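(* Let $d\ge2$, let $\mathbf{G}$ be a GLUE-scheme in $\mathbb{E}=\mathbb{R}^d$ with spread $n$, let $\mathbf{A},\mathbf{B}$ be its two associated linear schemes, and let $\alpha\in(0,1]$. If the chain $\mathbf{P}\in\mathbb{E}^{\ge n}$ is straightened by $\mathbf{G}$, and if both $\mathbf{A}$ and $\mathbf{B}$ are almost $C^{1,\alpha}$, then $\mathbf{G}$ is almost $C^{1,\alpha}$ at $\mathbf{P}$.
   Context: **Chains.** Let $\mathbb{N}=\{1,2,\dots\}$ and $\mathbb{E}:=\mathbb{R}^d$ with Euclidean norm $\|\cdot\|$; points are row vectors. $\mathbb{E}^N$ is the set of chains $\mathbf{P}=[p_0;\dots;p_{N-1}]$ of $N$ points $p_i\in\mathbb{E}$ (identified with $N\times d$ matrices); $\#\mathbf{P}:=N$; $\mathbb{E}^{\ge n}:=\bigcup_{N\ge n}\mathbb{E}^N$. Subchains: $T^n_i\mathbf{P}:=[p_i;\dots;p_{i+n-1}]$, $0\le i\le\#\mathbf{P}-n$, and $T^n\mathbf{P}$ is the set of all of these. Let $e:=[1,0,\dots,0]\in\mathbb{E}$, $\mathbf{E}_N:=[e;2e;\dots;Ne]$ and $\mathbf{e}:=\mathbf{E}_n$. Forward differences: $(\Delta\mathbf{P})_i:=p_{i+1}-p_i$, with iterates $\Delta^k$. Set $|\mathbf{P}|_0:=\max_i\|p_i\|$ and $|\mathbf{P}|_j:=|\Delta^j\mathbf{P}|_0$. Let $\mathbb{L}^n:=\{\mathbf{p}\in\mathbb{E}^n:\Delta^2\mathbf{p}=0\}$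 and let $\Pi:\mathbb{E}^n\to\mathbb{L}^n$ be the orthogonal projection with respect to $\langle\mathbf{p},\mathbf{q}\rangle_n=\sum_i\langle p_i,q_i\rangle$. The relative distortion of $\mathbf{p}\in\mathbb{E}^n$ is $\kappa(\mathbf{p}):=|\mathbf{p}|_2/|\Pi\mathbf{p}|_1$ if $\Delta\Pi\mathbf{p}\ne0$ and $\kappa(\mathbf{p}):=\infty$ otherwise; for $\mathbf{P}\in\mathbb{E}^{\ge n}$, $\kappa(\mathbf{P}):=\max\{\kappa(\mathbf{p}):\mathbf{p}\in T^n\mathbf{P}\}$. A similarity is a map $S(p)=\varrho pQ+s$ with $\varrho>0$, $Q\in\mathbb{R}^{d\times d}$ orthogonal, $s\in\mathbb{E}$; it acts on chains pointwise. **GLUE-schemes.** Let $m\in\mathbb{N}$ and $n=2m+1$. A map $\mathbf{G}:\mathbb{E}^{\ge n}\to\mathbb{E}^{\ge n}$ with $\#\mathbf{G}(\mathbf{P})=2\#\mathbf{P}-n+1$ is a GLUE-scheme with spread $n$ if: (G) $\mathbf{G}\circ S=S\circ\mathbf{G}$ for all similarities $S$; (L),(U) there are functions $g_0,g_1:\mathbb{E}^{m+1}\to\mathbb{E}$ such that $\mathbf{P}'=\mathbf{G}(\mathbf{P})$ has points $p'_{2i+\lambda}=g_\lambda(p_i,\dots,p_{i+m})$ for $\lambda\in\{0,1\}$, $0\le i<\#\mathbf{P}-m$, and $g_0,g_1$ are $C^{1,\nu}$ in a neighborhood of $\mathbf{E}_{m+1}$ for some $\nu>0$ (the regularity parameter);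 (E) $\mathbf{G}(\mathbf{e})=(\mathbf{E}_{n+1}+(m+\tau)e)/2$ for some $\tau\in[0,1)$ (the shift), where $(m+\tau)e$ is added to every point. Write $\mathbf{P}^\ell:=\mathbf{G}^\ell(\mathbf{P})$ with points $p^\ell_i$. The associated self-maps $\mathbf{g}_0,\mathbf{g}_1:\mathbb{E}^n\to\mathbb{E}^n$ are $\mathbf{g}_\lambda(\mathbf{p}):=T^n_\lambda\mathbf{G}(\mathbf{p})$, and $M_\lambda:=D\mathbf{g}_\lambda(\mathbf{e})$ is the derivative of $\mathbf{g}_\lambda$ at $\mathbf{e}$. **Straightening.** $\mathbf{P}$ is straightened by $\mathbf{G}$ if $\kappa(\mathbf{P}^\ell)\to0$ as $\ell\to\infty$ (finitely many infinite values allowed). **Limit curves and regularity.** For $N=\#\mathbf{P}$ let $I:=(0,N-n+1)$, $I_z:=[z,N-n+1-z]$ for $z>0$, $I^\ell_z:=\mathbb{N}\cap2^\ell I_z$, and $|\Phi|_z:=\max_{t\in I_z}\|\Phi(t)\|$. A GLUE-scheme is convergent at $\mathbf{P}$ if there is a continuous limit curve $\Phi[\mathbf{P}]:\mathbb{R}\to\mathbb{E}$ with $\lim_{\ell\to\infty}\sup_{i\in I^\ell_z}\|\Phi[\mathbf{P}](2^{-\ell}i)-p^\ell_i\|=0$ for every $z>0$. A curve $\Phi$ is $C^k$ if its $k$-th derivative $\partial^k\Phi$ exists and is continuous on $I$; it is $C^{k,\alpha}$ if moreover, for some $h_0>0$ and every $z>0$, $\sup_{0<h\le h_0}h^{-\alpha}\omega_z(\partial^k\Phi,h)<\infty$,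 where $\omega_z(\Psi,h):=|\Psi(\cdot+h/2)-\Psi(\cdot-h/2)|_{z+h/2}$. A GLUE-scheme is $C^{k,\alpha}$ at $\mathbf{P}$ if it is convergent at $\mathbf{P}$ and $\Phi[\mathbf{P}]$ is $C^{k,\alpha}$; it is almost $C^{k,\alpha}$ at $\mathbf{P}$ if it is $C^{k,\alpha'}$ at $\mathbf{P}$ for every $\alpha'<\alpha$ (with $\alpha'>0$). **Linear schemes.** A GLUE-scheme is linear if its rules have the form $a_\lambda(p_i,\dots,p_{i+m})=\sum_{j=0}^m a_{\lambda,j}p_{i+j}$, $\lambda\in\{0,1\}$, with real weights satisfying $\sum_j a_{\lambda,j}=1$; its self-maps are then $\mathbf{p}\mapsto A_\lambda\mathbf{p}$ with $n\times n$ matrices $A_0,A_1$. A linear scheme is called almost $C^{k,\alpha}$ if it is almost $C^{k,\alpha}$ at all $\mathbf{P}\in\mathbb{E}^{\ge n}$ and non-degenerate in the sense that a constant limit can only be attained for constant initial data. **Associated linear schemes ($d\ge2$).** By invariance under similarities there are real $n\times n$ matrices $A_\lambda,B_\lambda$, $\lambda\in\{0,1\}$, such that for every $\mathbf{d}=[\mathbf{d}_1,\mathbf{d}_2]\in\mathbb{E}^n$, partitioned into its first column $\mathbf{d}_1\in\mathbb{R}^{n\times1}$ and its remaining columns $\mathbf{d}_2\in\mathbb{R}^{n\times(d-1)}$, one has $M_\lambda\cdot\mathbf{d}=[A_\lambda\mathbf{d}_1,B_\lambda\mathbf{d}_2]$. The linear subdivision schemes corresponding to the pairs $(A_0,A_1)$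 and $(B_0,B_1)$ are denoted by $\mathbf{A}$ and $\mathbf{B}$. *)

theory Defs
  imports "HOL-Analysis.Analysis"
begin

text \<open>
  The ambient space is \<open>real ^ 'd\<close>; the linear order on the index type only serves to single out
  the first coordinate. A chain of \<open>N\<close> points is a list of length \<open>N\<close>, because chains of many
  different lengths occur in one and the same formula. Maps on chains are total functions on lists;
  nothing is ever required of their values at lists of the wrong length.
\<close>

type_synonym 'd chain = "(real ^ 'd) list"

section \<open>Chains\<close>

definition first_coord :: "'d::{finite,linorder}" where
  "first_coord = Min UNIV"

definition subchain :: "nat \<Rightarrow> nat \<Rightarrow> 'a list \<Rightarrow> 'a list" where
  "subchain n i P = take n (drop i P)"

definition subchains :: "nat \<Rightarrow> 'a list \<Rightarrow> 'a list set" where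
  "subchains n P = {subchain n i P | i. i + n \<le> length P}"

definition e_vec :: "real ^ 'd::{finite,linorder}" where
  "e_vec = axis first_coord 1"

definition E_chain :: "nat \<Rightarrow> 'd::{finite,linorder} chain" where
  "E_chain N = map (\<lambda>i. real (i + 1) *\<^sub>R e_vec) [0..<N]"

definition chain_add :: "'a::real_vector list \<Rightarrow> 'a list \<Rightarrow> 'a list" where
  "chain_add = map2 (+)"

definition chain_diff :: "'a::real_vector list \<Rightarrow> 'a list \<Rightarrow> 'a list" where
  "chain_diff = map2 (-)"

definition chain_scale :: "real \<Rightarrow> 'a::real_vector list \<Rightarrow> 'a list" where
  "chain_scale c = map (\<lambda>p. c *\<^sub>R p)"

definition fdiff :: "'a::real_vector list \<Rightarrow> 'a list" where
  "fdiff P = map (\<lambda>i. P ! (i + 1) - P ! i) [0..<length P - 1]"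

text \<open>\<open>chain_seminorm j P\<close> is \<open>|P|\<^sub>j\<close>; it is meaningful for \<open>length P > j\<close>.\<close>
definition chain_seminorm :: "nat \<Rightarrow> 'a::real_normed_vector list \<Rightarrow> real" where
  "chain_seminorm j P = Max (norm ` set ((fdiff ^^ j) P))"

definition chain_inner :: "'a::real_inner list \<Rightarrow> 'a list \<Rightarrow> real" where
  "chain_inner p q = (\<Sum>i<length p. p ! i \<bullet> q ! i)"

definition linear_chains :: "nat \<Rightarrow> 'a::real_vector list set" where
  "linear_chains n = {p. length p = n \<and> fdiff (fdiff p) = replicate (n - 2) 0}"

definition lin_proj :: "nat \<Rightarrow> 'a::real_inner list \<Rightarrow> 'a list" where
  "lin_proj n p = (THE q. q \<in> linear_chains n \<and>
      (\<forall>r\<in>linear_chains n. chain_inner (chain_diff p q) r = 0))"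

text \<open>Relative distortion, first of a chain of exactly \<open>n\<close> points, then of a longer chain.\<close>
definition distortion0 :: "nat \<Rightarrow> 'a::real_inner list \<Rightarrow> ereal" where
  "distortion0 n p =
     (if fdiff (lin_proj n p) \<noteq> replicate (n - 1) 0
      then ereal (chain_seminorm 2 p / chain_seminorm 1 (lin_proj n p)) else \<infinity>)"

definition distortion :: "nat \<Rightarrow> 'a::real_inner list \<Rightarrow> ereal" where
  "distortion n P = Max (distortion0 n ` subchains n P)"

text \<open>Points are row vectors, hence the product \<open>p v* Q\<close>.\<close>
definition similarity :: "(real ^ 'd \<Rightarrow> real ^ 'd) \<Rightarrow> bool" where
  "similarity S \<longleftrightarrow> (\<exists>\<rho> Q s. \<rho> > 0 \<and> orthogonal_matrix Q \<and> S = (\<lambda>p. \<rho> *\<^sub>R (p v* Q) + s))"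


section \<open>Differentiation on spaces of chains\<close>

definition chain_linear :: "nat \<Rightarrow> ('a::real_vector list \<Rightarrow> 'b::real_vector) \<Rightarrow> bool" where
  "chain_linear N D \<longleftrightarrow>
     (\<forall>p q. length p = N \<longrightarrow> length q = N \<longrightarrow> D (chain_add p q) = D p + D q) \<and>
     (\<forall>c p. length p = N \<longrightarrow> D (chain_scale c p) = c *\<^sub>R D p)"

text \<open>Frechet derivative at \<open>p\<close> of a map defined near \<open>p\<close> in the space of chains with
  \<open>length p\<close> points, normed by \<open>|\<cdot>|\<^sub>0\<close>.\<close>
definition has_chain_derivative ::
  "('a::real_normed_vector list \<Rightarrow> 'b::real_normed_vector) \<Rightarrow> ('a list \<Rightarrow> 'b) \<Rightarrow> 'a list \<Rightarrow> bool" where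
  "has_chain_derivative F D p \<longleftrightarrow> chain_linear (length p) D \<and>
     (\<forall>\<epsilon>>0. \<exists>\<delta>>0. \<forall>d. length d = length p \<longrightarrow> chain_seminorm 0 d < \<delta> \<longrightarrow>
        norm (F (chain_add p d) - F p - D d) \<le> \<epsilon> * chain_seminorm 0 d)"

text \<open>\<open>F\<close> is of class \<open>C\<^sup>1\<close> with \<open>\<nu>\<close>-Hoelder continuous derivative on some ball around \<open>p0\<close>.\<close>
definition C1_holder_near ::
  "real \<Rightarrow> ('a::real_normed_vector list \<Rightarrow> 'b::real_normed_vector) \<Rightarrow> 'a list \<Rightarrow> bool" where
  "C1_holder_near \<nu> F p0 \<longleftrightarrow>
     (\<exists>r>0. \<exists>D C. let U = {p. length p = length p0 \<and> chain_seminorm 0 (chain_diff p p0) < r} in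
        (\<forall>p\<in>U. has_chain_derivative F (D p) p) \<and>
        (\<forall>p\<in>U. \<forall>q\<in>U. \<forall>d. length d = length p0 \<longrightarrow>
           norm (D p d - D q d) \<le> C * chain_seminorm 0 (chain_diff p q) powr \<nu> * chain_seminorm 0 d))"


section \<open>GLUE-schemes\<close>

text \<open>The spread is \<open>n = 2 * m + 1\<close>; the two rules are \<open>g 0\<close> and \<open>g 1\<close>, and \<open>\<mu>\<close> runs
  through the parities \<open>0, 1\<close>.\<close>
definition glue_scheme :: "nat \<Rightarrow> ('d::{finite,linorder} chain \<Rightarrow> 'd chain) \<Rightarrow> bool" where
  "glue_scheme m G \<longleftrightarrow> m \<ge> 1 \<and> (let n = 2 * m + 1 in
     (\<forall>P. length P \<ge> n \<longrightarrow> length (G P) = 2 * length P + 1 - n) \<and>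
     (\<forall>S P. similarity S \<longrightarrow> length P \<ge> n \<longrightarrow> G (map S P) = map S (G P)) \<and>
     (\<exists>g.
        (\<forall>P. length P \<ge> n \<longrightarrow> (\<forall>\<mu>\<in>{0, 1}. \<forall>i < length P - m.
            G P ! (2 * i + \<mu>) = g \<mu> (subchain (m + 1) i P))) \<and>
        (\<exists>\<nu>>0. \<forall>\<mu>\<in>{0, 1}. C1_holder_near \<nu> (g \<mu>) (E_chain (m + 1)))) \<and>
     (\<exists>\<tau>. 0 \<le> \<tau> \<and> \<tau> < 1 \<and>
        G (E_chain n) = map (\<lambda>p. (1 / 2) *\<^sub>R (p + (real m + \<tau>) *\<^sub>R e_vec)) (E_chain (n + 1))))"

definition self_map :: "nat \<Rightarrow> ('a list \<Rightarrow> 'a list) \<Rightarrow> nat \<Rightarrow> 'a list \<Rightarrow> 'a list" where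
  "self_map m G \<mu> p = subchain (2 * m + 1) \<mu> (G p)"

definition straightened :: "nat \<Rightarrow> ('a::real_inner list \<Rightarrow> 'a list) \<Rightarrow> 'a list \<Rightarrow> bool" where
  "straightened m G P \<longleftrightarrow> (\<lambda>l. distortion (2 * m + 1) ((G ^^ l) P)) \<longlonglongrightarrow> 0"


section \<open>Limit curves and their regularity\<close>

text \<open>In this section \<open>L\<close> is the length \<open>N - n + 1\<close> of the parameter interval \<open>(0, L)\<close> on which the
  limit curve is determined by the chain. Suprema are taken in \<open>ennreal\<close>, so that those over the
  empty set (when \<open>z\<close> is large) are \<open>0\<close>.\<close>

definition inner_interval :: "real \<Rightarrow> real \<Rightarrow> real set" where
  "inner_interval L z = {z..L - z}"

definition curve_norm :: "real \<Rightarrow> real \<Rightarrow> (real \<Rightarrow> 'a::real_normed_vector) \<Rightarrow> ennreal" where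
  "curve_norm L z \<Phi> = (SUP t\<in>inner_interval L z. ennreal (norm (\<Phi> t)))"

definition param_length :: "nat \<Rightarrow> 'a list \<Rightarrow> real" where
  "param_length m P = real (length P) - real (2 * m + 1) + 1"

definition limit_curve ::
  "nat \<Rightarrow> ('a::real_normed_vector list \<Rightarrow> 'a list) \<Rightarrow> 'a list \<Rightarrow> (real \<Rightarrow> 'a) \<Rightarrow> bool" where
  "limit_curve m G P \<Phi> \<longleftrightarrow> continuous_on UNIV \<Phi> \<and>
     (\<forall>z>0. (\<lambda>l. SUP i\<in>{i::nat. i \<ge> 1 \<and> real i \<in> (\<lambda>t. 2 ^ l * t) ` inner_interval (param_length m P) z}.
               ennreal (norm (\<Phi> (real i / 2 ^ l) - (G ^^ l) P ! i))) \<longlonglongrightarrow> 0)"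

definition curve_deriv :: "nat \<Rightarrow> (real \<Rightarrow> 'a::real_normed_vector) \<Rightarrow> real \<Rightarrow> 'a" where
  "curve_deriv k = (\<lambda>\<Phi> t. vector_derivative \<Phi> (at t)) ^^ k"

definition Ck_curve :: "real \<Rightarrow> nat \<Rightarrow> (real \<Rightarrow> 'a::real_normed_vector) \<Rightarrow> bool" where
  "Ck_curve L k \<Phi> \<longleftrightarrow>
     (\<forall>j<k. \<forall>t\<in>{0<..<L}. curve_deriv j \<Phi> differentiable (at t)) \<and>
     continuous_on {0<..<L} (curve_deriv k \<Phi>)"

definition modulus :: "real \<Rightarrow> real \<Rightarrow> (real \<Rightarrow> 'a::real_normed_vector) \<Rightarrow> real \<Rightarrow> ennreal" where
  "modulus L z \<Psi> h = curve_norm L (z + h / 2) (\<lambda>t. \<Psi> (t + h / 2) - \<Psi> (t - h / 2))"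

definition Ck_holder_curve :: "real \<Rightarrow> nat \<Rightarrow> real \<Rightarrow> (real \<Rightarrow> 'a::real_normed_vector) \<Rightarrow> bool" where
  "Ck_holder_curve L k \<alpha> \<Phi> \<longleftrightarrow> Ck_curve L k \<Phi> \<and>
     (\<exists>h0>0. \<forall>z>0. (SUP h\<in>{0<..h0}. ennreal (h powr (- \<alpha>)) * modulus L z (curve_deriv k \<Phi>) h) < \<infinity>)"

text \<open>The limit curve is unique on \<open>(0, L)\<close>, the only place where its regularity is tested.\<close>
definition Ck_holder_at ::
  "nat \<Rightarrow> real \<Rightarrow> nat \<Rightarrow> ('a::real_normed_vector list \<Rightarrow> 'a list) \<Rightarrow> 'a list \<Rightarrow> bool" where
  "Ck_holder_at k \<alpha> m G P \<longleftrightarrow>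
     (\<exists>\<Phi>. limit_curve m G P \<Phi> \<and> Ck_holder_curve (param_length m P) k \<alpha> \<Phi>)"

definition almost_Ck_holder_at ::
  "nat \<Rightarrow> real \<Rightarrow> nat \<Rightarrow> ('a::real_normed_vector list \<Rightarrow> 'a list) \<Rightarrow> 'a list \<Rightarrow> bool" where
  "almost_Ck_holder_at k \<alpha> m G P \<longleftrightarrow> (\<forall>\<alpha>'. 0 < \<alpha>' \<and> \<alpha>' < \<alpha> \<longrightarrow> Ck_holder_at k \<alpha>' m G P)"


section \<open>Linear schemes\<close>

text \<open>Only the form of the rules is recorded here. The linear schemes associated with a GLUE-scheme
  are themselves GLUE-schemes, as a consequence of its invariance under similarities.\<close>
definition linear_scheme :: "nat \<Rightarrow> ('a::real_vector list \<Rightarrow> 'a list) \<Rightarrow> bool" where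
  "linear_scheme m G \<longleftrightarrow> (\<exists>a :: nat \<Rightarrow> nat \<Rightarrow> real.
     (\<forall>\<mu>\<in>{0, 1}. (\<Sum>j\<le>m. a \<mu> j) = 1) \<and>
     (\<forall>P. length P \<ge> 2 * m + 1 \<longrightarrow> length (G P) = 2 * length P + 1 - (2 * m + 1) \<and>
        (\<forall>\<mu>\<in>{0, 1}. \<forall>i < length P - m.
           G P ! (2 * i + \<mu>) = (\<Sum>j\<le>m. a \<mu> j *\<^sub>R P ! (i + j)))))"

definition non_degenerate :: "nat \<Rightarrow> ('a::real_normed_vector list \<Rightarrow> 'a list) \<Rightarrow> bool" where
  "non_degenerate m G \<longleftrightarrow> (\<forall>P \<Phi>. length P \<ge> 2 * m + 1 \<longrightarrow> limit_curve m G P \<Phi> \<longrightarrow>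
     (\<exists>c. \<forall>t\<in>{0<..<param_length m P}. \<Phi> t = c) \<longrightarrow> (\<exists>c. \<forall>p\<in>set P. p = c))"

definition almost_Ck_holder_linear ::
  "nat \<Rightarrow> real \<Rightarrow> nat \<Rightarrow> ('a::real_normed_vector list \<Rightarrow> 'a list) \<Rightarrow> bool" where
  "almost_Ck_holder_linear k \<alpha> m G \<longleftrightarrow>
     (\<forall>P. length P \<ge> 2 * m + 1 \<longrightarrow> almost_Ck_holder_at k \<alpha> m G P) \<and> non_degenerate m G"

text \<open>In the remaining definitions a pair of \<open>n \<times> n\<close> matrices, \<open>n = 2 * m + 1\<close>, is a function
  \<open>A\<close> whose value \<open>A \<mu> i j\<close>, for \<open>i, j < n\<close>, is the entry of \<open>A\<^sub>\<mu>\<close> in row \<open>i\<close> and column \<open>j\<close>.\<close>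

text \<open>The linear scheme \<open>S\<close> corresponds to the pair \<open>A\<close>: its self-maps are the multiplications by
  \<open>A 0\<close> and \<open>A 1\<close>. This determines \<open>S\<close> on all chains of at least \<open>n\<close> points.\<close>
definition linear_scheme_of ::
  "nat \<Rightarrow> (nat \<Rightarrow> nat \<Rightarrow> nat \<Rightarrow> real) \<Rightarrow> ('a::real_vector list \<Rightarrow> 'a list) \<Rightarrow> bool" where
  "linear_scheme_of m A S \<longleftrightarrow> linear_scheme m S \<and>
     (\<forall>\<mu>\<in>{0, 1}. \<forall>p. length p = 2 * m + 1 \<longrightarrow>
        self_map m S \<mu> p = map (\<lambda>i. \<Sum>j<2 * m + 1. A \<mu> i j *\<^sub>R p ! j) [0..<2 * m + 1])"

text \<open>The map taking \<open>d = [d\<^sub>1, d\<^sub>2]\<close> to \<open>[A\<^sub>\<mu> d\<^sub>1, B\<^sub>\<mu> d\<^sub>2]\<close>, where \<open>d\<^sub>1\<close> is the first column of \<open>d\<close>.\<close>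
definition split_action ::
  "nat \<Rightarrow> (nat \<Rightarrow> nat \<Rightarrow> real) \<Rightarrow> (nat \<Rightarrow> nat \<Rightarrow> real) \<Rightarrow>
     'd::{finite,linorder} chain \<Rightarrow> 'd chain" where
  "split_action n A B d =
     map (\<lambda>i. \<chi> k. if k = first_coord then (\<Sum>j<n. A i j * (d ! j $ k))
                   else (\<Sum>j<n. B i j * (d ! j $ k))) [0..<n]"

text \<open>The derivatives of the two self-maps of \<open>G\<close> at \<open>E_chain n\<close> (taken point by point of the
  image chain) are given by the pairs \<open>A\<close> and \<open>B\<close>.\<close>
definition associated_matrices ::
  "nat \<Rightarrow> ('d::{finite,linorder} chain \<Rightarrow> 'd chain) \<Rightarrow>
     (nat \<Rightarrow> nat \<Rightarrow> nat \<Rightarrow> real) \<Rightarrow> (nat \<Rightarrow> nat \<Rightarrow> nat \<Rightarrow> real) \<Rightarrow> bool" where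
  "associated_matrices m G A B \<longleftrightarrow> (\<forall>\<mu>\<in>{0, 1}. \<forall>i<2 * m + 1.
     has_chain_derivative (\<lambda>p. self_map m G \<mu> p ! i)
       (\<lambda>d. split_action (2 * m + 1) (A \<mu>) (B \<mu>) d ! i) (E_chain (2 * m + 1)))"

end

theory Submission
  imports Defs
begin

text \<open>
  Second differences govern the regularity of the limit curve: if they decay like
  \<open>2\<close> to the power \<open>-(1 + \<beta>) l\<close>, the normalized first differences converge uniformly to a
  \<open>\<beta>\<close>-Hoelder curve, which is the derivative of the limit.

  For the linear schemes this rate is necessary. By non-degeneracy a chain of \<open>n\<close> points is bounded
  by finitely many values of its limit curve. The limit curve belonging to a subchain at level \<open>r\<close>
  is a piece of length \<open>2\<close> to the power \<open>-r\<close> of the original one, so that up to an affine function,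
  which the scheme reproduces, it is of size \<open>2\<close> to the power \<open>-(1 + \<beta>) r\<close>.

  For the GLUE-scheme, a subchain with small relative distortion is the image of a small perturbation
  \<open>e + d\<close> of \<open>e\<close> under a similarity \<open>S\<close>, and \<open>r\<close> steps starting from \<open>e + d\<close> differ from
  \<open>r\<close> steps starting from \<open>e\<close> by \<open>r\<close> linear steps applied to \<open>d\<close>, up to \<open>o(d)\<close>. Fixing \<open>r\<close>
  first and then making the distortion small, the error is absorbed by an arbitrarily small loss
  in the exponent.
\<close>

section \<open>Local schemes\<close>

text \<open>Reproduction of affine data has to be derived for both associated schemes, since a
  linear scheme by definition reproduces constants only. It comes from equivariance: a line that is
  stretched and slightly rotated is still similar to the original one, so its image under the scheme
  is known exactly, and comparison with the derivative yields the first moments of the weights.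
  Non-degeneracy is a qualitative statement. Finite dimension turns it into a bound, by functionals
  dual to the limits of unit data. The nonlinear argument proceeds in blocks of \<open>r\<close>
  steps because each linear estimate loses a constant. Lowering the exponent from
  \<open>\<beta>1\<close> to \<open>\<beta>\<close> gives room: for large \<open>r\<close> the
  linear part takes at most half of the admissible factor, and the other half is left for the
  linearization error. That error must be proportional to the second differences rather than to the
  size of the chain. This holds because, in a frame adapted to the first two points of a window, the
  deviation from a line is bounded by second differences alone.\<close>

definition local_scheme :: "nat \<Rightarrow> ('a list \<Rightarrow> 'a list) \<Rightarrow> bool" where
  "local_scheme m G \<longleftrightarrow>
     (\<forall>P. length P \<ge> 2 * m + 1 \<longrightarrow> length (G P) = 2 * length P + 1 - (2 * m + 1)) \<and>
     (\<exists>g. \<forall>P. length P \<ge> 2 * m + 1 \<longrightarrow> (\<forall>\<mu>\<in>{0, 1}. \<forall>i < length P - m.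
            G P ! (2 * i + \<mu>) = g \<mu> (subchain (m + 1) i P)))"

lemma length_subchain: "k + n \<le> length P \<Longrightarrow> length (subchain n k P) = n"
  by (simp add: subchain_def)

lemma nth_subchain: "k + n \<le> length P \<Longrightarrow> i < n \<Longrightarrow> subchain n k P ! i = P ! (k + i)"
  by (simp add: subchain_def)

lemma subchain_subchain:
  "a + n' \<le> n \<Longrightarrow> subchain n' a (subchain n k P) = subchain n' (k + a) P"
  by (simp add: subchain_def drop_take min_def add.commute)

text \<open>\<open>L\<close> is the length of the parameter interval. In terms of \<open>L\<close>
  the length rule is plain doubling, while \<open>2 * m\<close> extra points persist at every
  level.\<close>

lemma local_scheme_length_iter:
  assumes "local_scheme m G" "length P = L + 2 * m" "L \<ge> 1"
  shows "length ((G ^^ r) P) = 2 ^ r * L + 2 * m"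
proof (induction r)
  case (Suc r)
  have "length ((G ^^ r) P) \<ge> 2 * m + 1"
    using Suc assms by (simp add: Suc_le_eq)
  then have "length (G ((G ^^ r) P)) = 2 * length ((G ^^ r) P) + 1 - (2 * m + 1)"
    using assms(1) unfolding local_scheme_def by blast
  then show ?case using Suc by simp
qed (use assms in simp)

text \<open>The point at position \<open>2 * a + b\<close> depends on \<open>m + 1\<close>
  consecutive points starting at \<open>a\<close>. For \<open>a \<le> m\<close> these lie in a
  window of \<open>2 * m + 1\<close> points, so a window fixes all \<open>2 * m + 2\<close> points
  of its image.\<close>

lemma local_scheme_shift:
  assumes G: "local_scheme m G" and k: "k + (2 * m + 1) \<le> length P" and j: "j \<le> 2 * m + 1"
  shows "G P ! (2 * k + j) = G (subchain (2 * m + 1) k P) ! j"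
proof -
  obtain g where g: "\<And>P \<mu> i. length P \<ge> 2 * m + 1 \<Longrightarrow> \<mu> \<in> {0, 1} \<Longrightarrow> i < length P - m \<Longrightarrow>
            G P ! (2 * i + \<mu>) = g \<mu> (subchain (m + 1) i P)"
    using G unfolding local_scheme_def by blast
  define a b where "a = j div 2" and "b = j mod 2"
  have ab: "j = 2 * a + b" "b \<in> {0, 1}" "a \<le> m" using j by (auto simp: a_def b_def)
  have "G P ! (2 * (k + a) + b) = g b (subchain (m + 1) (k + a) P)"
    using k ab by (intro g) auto
  moreover have "G (subchain (2 * m + 1) k P) ! (2 * a + b) =
      g b (subchain (m + 1) a (subchain (2 * m + 1) k P))"
    using k ab by (intro g) (auto simp: length_subchain)
  moreover have "subchain (m + 1) a (subchain (2 * m + 1) k P) = subchain (m + 1) (k + a) P"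
    using ab by (intro subchain_subchain) auto
  ultimately show ?thesis using ab by (simp add: algebra_simps)
qed

text \<open>After \<open>r\<close> steps a chain of \<open>2 * m + 1\<close> points has
  \<open>2 ^ r\<close> windows of that length. Each point of the next level lies in the image of one
  of them: \<open>a\<close> is the window, \<open>b\<close> the place in its image.\<close>

lemma dyadic_split:
  fixes r m j :: nat
  assumes "j < 2 ^ Suc r + 2 * m"
  obtains a b where "j = 2 * a + b" "a < 2 ^ r" "b \<le> 2 * m + 1"
proof (cases "j div 2 < 2 ^ r")
  case True
  have "j = 2 * (j div 2) + j mod 2" "j mod 2 \<le> 2 * m + 1" by auto
  then show ?thesis using that True by blast
next
  case False
  have "(1::nat) \<le> 2 ^ r" by simp
  then obtain q :: nat where q: "2 ^ r = Suc q" by (metis Suc_le_D One_nat_def)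
  have "j \<ge> 2 ^ Suc r" using False by auto
  \<comment> \<open>Indices beyond the last window start are assigned to the last window
    \<open>2 ^ r - 1\<close>; this is where \<open>b\<close> may exceed 1.\<close>
  then have "j = 2 * (2 ^ r - 1) + (j + 2 - 2 ^ Suc r)" by (simp add: q)
  moreover have "2 ^ r - 1 < (2::nat) ^ r"
    "j + 2 - 2 ^ Suc r \<le> 2 * m + 1"
    using assms by (auto simp: q)
  ultimately show ?thesis using that by blast
qed

text \<open>At level \<open>r\<close> the window of the whole chain at \<open>2 ^ r * k + a\<close>
  coincides with window \<open>a\<close> of the refined subchain, and one further step depends on
  that window only.\<close>

lemma local_scheme_iter_shift:
  assumes G: "local_scheme m G" and k: "k + (2 * m + 1) \<le> length P" and j: "j < 2 ^ r + 2 * m"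
  shows "(G ^^ r) P ! (2 ^ r * k + j) = (G ^^ r) (subchain (2 * m + 1) k P) ! j"
  using j
proof (induction r arbitrary: j)
  case 0
  then show ?case using k by (simp add: nth_subchain)
next
  case (Suc r)
  obtain a b where ab: "j = 2 * a + b" "a < 2 ^ r" "b \<le> 2 * m + 1"
    using dyadic_split[OF Suc.prems] .
  let ?Q = "subchain (2 * m + 1) k P"
  define L where "L = length P - 2 * m"
  have L: "length P = L + 2 * m" "L \<ge> k + 1" using k by (auto simp: L_def)
  have lenP: "length ((G ^^ r) P) = 2 ^ r * L + 2 * m"
    using local_scheme_length_iter[OF G] L by simp
  have lenQ: "length ((G ^^ r) ?Q) = 2 ^ r + 2 * m"
    using local_scheme_length_iter[OF G, of ?Q 1 r] k by (simp add: length_subchain)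
  have "2 ^ r * (k + 1) \<le> 2 ^ r * L" using L(2) by (intro mult_left_mono) auto
  then have ka: "2 ^ r * k + a + (2 * m + 1) \<le> length ((G ^^ r) P)"
    using ab(2) by (simp add: lenP)
  have a': "a + (2 * m + 1) \<le> length ((G ^^ r) ?Q)" using ab lenQ by simp
  have eq: "subchain (2 * m + 1) (2 ^ r * k + a) ((G ^^ r) P) = subchain (2 * m + 1) a ((G ^^ r) ?Q)"
  proof (rule nth_equalityI)
    show "length (subchain (2 * m + 1) (2 ^ r * k + a) ((G ^^ r) P)) =
          length (subchain (2 * m + 1) a ((G ^^ r) ?Q))"
      using ka a' by (simp add: length_subchain)
    fix i assume "i < length (subchain (2 * m + 1) (2 ^ r * k + a) ((G ^^ r) P))"
    then have i: "i < 2 * m + 1" using length_subchain[OF ka] by simp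
    have "(G ^^ r) P ! (2 ^ r * k + (a + i)) = (G ^^ r) ?Q ! (a + i)"
      using ab i by (intro Suc.IH) auto
    then show "subchain (2 * m + 1) (2 ^ r * k + a) ((G ^^ r) P) ! i =
          subchain (2 * m + 1) a ((G ^^ r) ?Q) ! i"
      using nth_subchain[OF ka i] nth_subchain[OF a' i] by (simp add: add.assoc)
  qed
  have "(G ^^ Suc r) P ! (2 ^ Suc r * k + j) = G ((G ^^ r) P) ! (2 * (2 ^ r * k + a) + b)"
    by (simp add: ab algebra_simps)
  also have "\<dots> = G (subchain (2 * m + 1) (2 ^ r * k + a) ((G ^^ r) P)) ! b"
    using local_scheme_shift[OF G ka ab(3)] .
  also have "\<dots> = G ((G ^^ r) ?Q) ! (2 * a + b)"
    unfolding eq using local_scheme_shift[OF G a' ab(3)] by simp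
  finally show ?case by (simp add: ab)
qed


section \<open>Linear schemes\<close>

text \<open>Scalar refinement acts on infinite sequences, so that linearity and shifts hold without
  conditions on lengths. \<open>lin_sub_iter_cong\<close> restricts attention to the entries that a
  chain provides.\<close>

definition lin_sub :: "nat \<Rightarrow> (nat \<Rightarrow> nat \<Rightarrow> real) \<Rightarrow> (nat \<Rightarrow> real) \<Rightarrow> nat \<Rightarrow> real" where
  "lin_sub m a x k = (\<Sum>j\<le>m. a (k mod 2) j * x (k div 2 + j))"

lemma lin_sub_shift: "lin_sub m a (\<lambda>i. x (c + i)) k = lin_sub m a x (2 * c + k)"
  by (simp add: lin_sub_def add.assoc)

lemma lin_sub_iter_shift:
  "(lin_sub m a ^^ r) (\<lambda>i. x (c + i)) k = (lin_sub m a ^^ r) x (2 ^ r * c + k)"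
proof (induction r arbitrary: k)
  case (Suc r)
  have "(lin_sub m a ^^ r) (\<lambda>i. x (c + i)) = (\<lambda>k. (lin_sub m a ^^ r) x (2 ^ r * c + k))"
    by (rule ext) (rule Suc)
  then show ?case by (simp add: lin_sub_shift mult.assoc)
qed simp

lemma lin_sub_linear:
  "lin_sub m a (\<lambda>i. s * x i + t * y i) k = s * lin_sub m a x k + t * lin_sub m a y k"
  by (simp add: lin_sub_def algebra_simps sum.distrib sum_distrib_left)

lemma lin_sub_iter_linear:
  "(lin_sub m a ^^ r) (\<lambda>i. s * x i + t * y i) k =
     s * (lin_sub m a ^^ r) x k + t * (lin_sub m a ^^ r) y k"
proof (induction r arbitrary: k)
  case (Suc r)
  have "(lin_sub m a ^^ r) (\<lambda>i. s * x i + t * y i) =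
      (\<lambda>k. s * (lin_sub m a ^^ r) x k + t * (lin_sub m a ^^ r) y k)"
    by (rule ext) (rule Suc)
  then show ?case by (simp add: lin_sub_linear)
qed simp

lemma lin_sub_iter_scale: "(lin_sub m a ^^ r) (\<lambda>i. s * x i) k = s * (lin_sub m a ^^ r) x k"
  using lin_sub_iter_linear[of r m a s x 0 x k] by simp

lemma lin_sub_iter_sum:
  assumes "finite J"
  shows "(lin_sub m a ^^ r) (\<lambda>i. \<Sum>j\<in>J. c j * x j i) k = (\<Sum>j\<in>J. c j * (lin_sub m a ^^ r) (x j) k)"
  using assms
proof (induction J)
  case empty
  show ?case using lin_sub_iter_scale[of r m a 0 "\<lambda>_. 0" k] by simp
next
  case (insert j J)
  then show ?case
    using lin_sub_iter_linear[of r m a "c j" "x j" 1 "\<lambda>i. \<Sum>j\<in>J. c j * x j i" k] by simp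
qed

lemma lin_sub_iter_cong:
  assumes "\<And>i. i < L + 2 * m \<Longrightarrow> x i = y i" "k < 2 ^ r * L + 2 * m"
  shows "(lin_sub m a ^^ r) x k = (lin_sub m a ^^ r) y k"
  using assms(2)
proof (induction r arbitrary: k)
  case (Suc r)
  have "(lin_sub m a ^^ r) x (k div 2 + j) = (lin_sub m a ^^ r) y (k div 2 + j)" if "j \<le> m" for j
    using Suc.prems that by (intro Suc.IH) auto
  then have "lin_sub m a ((lin_sub m a ^^ r) x) k = lin_sub m a ((lin_sub m a ^^ r) y) k"
    unfolding lin_sub_def by (intro sum.cong) auto
  then show ?case by simp
qed (use assms in simp)

lemma lin_sub_bound:
  assumes "\<And>\<mu>. \<mu> \<in> {0, 1} \<Longrightarrow> (\<Sum>j\<le>m. \<bar>a \<mu> j\<bar>) \<le> K"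
    and "\<And>j. j \<le> m \<Longrightarrow> \<bar>x (k div 2 + j)\<bar> \<le> c" and "c \<ge> 0"
  shows "\<bar>lin_sub m a x k\<bar> \<le> K * c"
proof -
  have "\<bar>lin_sub m a x k\<bar> \<le> (\<Sum>j\<le>m. \<bar>a (k mod 2) j\<bar> * c)"
    unfolding lin_sub_def using assms(2)
    by (intro order.trans[OF sum_abs] sum_mono) (auto simp: abs_mult intro!: mult_left_mono)
  also have "\<dots> \<le> K * c"
    unfolding sum_distrib_right[symmetric]
    by (intro mult_right_mono assms(1,3)) auto
  finally show ?thesis .
qed

text \<open>A crude bound with exponential growth, good for the finitely many levels that precede
  the asymptotic regime.\<close>

lemma lin_sub_iter_bound:
  assumes K: "\<And>\<mu>. \<mu> \<in> {0, 1} \<Longrightarrow> (\<Sum>j\<le>m. \<bar>a \<mu> j\<bar>) \<le> K"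
    and x: "\<And>i. i < L + 2 * m \<Longrightarrow> \<bar>x i\<bar> \<le> c" and c: "c \<ge> 0" and "k < 2 ^ r * L + 2 * m"
  shows "\<bar>(lin_sub m a ^^ r) x k\<bar> \<le> K ^ r * c"
  using assms(4)
proof (induction r arbitrary: k)
  case (Suc r)
  have "0 \<le> (\<Sum>j\<le>m. \<bar>a 0 j\<bar>)" by (simp add: sum_nonneg)
  also have "\<dots> \<le> K" by (rule K) simp
  finally have "K \<ge> 0" .
  have "\<bar>lin_sub m a ((lin_sub m a ^^ r) x) k\<bar> \<le> K * (K ^ r * c)"
  proof (rule lin_sub_bound[OF K])
    fix j assume "j \<le> m"
    then show "\<bar>(lin_sub m a ^^ r) x (k div 2 + j)\<bar> \<le> K ^ r * c"
      using Suc.prems by (intro Suc.IH) auto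
  qed (use \<open>K \<ge> 0\<close> c in auto)
  then show ?case by simp
qed (use x in simp)

text \<open>The two assumptions prescribe the zeroth and first moments of both rules. The same
  \<open>\<sigma>\<close> for both parities makes even and odd points fall on one line.\<close>

lemma lin_sub_affine:
  assumes "\<And>\<mu>. \<mu> \<in> {0, 1} \<Longrightarrow> (\<Sum>j\<le>m. a \<mu> j) = 1"
    and "\<And>\<mu>. \<mu> \<in> {0, 1} \<Longrightarrow> (\<Sum>j\<le>m. a \<mu> j * real j) = (real \<mu> + \<sigma>) / 2"
  shows "lin_sub m a (\<lambda>i. \<beta> + \<gamma> * real i) k = \<beta> + \<gamma> * (real k + \<sigma>) / 2"
proof -
  let ?\<mu> = "k mod 2"
  have \<mu>: "?\<mu> \<in> {0, 1}" by auto
  have k: "real k = 2 * real (k div 2) + real ?\<mu>"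
    by (metis of_nat_add of_nat_mult of_nat_numeral mult_div_mod_eq)
  have "lin_sub m a (\<lambda>i. \<beta> + \<gamma> * real i) k =
     (\<beta> + \<gamma> * real (k div 2)) * (\<Sum>j\<le>m. a ?\<mu> j) + \<gamma> * (\<Sum>j\<le>m. a ?\<mu> j * real j)"
    by (simp add: lin_sub_def algebra_simps sum.distrib sum_distrib_left)
  then show ?thesis using assms(1)[OF \<mu>] assms(2)[OF \<mu>] k by (simp add: field_simps)
qed

text \<open>The shift accumulates as a geometric sum, \<open>\<sigma>\<close> times 1/2 + 1/4 + ...
  up to \<open>1 / 2 ^ r\<close>.\<close>

lemma lin_sub_iter_affine:
  assumes "\<And>\<mu>. \<mu> \<in> {0, 1} \<Longrightarrow> (\<Sum>j\<le>m. a \<mu> j) = 1"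
    and "\<And>\<mu>. \<mu> \<in> {0, 1} \<Longrightarrow> (\<Sum>j\<le>m. a \<mu> j * real j) = (real \<mu> + \<sigma>) / 2"
  shows "(lin_sub m a ^^ r) (\<lambda>i. \<beta> + \<gamma> * real i) =
    (\<lambda>k. \<beta> + \<gamma> * (real k / 2 ^ r + \<sigma> * (1 - 1 / 2 ^ r)))"
proof (induction r)
  case (Suc r)
  have "(lin_sub m a ^^ Suc r) (\<lambda>i. \<beta> + \<gamma> * real i) =
     lin_sub m a (\<lambda>k. (\<beta> + \<gamma> * (\<sigma> * (1 - 1 / 2 ^ r))) + \<gamma> / 2 ^ r * real k)"
    by (simp add: Suc algebra_simps)
  also have "\<dots> = (\<lambda>k. (\<beta> + \<gamma> * (\<sigma> * (1 - 1 / 2 ^ r))) + \<gamma> / 2 ^ r * (real k + \<sigma>) / 2)"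
    by (intro ext lin_sub_affine assms) auto
  also have "\<dots> = (\<lambda>k. \<beta> + \<gamma> * (real k / 2 ^ Suc r + \<sigma> * (1 - 1 / 2 ^ Suc r)))"
    by (rule ext) (simp add: divide_simps, simp add: algebra_simps)
  finally show ?case .
qed simp

lemma linear_scheme_iter:
  fixes S :: "(real ^ 'd) list \<Rightarrow> (real ^ 'd) list"
  assumes S: "\<And>P. length P \<ge> 2 * m + 1 \<Longrightarrow> length (S P) = 2 * length P + 1 - (2 * m + 1) \<and>
        (\<forall>\<mu>\<in>{0, 1}. \<forall>i < length P - m. S P ! (2 * i + \<mu>) = (\<Sum>j\<le>m. a \<mu> j *\<^sub>R P ! (i + j)))"
    and P: "length P = L + 2 * m" "L \<ge> 1"
  shows "length ((S ^^ r) P) = 2 ^ r * L + 2 * m \<and>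
    (\<forall>k < 2 ^ r * L + 2 * m. (S ^^ r) P ! k $ c = (lin_sub m a ^^ r) (\<lambda>i. P ! i $ c) k)"
proof (induction r)
  case (Suc r)
  let ?Q = "(S ^^ r) P"
  have len: "length ?Q = 2 ^ r * L + 2 * m" using Suc by blast
  have "1 \<le> 2 ^ r * L" using P(2) by (simp add: Suc_le_eq)
  then have ge: "length ?Q \<ge> 2 * m + 1" using len by linarith
  have "(S ^^ Suc r) P ! k $ c = (lin_sub m a ^^ Suc r) (\<lambda>i. P ! i $ c) k"
    if "k < 2 ^ Suc r * L + 2 * m" for k
  proof -
    have k: "k = 2 * (k div 2) + k mod 2" "k mod 2 \<in> {0, 1}" by auto
    have lt: "k div 2 < length ?Q - m" using that len by auto
    have "S ?Q ! (2 * (k div 2) + k mod 2) = (\<Sum>j\<le>m. a (k mod 2) j *\<^sub>R ?Q ! (k div 2 + j))"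
      using bspec[OF conjunct2[OF S[OF ge]] k(2)] lt by blast
    then have "S ?Q ! k = (\<Sum>j\<le>m. a (k mod 2) j *\<^sub>R ?Q ! (k div 2 + j))"
      unfolding mult_div_mod_eq .
    then have "(S ^^ Suc r) P ! k $ c = (\<Sum>j\<le>m. a (k mod 2) j * (?Q ! (k div 2 + j) $ c))"
      by (simp only: funpow.simps o_apply sum_component vector_scaleR_component real_scaleR_def)
    also have "\<dots> = (\<Sum>j\<le>m. a (k mod 2) j * (lin_sub m a ^^ r) (\<lambda>i. P ! i $ c) (k div 2 + j))"
    proof (rule sum.cong)
      fix j assume "j \<in> {..m}"
      then have "k div 2 + j < 2 ^ r * L + 2 * m" using lt len by simp
      then show "a (k mod 2) j * (?Q ! (k div 2 + j) $ c) =
          a (k mod 2) j * (lin_sub m a ^^ r) (\<lambda>i. P ! i $ c) (k div 2 + j)"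
        using Suc by simp
    qed simp
    also have "\<dots> = lin_sub m a ((lin_sub m a ^^ r) (\<lambda>i. P ! i $ c)) k"
      unfolding lin_sub_def ..
    finally show ?thesis by simp
  qed
  moreover have "length ((S ^^ Suc r) P) = 2 ^ Suc r * L + 2 * m"
    using S[OF ge] len by simp
  ultimately show ?case by blast
qed (use P in simp)

section \<open>Dual point functionals\<close>

text \<open>A finite combination of point evaluations, coded as a list of weights and points, so
  that combinations are formed by appending.\<close>

definition point_functional :: "(real \<times> 'b) list \<Rightarrow> ('b \<Rightarrow> real) \<Rightarrow> real" where
  "point_functional xs g = (\<Sum>p\<leftarrow>xs. fst p * g (snd p))"

definition scale_functional :: "real \<Rightarrow> (real \<times> 'b) list \<Rightarrow> (real \<times> 'b) list" where
  "scale_functional s xs = map (\<lambda>p. (s * fst p, snd p)) xs"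

lemma point_functional_simps [simp]:
  "point_functional [] g = 0"
  "point_functional (p # xs) g = fst p * g (snd p) + point_functional xs g"
  "point_functional (xs @ ys) g = point_functional xs g + point_functional ys g"
  by (simp_all add: point_functional_def)

lemma point_functional_scale [simp]:
  "point_functional (scale_functional s xs) g = s * point_functional xs g"
  by (induction xs) (simp_all add: scale_functional_def algebra_simps)

lemma point_functional_concat:
  "point_functional (concat (map L [0..<n])) g = (\<Sum>j<n. point_functional (L j) g)"
  by (induction n) simp_all

lemma point_functional_sum:
  "point_functional xs (\<lambda>t. \<Sum>j<n. x j * f j t) = (\<Sum>j<n. x j * point_functional xs (f j))"
  by (induction xs) (simp_all add: sum.distrib sum_distrib_left algebra_simps)

lemma point_functional_bound:
  assumes "\<And>t. t \<in> snd ` set xs \<Longrightarrow> \<bar>g t\<bar> \<le> b"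
  shows "\<bar>point_functional xs g\<bar> \<le> (\<Sum>p\<leftarrow>xs. \<bar>fst p\<bar>) * b"
  using assms
proof (induction xs)
  case (Cons p xs)
  have "\<bar>fst p * g (snd p)\<bar> \<le> \<bar>fst p\<bar> * b"
    unfolding abs_mult using Cons.prems[of "snd p"] by (intro mult_left_mono) auto
  moreover have "\<bar>point_functional xs g\<bar> \<le> (\<Sum>p\<leftarrow>xs. \<bar>fst p\<bar>) * b"
    using Cons by auto
  ultimately show ?case by (simp add: algebra_simps)
qed simp

text \<open>Gaussian elimination: a point at which the new function is not interpolated by the old
  ones serves as pivot. Linear independence on a possibly infinite set \<open>T\<close> thus becomes
  visible on finitely many points.\<close>

lemma dual_point_functionals:
  fixes f :: "nat \<Rightarrow> 'b \<Rightarrow> real"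
  assumes "\<forall>x. (\<forall>t\<in>T. (\<Sum>i<n. x i * f i t) = 0) \<longrightarrow> (\<forall>i<n. x i = 0)"
  shows "\<exists>L. \<forall>j<n. snd ` set (L j) \<subseteq> T \<and>
    (\<forall>i<n. point_functional (L j) (f i) = (if i = j then 1 else 0))"
  using assms
proof (induction n)
  case (Suc n)
  have "\<forall>x. (\<forall>t\<in>T. (\<Sum>i<n. x i * f i t) = 0) \<longrightarrow> (\<forall>i<n. x i = 0)"
  proof (intro allI impI)
    fix x i assume "\<forall>t\<in>T. (\<Sum>i<n. x i * f i t) = 0" "i < n"
    then show "x i = 0"
      using Suc.prems[rule_format, of "x(n := 0)" i] by simp
  qed
  from Suc.IH[OF this] obtain L where "\<forall>j<n. snd ` set (L j) \<subseteq> T \<and>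
    (\<forall>i<n. point_functional (L j) (f i) = (if i = j then 1 else 0))" ..
  then have L: "\<And>j. j < n \<Longrightarrow> snd ` set (L j) \<subseteq> T"
    "\<And>i j. i < n \<Longrightarrow> j < n \<Longrightarrow> point_functional (L j) (f i) = (if i = j then 1 else 0)"
    by blast+
  \<comment> \<open>The remainder of \<open>f n\<close> after interpolation by the functionals
    already found. If it vanished on all of \<open>T\<close>, independence would fail.\<close>
  define h where "h t = f n t - (\<Sum>j<n. point_functional (L j) (f n) * f j t)" for t
  have "\<exists>t\<in>T. h t \<noteq> 0"
  proof (rule ccontr)
    assume "\<not> (\<exists>t\<in>T. h t \<noteq> 0)"
    then have "(\<Sum>i<Suc n. ((\<lambda>j. - point_functional (L j) (f n))(n := 1)) i * f i t) = 0"
      if "t \<in> T" for t using that by (simp add: h_def sum_negf)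
    then show False
      using Suc.prems[rule_format, of "(\<lambda>j. - point_functional (L j) (f n))(n := 1)" n] by simp
  qed
  then obtain t where t: "t \<in> T" "h t \<noteq> 0" by blast
  \<comment> \<open>The interpolation remainder evaluated at \<open>t\<close> and normalized: this
    functional annihilates the old functions and takes the value 1 on \<open>f n\<close>.\<close>
  define l where "l = (1 / h t, t) #
    concat (map (\<lambda>j. scale_functional (- f j t / h t) (L j)) [0..<n])"
  have l: "point_functional l g = (g t - (\<Sum>j<n. f j t * point_functional (L j) g)) / h t" for g
    by (simp add: l_def point_functional_concat sum_negf diff_divide_distrib sum_divide_distrib)
  have l0: "point_functional l (f i) = 0" if "i < n" for i
  proof -
    have "(\<Sum>j<n. f j t * point_functional (L j) (f i)) = (\<Sum>j<n. if j = i then f i t else 0)"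
      using that L(2) by (intro sum.cong) auto
    then show ?thesis using that by (simp add: l)
  qed
  have l1: "point_functional l (f n) = 1"
    using t by (simp add: l h_def mult.commute)
  have lT: "snd ` set l \<subseteq> T" using t L(1) by (fastforce simp: l_def scale_functional_def)
  \<comment> \<open>Subtracting a multiple of \<open>l\<close> makes the old functionals vanish on
    \<open>f n\<close> without changing them on the old functions.\<close>
  define L' where "L' j = (if j = n then l else
    L j @ scale_functional (- point_functional (L j) (f n)) l)" for j
  show ?case
  proof (intro exI[of _ L'] allI impI conjI)
    fix j assume "j < Suc n"
    have "snd ` set (scale_functional s xs) = snd ` set xs" for s and xs :: "(real \<times> 'b) list"
      by (force simp: scale_functional_def)
    then show "snd ` set (L' j) \<subseteq> T"
      using \<open>j < Suc n\<close> L(1)[of j] lT by (cases "j = n") (simp_all add: L'_def image_Un)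
    fix i assume "i < Suc n"
    then show "point_functional (L' j) (f i) = (if i = j then 1 else 0)"
      using \<open>j < Suc n\<close> l0 l1 L(2) by (auto simp: L'_def less_Suc_eq)
  qed
qed simp

text \<open>The dual functional of index \<open>i\<close>, applied to the combination, returns
  \<open>x i\<close>. The constant is the total absolute weight of the dual functionals, finite
  because each uses finitely many points.\<close>

lemma coefficients_bounded_by_values:
  fixes f :: "nat \<Rightarrow> 'b \<Rightarrow> real"
  assumes "\<forall>x. (\<forall>t\<in>T. (\<Sum>i<n. x i * f i t) = 0) \<longrightarrow> (\<forall>i<n. x i = 0)"
  obtains C where "C \<ge> 0"
    "\<And>x b i. b \<ge> 0 \<Longrightarrow> (\<And>t. t \<in> T \<Longrightarrow> \<bar>\<Sum>j<n. x j * f j t\<bar> \<le> b) \<Longrightarrow> i < n \<Longrightarrow> \<bar>x i\<bar> \<le> C * b"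
proof -
  from dual_point_functionals[OF assms] obtain L where "\<forall>j<n. snd ` set (L j) \<subseteq> T \<and>
    (\<forall>i<n. point_functional (L j) (f i) = (if i = j then 1 else 0))" ..
  then have L: "\<And>j. j < n \<Longrightarrow> snd ` set (L j) \<subseteq> T"
    "\<And>i j. i < n \<Longrightarrow> j < n \<Longrightarrow> point_functional (L j) (f i) = (if i = j then 1 else 0)"
    by blast+
  define c where "c i = (\<Sum>p\<leftarrow>L i. \<bar>fst p\<bar>)" for i
  have c: "c i \<ge> 0" for i unfolding c_def by (rule sum_list_nonneg) auto
  show ?thesis
  proof (rule that[of "\<Sum>i<n. c i"])
    fix x b i assume b: "b \<ge> 0" "\<And>t. t \<in> T \<Longrightarrow> \<bar>\<Sum>j<n. x j * f j t\<bar> \<le> b" and i: "i < n"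
    have "(\<Sum>j<n. x j * point_functional (L i) (f j)) = (\<Sum>j<n. if j = i then x i else 0)"
      using L(2) i by (intro sum.cong) auto
    then have "x i = point_functional (L i) (\<lambda>t. \<Sum>j<n. x j * f j t)"
      using i by (simp add: point_functional_sum)
    also have "\<bar>\<dots>\<bar> \<le> c i * b"
      unfolding c_def using L(1)[OF i] b by (intro point_functional_bound) auto
    also have "\<dots> \<le> (\<Sum>i<n. c i) * b"
      using b c i by (intro mult_right_mono member_le_sum) auto
    finally show "\<bar>x i\<bar> \<le> (\<Sum>i<n. c i) * b" .
  qed (use c in \<open>simp add: sum_nonneg\<close>)
qed

section \<open>Limits of dyadic data\<close>

text \<open>Telescoping series with a geometric majorant; its tail from \<open>l\<close> on gives
  both the constant and the rate.\<close>

lemma geometric_limit: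
  fixes y :: "nat \<Rightarrow> 'a::banach"
  assumes y: "\<And>l. l \<ge> l0 \<Longrightarrow> norm (y (Suc l) - y l) \<le> C * q ^ l" and q: "0 < q" "q < 1"
    and l: "l \<ge> l0"
  shows "norm (lim y - y l) \<le> C / (1 - q) * q ^ l"
proof -
  have sm: "(\<lambda>k. C * q ^ (l + k)) sums (C / (1 - q) * q ^ l)"
    using sums_mult[OF geometric_sums[of q], of "C * q ^ l"] q by (simp add: power_add algebra_simps)
  have le: "norm (y (Suc (l + k)) - y (l + k)) \<le> C * q ^ (l + k)" for k
    using y l by simp
  have sd: "summable (\<lambda>k. y (Suc (l + k)) - y (l + k))"
    by (rule summable_comparison_test'[OF sums_summable[OF sm]]) (use le in auto)
  have "(\<lambda>n. \<Sum>k<n. y (Suc (l + k)) - y (l + k)) \<longlonglongrightarrow> (\<Sum>k. y (Suc (l + k)) - y (l + k))"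
    using sd summable_LIMSEQ by blast
  moreover have "(\<Sum>k<n. y (Suc (l + k)) - y (l + k)) = y (l + n) - y l" for n
    by (induction n) auto
  ultimately have "(\<lambda>n. y (l + n) - y l) \<longlonglongrightarrow> (\<Sum>k. y (Suc (l + k)) - y (l + k))" by simp
  then have "(\<lambda>n. y l + (y (n + l) - y l)) \<longlonglongrightarrow> y l + (\<Sum>k. y (Suc (l + k)) - y (l + k))"
    by (intro tendsto_intros) (simp add: add.commute)
  then have "y \<longlonglongrightarrow> y l + (\<Sum>k. y (Suc (l + k)) - y (l + k))" by (simp add: LIMSEQ_offset)
  then have "lim y - y l = (\<Sum>k. y (Suc (l + k)) - y (l + k))" by (simp add: limI)
  also have "norm \<dots> \<le> (\<Sum>k. C * q ^ (l + k))"
    by (rule norm_suminf_le[OF le sums_summable[OF sm]])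
  finally show ?thesis using sums_unique[OF sm] by simp
qed

section \<open>Dyadic cells and limits along nested cells\<close>

definition dyadic_index :: "nat \<Rightarrow> real \<Rightarrow> nat" where
  "dyadic_index l t = nat \<lfloor>2 ^ l * t\<rfloor>"

lemma dyadic_index_bounds:
  assumes "t \<ge> 0"
  shows "real (dyadic_index l t) / 2 ^ l \<le> t" "t < (real (dyadic_index l t) + 1) / 2 ^ l"
proof -
  have "2 ^ l * t \<ge> 0" using assms by simp
  then have "real (dyadic_index l t) \<le> 2 ^ l * t" "2 ^ l * t < real (dyadic_index l t) + 1"
    unfolding dyadic_index_def by linarith+
  then show "real (dyadic_index l t) / 2 ^ l \<le> t" "t < (real (dyadic_index l t) + 1) / 2 ^ l"
    by (simp_all add: field_simps)
qed

lemma dyadic_index_dyadic [simp]: "dyadic_index l (real i / 2 ^ l) = i"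
  by (simp add: dyadic_index_def)

lemma dyadic_index_less:
  assumes "0 \<le> t" "t < real L"
  shows "dyadic_index l t < 2 ^ l * L"
proof -
  have "real (dyadic_index l t) \<le> 2 ^ l * t"
    using dyadic_index_bounds(1)[OF assms(1), of l] by (simp add: field_simps)
  also have "\<dots> < 2 ^ l * real L" using assms by simp
  finally have "real (dyadic_index l t) < real (2 ^ l * L)" by simp
  then show ?thesis by (simp only: of_nat_less_iff)
qed

lemma dyadic_index_mono: "0 \<le> s \<Longrightarrow> s \<le> t \<Longrightarrow> dyadic_index l s \<le> dyadic_index l t"
  unfolding dyadic_index_def by (intro nat_mono floor_mono mult_left_mono) auto

lemma dyadic_index_Suc:
  assumes "t \<ge> 0"
  obtains \<mu> where "\<mu> \<le> 1" "dyadic_index (Suc l) t = 2 * dyadic_index l t + \<mu>"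
proof -
  let ?i = "dyadic_index l t" and ?j = "dyadic_index (Suc l) t"
  have "real ?i \<le> 2 ^ l * t" "2 ^ l * t < real ?i + 1" "real ?j \<le> 2 * (2 ^ l * t)"
    "2 * (2 ^ l * t) < real ?j + 1"
    using dyadic_index_bounds[OF assms, of l] dyadic_index_bounds[OF assms, of "Suc l"]
    by (simp_all add: field_simps)
  then have "2 * ?i \<le> ?j" "?j \<le> 2 * ?i + 1" by linarith+
  then show ?thesis using that[of "?j - 2 * ?i"] by auto
qed

lemma dyadic_index_tendsto:
  assumes "t \<ge> 0"
  shows "(\<lambda>l. real (dyadic_index l t) / 2 ^ l) \<longlonglongrightarrow> t"
proof (rule real_tendsto_sandwich)
  show "\<forall>\<^sub>F l in sequentially. t - (1 / 2) ^ l \<le> real (dyadic_index l t) / 2 ^ l"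
    using less_imp_le[OF dyadic_index_bounds(2)[OF assms]]
    by (auto simp: power_divide add_divide_distrib diff_le_eq intro!: always_eventually)
  show "\<forall>\<^sub>F l in sequentially. real (dyadic_index l t) / 2 ^ l \<le> t"
    using dyadic_index_bounds(1)[OF assms] by auto
  have "(\<lambda>l. t - (1 / 2) ^ l) \<longlonglongrightarrow> t - 0"
    by (intro tendsto_diff tendsto_const LIMSEQ_power_zero) auto
  then show "(\<lambda>l. t - (1 / 2) ^ l) \<longlonglongrightarrow> t" by simp
qed auto

text \<open>The cells containing \<open>t\<close> form a path from parent to child, along which the
  data change by at most \<open>C * q ^ l\<close>. \<open>F t\<close> is the limit along this path;
  continuity of \<open>F\<close> is a separate matter.\<close>

lemma dyadic_limit:
  fixes Y :: "nat \<Rightarrow> nat \<Rightarrow> 'a::banach"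
  assumes step: "\<And>l i \<mu>. l \<ge> l0 \<Longrightarrow> i < 2 ^ l * L \<Longrightarrow> \<mu> \<le> 1 \<Longrightarrow>
      norm (Y (Suc l) (2 * i + \<mu>) - Y l i) \<le> C * q ^ l"
    and q: "0 < q" "q < 1"
  obtains F where "\<And>l t. l \<ge> l0 \<Longrightarrow> 0 \<le> t \<Longrightarrow> t < real L \<Longrightarrow>
      norm (F t - Y l (dyadic_index l t)) \<le> C / (1 - q) * q ^ l"
proof (rule that[of "\<lambda>t. lim (\<lambda>l. Y l (dyadic_index l t))"])
  fix l t assume l: "l \<ge> l0" and t: "0 \<le> t" "t < real L"
  show "norm (lim (\<lambda>l. Y l (dyadic_index l t)) - Y l (dyadic_index l t)) \<le> C / (1 - q) * q ^ l"
  proof (rule geometric_limit[OF _ q l])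
    fix l assume l: "l \<ge> l0"
    obtain \<mu> where "\<mu> \<le> 1" "dyadic_index (Suc l) t = 2 * dyadic_index l t + \<mu>"
      using dyadic_index_Suc[OF t(1)] .
    then show "norm (Y (Suc l) (dyadic_index (Suc l) t) - Y l (dyadic_index l t)) \<le> C * q ^ l"
      using step[OF l dyadic_index_less[OF t]] by simp
  qed
qed

text \<open>Points at distance at most one cell length lie in equal or adjacent cells. The bound
  adds two approximation errors and one difference of neighbours.\<close>

lemma dyadic_approx_close:
  fixes Y :: "nat \<Rightarrow> nat \<Rightarrow> 'a::real_normed_vector"
  assumes F: "\<And>l t. l \<ge> l0 \<Longrightarrow> 0 \<le> t \<Longrightarrow> t < real L \<Longrightarrow>
      norm (F t - Y l (dyadic_index l t)) \<le> K * q ^ l"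
    and Y: "\<And>l i. l \<ge> l0 \<Longrightarrow> i + 1 < 2 ^ l * L \<Longrightarrow> norm (Y l (i + 1) - Y l i) \<le> C * q ^ l"
    and "0 \<le> C" "0 \<le> q" "l \<ge> l0" "0 \<le> s" "s \<le> t" "t < real L" "t - s \<le> 1 / 2 ^ l"
  shows "norm (F t - F s) \<le> (2 * K + C) * q ^ l"
proof -
  let ?i = "dyadic_index l s" and ?j = "dyadic_index l t"
  have "2 ^ l * t \<le> 2 ^ l * s + 1" using assms(9) by (simp add: field_simps)
  moreover have "real ?j \<le> 2 ^ l * t" "2 ^ l * s < real ?i + 1"
    using dyadic_index_bounds[of t l] dyadic_index_bounds[of s l] assms by (simp_all add: field_simps)
  ultimately have "?j < ?i + 2" by linarith
  moreover have "?i \<le> ?j" using assms by (intro dyadic_index_mono)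
  ultimately have "?j = ?i \<or> ?j = ?i + 1" by linarith
  moreover have "?j < 2 ^ l * L" using assms by (intro dyadic_index_less) auto
  ultimately have "norm (Y l ?j - Y l ?i) \<le> C * q ^ l"
    using Y[of l ?i] assms by auto
  moreover have "norm (F t - Y l ?j) \<le> K * q ^ l" "norm (F s - Y l ?i) \<le> K * q ^ l"
    using F assms by auto
  moreover have "F t - F s = (F t - Y l ?j) + (Y l ?j - Y l ?i) - (F s - Y l ?i)" by simp
  ultimately show ?thesis
    using norm_triangle_ineq[of "F t - Y l ?j" "Y l ?j - Y l ?i"]
      norm_triangle_ineq4[of "(F t - Y l ?j) + (Y l ?j - Y l ?i)" "F s - Y l ?i"]
    by (simp add: algebra_simps)
qed

lemma dyadic_scale:
  fixes d :: real
  assumes "0 < d" "d \<le> 1 / 2 ^ l0"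
  obtains l where "l \<ge> l0" "1 / 2 ^ Suc l < d" "d \<le> 1 / 2 ^ l"
proof -
  obtain k where "(1 / 2 :: real) ^ k < d" using real_arch_pow_inv[OF assms(1), of "1/2"] by auto
  then have k: "1 / 2 ^ k < d" by (simp add: power_divide)
  define l where "l = (LEAST k. 1 / 2 ^ k < d)"
  have l: "1 / 2 ^ l < d" unfolding l_def using k by (rule LeastI)
  have "l > l0"
  proof (rule ccontr)
    assume "\<not> l > l0"
    then have "(2::real) ^ l \<le> 2 ^ l0" by (intro power_increasing) auto
    then have "1 / 2 ^ l0 \<le> 1 / (2::real) ^ l" by (simp add: frac_le)
    then show False using l assms by simp
  qed
  then obtain l' where l': "l = Suc l'" by (cases l) auto
  have "\<not> 1 / 2 ^ l' < d" using not_less_Least[of l' "\<lambda>k. 1 / 2 ^ k < d"] l' by (simp add: l_def)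
  then show ?thesis using that[of l'] l l' \<open>l > l0\<close> by auto
qed

text \<open>At a distance between \<open>1 / 2 ^ Suc l\<close> and \<open>1 / 2 ^ l\<close>, the
  \<open>l\<close>-th power of \<open>2 powr (- \<beta>)\<close> is comparable to the distance to
  the power \<open>\<beta>\<close>. The factor \<open>2 powr \<beta>\<close> is the price of
  rounding to a dyadic scale.\<close>

lemma dyadic_holder:
  fixes Y :: "nat \<Rightarrow> nat \<Rightarrow> 'a::real_normed_vector"
  assumes F: "\<And>l t. l \<ge> l0 \<Longrightarrow> 0 \<le> t \<Longrightarrow> t < real L \<Longrightarrow>
      norm (F t - Y l (dyadic_index l t)) \<le> K * (2 powr (- \<beta>)) ^ l"
    and Y: "\<And>l i. l \<ge> l0 \<Longrightarrow> i + 1 < 2 ^ l * L \<Longrightarrow>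
      norm (Y l (i + 1) - Y l i) \<le> C * (2 powr (- \<beta>)) ^ l"
    and nn: "0 \<le> C" "0 \<le> K" "0 \<le> \<beta>"
    and s: "0 \<le> s" "s < real L" and t: "0 \<le> t" "t < real L" and st: "\<bar>t - s\<bar> \<le> 1 / 2 ^ l0"
  shows "norm (F t - F s) \<le> (2 * K + C) * 2 powr \<beta> * \<bar>t - s\<bar> powr \<beta>"
proof -
  have "norm (F t - F s) \<le> (2 * K + C) * 2 powr \<beta> * (t - s) powr \<beta>"
    if st: "0 \<le> s" "s < t" "t < real L" "t - s \<le> 1 / 2 ^ l0" for s t
  proof -
    obtain l where l: "l \<ge> l0" "1 / 2 ^ Suc l < t - s" "t - s \<le> 1 / 2 ^ l"
      by (rule dyadic_scale[of "t - s" l0]) (use st in auto)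
    have "norm (F t - F s) \<le> (2 * K + C) * (2 powr (- \<beta>)) ^ l"
      by (rule dyadic_approx_close[OF F Y]) (use nn l st in auto)
    also have "(2 powr (- \<beta>)) ^ l = 2 powr \<beta> * (1 / 2 ^ Suc l :: real) powr \<beta>"
    proof -
      have "(1 / 2 ^ Suc l :: real) = 2 powr (- real (Suc l))"
        by (simp add: powr_minus powr_realpow divide_inverse del: power_Suc of_nat_Suc)
      then show ?thesis
        by (simp add: powr_powr powr_power flip: powr_add) (simp add: algebra_simps)
    qed
    also have "(2 * K + C) * (2 powr \<beta> * (1 / 2 ^ Suc l :: real) powr \<beta>) \<le>
        (2 * K + C) * (2 powr \<beta> * (t - s) powr \<beta>)"
      using nn l by (intro mult_left_mono powr_mono2) auto
    finally show ?thesis by (simp add: mult.assoc)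
  qed
  note * = this
  show ?thesis
  proof (cases s t rule: linorder_cases)
    case less
    then show ?thesis using *[of s t] s t st by simp
  next
    case greater
    then show ?thesis using *[of t s] s t st by (simp add: norm_minus_commute)
  qed simp
qed

lemma holder_modulus_small:
  fixes \<beta> e H :: real
  assumes \<beta>: "\<beta> > 0" and e: "e > 0"
  obtains d where "d > 0" "\<And>x. x \<noteq> 0 \<Longrightarrow> \<bar>x\<bar> < d \<Longrightarrow> H * \<bar>x\<bar> powr \<beta> < e"
proof -
  have "((\<lambda>x. H * \<bar>x\<bar> powr \<beta>) \<longlongrightarrow> H * 0) (at 0)"
    using \<beta> by (intro tendsto_mult tendsto_const tendsto_zero_powrI[where b = \<beta>])
      (auto intro!: tendsto_rabs_zero)
  then have "\<forall>\<^sub>F x in at 0. H * \<bar>x\<bar> powr \<beta> < e" using e by (auto dest: order_tendstoD(2))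
  then show ?thesis using that unfolding eventually_at by (auto simp: dist_real_def)
qed

lemma dyadic_sum_estimate:
  fixes Q :: "nat \<Rightarrow> 'a::real_normed_vector"
  assumes "i \<le> j" "\<And>k. i \<le> k \<Longrightarrow> k < j \<Longrightarrow> norm (Q (Suc k) - Q k - w) \<le> b"
  shows "norm (Q j - Q i - (real j - real i) *\<^sub>R w) \<le> (real j - real i) * b"
proof -
  have "Q j - Q i - (real j - real i) *\<^sub>R w = (\<Sum>k=i..<j. Q (Suc k) - Q k - w)"
    using sum_Suc_diff'[OF assms(1), of Q] assms(1)
    by (simp add: sum_subtractf[of "\<lambda>k. Q (Suc k) - Q k"] sum_constant_scaleR of_nat_diff)
  also have "norm \<dots> \<le> (\<Sum>k=i..<j. b)"
    by (rule sum_norm_le) (use assms in auto)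
  finally show ?thesis using assms(1) by (simp add: of_nat_diff)
qed

text \<open>A substitute for integrating \<open>\<Psi>\<close>: increments of \<open>\<Phi>\<close>
  are limits of sums of first differences, each of which is the cell length times a value of
  \<open>\<Psi>\<close>, up to a relative error \<open>q ^ l\<close>. The margin
  \<open>\<eta>\<close> is there because the cell containing \<open>s\<close> may start to the left
  of \<open>s\<close>.\<close>

lemma dyadic_limit_increment:
  fixes Q :: "nat \<Rightarrow> nat \<Rightarrow> 'a::real_normed_vector"
  assumes \<Phi>: "\<And>l t. l \<ge> l0 \<Longrightarrow> 0 \<le> t \<Longrightarrow> t < real L \<Longrightarrow>
      norm (\<Phi> t - Q l (dyadic_index l t)) \<le> K * (1 / 2) ^ l"
    and \<Psi>: "\<And>l t. l \<ge> l0 \<Longrightarrow> 0 \<le> t \<Longrightarrow> t < real L \<Longrightarrow>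
      norm (\<Psi> t - 2 ^ l *\<^sub>R (Q l (dyadic_index l t + 1) - Q l (dyadic_index l t))) \<le> K' * q ^ l"
    and q: "0 < q" "q < 1" and s: "0 \<le> s" "s \<le> t" "t < real L" and \<eta>: "\<eta> > 0"
    and w: "\<And>x. 0 \<le> x \<Longrightarrow> x < real L \<Longrightarrow> s - \<eta> \<le> x \<Longrightarrow> x \<le> t \<Longrightarrow> norm (\<Psi> x - w) \<le> \<epsilon>"
  shows "norm (\<Phi> t - \<Phi> s - (t - s) *\<^sub>R w) \<le> (t - s) * \<epsilon>"
proof -
  have lim\<Phi>: "(\<lambda>l. Q l (dyadic_index l x)) \<longlonglongrightarrow> \<Phi> x" if "0 \<le> x" "x < real L" for x
  proof (rule Lim_transform_eventually)
    have "(\<lambda>l. Q l (dyadic_index l x) - \<Phi> x) \<longlonglongrightarrow> 0"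
    proof (rule tendsto_0_le[where K = K])
      show "(\<lambda>l. (1 / 2 :: real) ^ l) \<longlonglongrightarrow> 0" by (intro LIMSEQ_power_zero) auto
      show "\<forall>\<^sub>F l in sequentially. norm (Q l (dyadic_index l x) - \<Phi> x) \<le> norm ((1 / 2 :: real) ^ l) * K"
        using eventually_ge_at_top[of l0]
        by eventually_elim (use \<Phi> that in \<open>simp add: norm_minus_commute mult.commute\<close>)
    qed
    then have "(\<lambda>l. Q l (dyadic_index l x) - \<Phi> x + \<Phi> x) \<longlonglongrightarrow> 0 + \<Phi> x"
      by (intro tendsto_intros)
    then show "(\<lambda>l. Q l (dyadic_index l x) - \<Phi> x + \<Phi> x) \<longlonglongrightarrow> \<Phi> x" by simp
  qed simp
  let ?i = "\<lambda>l. dyadic_index l s" and ?j = "\<lambda>l. dyadic_index l t"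
  let ?d = "\<lambda>l. real (?j l) / 2 ^ l - real (?i l) / 2 ^ l"
  have L: "(\<lambda>l. norm (Q l (?j l) - Q l (?i l) - ?d l *\<^sub>R w)) \<longlonglongrightarrow> norm (\<Phi> t - \<Phi> s - (t - s) *\<^sub>R w)"
    using s by (intro tendsto_intros lim\<Phi> dyadic_index_tendsto) auto
  have R: "(\<lambda>l. ?d l * (\<epsilon> + K' * q ^ l)) \<longlonglongrightarrow> (t - s) * (\<epsilon> + K' * 0)"
    using s q by (intro tendsto_intros dyadic_index_tendsto LIMSEQ_power_zero) auto
  \<comment> \<open>From some level on the cell of \<open>s\<close> begins after
    \<open>s - \<eta>\<close>, so the bound on \<open>\<Psi>\<close> covers all grid points of the
    sum.\<close>
  have ev: "\<forall>\<^sub>F l in sequentially. (1 / 2) ^ l < \<eta>"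
    using \<eta> by (intro order_tendstoD(2)[OF LIMSEQ_power_zero]) auto
  have "\<forall>\<^sub>F l in sequentially.
      norm (Q l (?j l) - Q l (?i l) - ?d l *\<^sub>R w) \<le> ?d l * (\<epsilon> + K' * q ^ l)"
    using ev eventually_ge_at_top[of l0]
  proof eventually_elim
    case (elim l)
    let ?b = "(\<epsilon> + K' * q ^ l) / 2 ^ l"
    have ij: "?i l \<le> ?j l" using s by (intro dyadic_index_mono)
    have "norm (Q l (?j l) - Q l (?i l) - (real (?j l) - real (?i l)) *\<^sub>R ((1 / 2 ^ l) *\<^sub>R w))
        \<le> (real (?j l) - real (?i l)) * ?b"
    proof (rule dyadic_sum_estimate[OF ij])
      fix k assume k: "?i l \<le> k" "k < ?j l"
      define x where "x = real k / 2 ^ l"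
      have "real (?j l) / 2 ^ l \<le> t" using dyadic_index_bounds(1) s by auto
      moreover have "x \<le> real (?j l) / 2 ^ l" using k unfolding x_def by (intro divide_right_mono) auto
      ultimately have xt: "x \<le> t" by simp
      have "s < (real (?i l) + 1) / 2 ^ l" using dyadic_index_bounds(2) s by auto
      also have "\<dots> \<le> x + (1 / 2) ^ l"
        using k by (simp add: x_def power_divide divide_right_mono flip: add_divide_distrib)
      finally have xs: "s - \<eta> \<le> x" using elim by simp
      have x: "0 \<le> x" "x < real L" "dyadic_index l x = k" using xt s by (auto simp: x_def)
      have "norm (\<Psi> x - w) \<le> \<epsilon>" using w x xt xs by auto
      moreover have "norm (\<Psi> x - 2 ^ l *\<^sub>R (Q l (k + 1) - Q l k)) \<le> K' * q ^ l"
        using \<Psi>[OF elim(2) x(1,2)] x(3) by simp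
      moreover have "2 ^ l *\<^sub>R (Q l (k + 1) - Q l k) - w =
        (\<Psi> x - w) - (\<Psi> x - 2 ^ l *\<^sub>R (Q l (k + 1) - Q l k))" by simp
      ultimately have *: "norm (2 ^ l *\<^sub>R (Q l (k + 1) - Q l k) - w) \<le> \<epsilon> + K' * q ^ l"
        using norm_triangle_ineq4[of "\<Psi> x - w" "\<Psi> x - 2 ^ l *\<^sub>R (Q l (k + 1) - Q l k)"] by simp
      have "Q l (Suc k) - Q l k - (1 / 2 ^ l) *\<^sub>R w =
        (1 / 2 ^ l) *\<^sub>R (2 ^ l *\<^sub>R (Q l (k + 1) - Q l k) - w)" by (simp add: scaleR_diff_right)
      then have "norm (Q l (Suc k) - Q l k - (1 / 2 ^ l) *\<^sub>R w) =
        norm (2 ^ l *\<^sub>R (Q l (k + 1) - Q l k) - w) / 2 ^ l" by simp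
      also have "\<dots> \<le> ?b" using * by (intro divide_right_mono) auto
      finally show "norm (Q l (Suc k) - Q l k - (1 / 2 ^ l) *\<^sub>R w) \<le> ?b" .
    qed
    then show ?case by (simp add: diff_divide_distrib[symmetric])
  qed
  from tendsto_le[OF _ R L this] show ?thesis by simp
qed


text \<open>The order of the estimates matters. By \<open>first\<close>, the difference quotients
  converge on their own and are therefore bounded; only then does \<open>zeroth\<close>, whose bound
  contains a first difference, give convergence of the points. \<open>second\<close> compares
  neighbouring quotients and so yields the Hoelder bound for the derivative.\<close>

lemma dyadic_C1_limit:
  fixes Q :: "nat \<Rightarrow> nat \<Rightarrow> 'a::euclidean_space"
  assumes \<beta>: "\<beta> > 0" and q: "q = 2 powr (- \<beta>)" and C: "C \<ge> 0" and L: "L \<ge> 1"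
    and second: "\<And>l i. l \<ge> l0 \<Longrightarrow> i < 2 ^ l * L \<Longrightarrow>
      norm ((Q l (i + 2) - Q l (i + 1)) - (Q l (i + 1) - Q l i)) \<le> C * (q / 2) ^ l"
    and first: "\<And>l i \<mu>. l \<ge> l0 \<Longrightarrow> i < 2 ^ l * L \<Longrightarrow> \<mu> \<le> 1 \<Longrightarrow>
      norm ((Q (Suc l) (2 * i + \<mu> + 1) - Q (Suc l) (2 * i + \<mu>)) - (1 / 2) *\<^sub>R (Q l (i + 1) - Q l i))
        \<le> C * (q / 2) ^ l"
    and zeroth: "\<And>l i \<mu>. l \<ge> l0 \<Longrightarrow> i < 2 ^ l * L \<Longrightarrow> \<mu> \<le> 1 \<Longrightarrow>
      norm (Q (Suc l) (2 * i + \<mu>) - Q l i) \<le> C * (norm (Q l (i + 1) - Q l i) + (q / 2) ^ l)"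
  obtains \<Phi> \<Psi> K H where "continuous_on UNIV \<Phi>"
    "\<And>l i. l \<ge> l0 \<Longrightarrow> 0 < i \<Longrightarrow> i < 2 ^ l * L \<Longrightarrow> norm (\<Phi> (real i / 2 ^ l) - Q l i) \<le> K * (1 / 2) ^ l"
    "\<And>t. 0 < t \<Longrightarrow> t < real L \<Longrightarrow> (\<Phi> has_vector_derivative \<Psi> t) (at t)"
    "\<And>s t. 0 < s \<Longrightarrow> s < real L \<Longrightarrow> 0 < t \<Longrightarrow> t < real L \<Longrightarrow> \<bar>t - s\<bar> \<le> 1 / 2 ^ l0 \<Longrightarrow>
      norm (\<Psi> t - \<Psi> s) \<le> H * \<bar>t - s\<bar> powr \<beta>"
proof -
  have q01: "0 < q" "q < 1" using \<beta> by (auto simp: q powr_less_one)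
  define D where "D l i = 2 ^ l *\<^sub>R (Q l (i + 1) - Q l i)" for l i
  have normD: "norm (Q l (i + 1) - Q l i) = norm (D l i) * (1 / 2) ^ l" for l i
    by (simp add: D_def power_divide)
  have stepD: "norm (D (Suc l) (2 * i + \<mu>) - D l i) \<le> (2 * C) * q ^ l"
    if "l \<ge> l0" "i < 2 ^ l * L" "\<mu> \<le> 1" for l i \<mu>
  proof -
    have "D (Suc l) (2 * i + \<mu>) - D l i = 2 ^ Suc l *\<^sub>R
      ((Q (Suc l) (2 * i + \<mu> + 1) - Q (Suc l) (2 * i + \<mu>)) - (1 / 2) *\<^sub>R (Q l (i + 1) - Q l i))"
      by (simp add: D_def scaleR_diff_right)
    then have "norm (D (Suc l) (2 * i + \<mu>) - D l i) \<le> 2 ^ Suc l * (C * (q / 2) ^ l)"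
      using first[OF that] by simp
    then show ?thesis by (simp add: power_divide field_simps)
  qed
  have neighD: "norm (D l (i + 1) - D l i) \<le> C * q ^ l" if "l \<ge> l0" "i + 1 < 2 ^ l * L" for l i
  proof -
    have "D l (i + 1) - D l i = 2 ^ l *\<^sub>R ((Q l (i + 2) - Q l (i + 1)) - (Q l (i + 1) - Q l i))"
      by (simp add: D_def scaleR_diff_right)
    then have "norm (D l (i + 1) - D l i) \<le> 2 ^ l * (C * (q / 2) ^ l)"
      using second[of l i] that by simp
    then show ?thesis by (simp add: power_divide field_simps)
  qed
  define K1 where "K1 = 2 * C / (1 - q)"
  have K1: "K1 \<ge> 0" using C q01 by (simp add: K1_def)
  obtain \<Psi> where \<Psi>: "\<And>l t. l \<ge> l0 \<Longrightarrow> 0 \<le> t \<Longrightarrow> t < real L \<Longrightarrow>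
      norm (\<Psi> t - D l (dyadic_index l t)) \<le> K1 * q ^ l"
    unfolding K1_def using dyadic_limit[OF stepD q01] by blast
  define B where "B = Max ((\<lambda>i. norm (D l0 i)) ` {..<2 ^ l0 * L})"
  have B: "norm (D l0 i) \<le> B" if "i < 2 ^ l0 * L" for i
    unfolding B_def using that by (intro Max_ge) auto
  have "norm (D l0 0) \<le> B" using L by (intro B) auto
  then have B0: "B \<ge> 0" using norm_ge_zero order_trans by blast
  have \<Psi>1: "norm (\<Psi> t - D l (dyadic_index l t)) \<le> K1" if "l \<ge> l0" "0 \<le> t" "t < real L" for l t
  proof -
    have "K1 * q ^ l \<le> K1 * 1" using K1 q01 by (intro mult_left_mono power_le_one) auto
    then show ?thesis using \<Psi>[OF that] by simp
  qed
  \<comment> \<open>Every quotient is within \<open>K1\<close> of a value of \<open>\<Psi>\<close>,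
    which in turn is within \<open>K1\<close> of one of the finitely many quotients of level
    \<open>l0\<close>.\<close>
  define M where "M = B + 2 * K1"
  have M: "norm (D l i) \<le> M" if "l \<ge> l0" "i < 2 ^ l * L" for l i
  proof -
    define t where "t = real i / 2 ^ l"
    have "real i < real (2 ^ l * L)" using that(2) by (simp only: of_nat_less_iff)
    then have t: "0 \<le> t" "t < real L" by (auto simp: t_def field_simps)
    have 1: "norm (\<Psi> t - D l0 (dyadic_index l0 t)) \<le> K1" using \<Psi>1 t by auto
    have 2: "norm (\<Psi> t - D l i) \<le> K1" using \<Psi>1[OF that(1) t] by (simp add: t_def)
    have 3: "norm (D l0 (dyadic_index l0 t)) \<le> B" using B dyadic_index_less[OF t] by auto
    have "D l i = (\<Psi> t - D l0 (dyadic_index l0 t)) - (\<Psi> t - D l i) + D l0 (dyadic_index l0 t)" by simp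
    then have "norm (D l i) \<le> norm (\<Psi> t - D l0 (dyadic_index l0 t)) + norm (\<Psi> t - D l i) +
        norm (D l0 (dyadic_index l0 t))"
      using norm_triangle_ineq[of "(\<Psi> t - D l0 (dyadic_index l0 t)) - (\<Psi> t - D l i)" "D l0 (dyadic_index l0 t)"]
        norm_triangle_ineq4[of "\<Psi> t - D l0 (dyadic_index l0 t)" "\<Psi> t - D l i"] by simp
    then show ?thesis using 1 2 3 by (simp add: M_def)
  qed
  have M0: "M \<ge> 0" using B0 K1 by (simp add: M_def)
  define K where "K = C * (M + 1) / (1 - 1 / 2)"
  have K: "K \<ge> 0" using C M0 by (simp add: K_def)
  have stepQ: "norm (Q (Suc l) (2 * i + \<mu>) - Q l i) \<le> (C * (M + 1)) * (1 / 2) ^ l"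
    if "l \<ge> l0" "i < 2 ^ l * L" "\<mu> \<le> 1" for l i \<mu>
  proof -
    have "(q / 2) ^ l \<le> (1 / 2) ^ l" using q01 by (intro power_mono) auto
    moreover have "norm (Q l (i + 1) - Q l i) \<le> M * (1 / 2) ^ l"
      unfolding normD using M[OF that(1,2)] by (intro mult_right_mono) auto
    ultimately have "norm (Q l (i + 1) - Q l i) + (q / 2) ^ l \<le> (M + 1) * (1 / 2) ^ l"
      by (simp add: algebra_simps)
    from mult_left_mono[OF this C] show ?thesis using zeroth[OF that] by (simp add: mult.assoc)
  qed
  obtain \<Phi>0 where \<Phi>0: "\<And>l t. l \<ge> l0 \<Longrightarrow> 0 \<le> t \<Longrightarrow> t < real L \<Longrightarrow>
      norm (\<Phi>0 t - Q l (dyadic_index l t)) \<le> K * (1 / 2) ^ l"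
    unfolding K_def by (rule dyadic_limit[OF stepQ]) auto
  \<comment> \<open>Lipschitz continuity is obtained as the Hoelder estimate with exponent
    1.\<close>
  have half: "2 powr (- 1) = (1 / 2 :: real)" by (simp add: powr_minus)
  define K2 where "K2 = (2 * K + M) * 2 powr 1"
  have lip: "norm (\<Phi>0 t - \<Phi>0 s) \<le> K2 * \<bar>t - s\<bar>"
    if "0 \<le> s" "s < real L" "0 \<le> t" "t < real L" "\<bar>t - s\<bar> \<le> 1 / 2 ^ l0" for s t
  proof -
    have "norm (\<Phi>0 t - \<Phi>0 s) \<le> (2 * K + M) * 2 powr 1 * \<bar>t - s\<bar> powr 1"
    proof (rule dyadic_holder[where Y = Q and L = L and ?l0.0 = l0])
      fix l i assume "l \<ge> l0" "i + 1 < 2 ^ l * L"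
      then show "norm (Q l (i + 1) - Q l i) \<le> M * (2 powr - 1) ^ l"
        unfolding normD half using M[of l i] by (intro mult_right_mono) auto
    qed (use \<Phi>0 K M0 that in \<open>auto simp: half\<close>)
    then show ?thesis by (simp add: K2_def)
  qed
  have K2: "K2 \<ge> 0" using K M0 by (simp add: K2_def)
  define H where "H = (2 * K1 + C) * 2 powr \<beta>"
  have hoelder: "norm (\<Psi> t - \<Psi> s) \<le> H * \<bar>t - s\<bar> powr \<beta>"
    if "0 \<le> s" "s < real L" "0 \<le> t" "t < real L" "\<bar>t - s\<bar> \<le> 1 / 2 ^ l0" for s t
    unfolding H_def using that \<beta> K1 C \<Psi> neighD
    by (intro dyadic_holder[where Y = D and L = L and ?l0.0 = l0]) (auto simp: q)
  \<comment> \<open>A limit curve has to be continuous on the whole line, whereas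
    \<open>\<Phi>0\<close> is controlled on \<open>{0..<real L}\<close> only. Uniform continuity
    extends it to the closed interval, and clamping the argument extends it further by
    constants.\<close>
  have "uniformly_continuous_on {0..<real L} \<Phi>0"
    unfolding uniformly_continuous_on_def
  proof (intro allI impI)
    fix e :: real assume e: "e > 0"
    let ?d = "min (1 / 2 ^ l0) (e / (K2 + 1))"
    have "dist (\<Phi>0 x') (\<Phi>0 x) < e" if "x \<in> {0..<real L}" "x' \<in> {0..<real L}" "dist x' x < ?d" for x x'
    proof -
      have "norm (\<Phi>0 x' - \<Phi>0 x) \<le> K2 * \<bar>x' - x\<bar>"
        using that by (intro lip) (auto simp: dist_real_def)
      also have "\<dots> \<le> (K2 + 1) * \<bar>x' - x\<bar>" by (intro mult_right_mono) auto
      also have "\<dots> < (K2 + 1) * (e / (K2 + 1))"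
        using that K2 by (intro mult_strict_left_mono) (auto simp: dist_real_def)
      finally show ?thesis using K2 by (simp add: dist_norm)
    qed
    then show "\<exists>d>0. \<forall>x\<in>{0..<real L}. \<forall>x'\<in>{0..<real L}. dist x' x < d \<longrightarrow> dist (\<Phi>0 x') (\<Phi>0 x) < e"
      using e K2 by (intro exI[of _ ?d]) auto
  qed
  then obtain g where g: "uniformly_continuous_on (closure {0..<real L}) g"
    "\<And>x. x \<in> {0..<real L} \<Longrightarrow> \<Phi>0 x = g x"
    by (rule uniformly_continuous_on_extension_on_closure) (rule that)
  have cl: "closure {0..<real L} = {0..real L}" using L by simp
  define \<Phi> where "\<Phi> t = g (max 0 (min (real L) t))" for t
  have eq: "\<Phi> t = \<Phi>0 t" if "0 \<le> t" "t < real L" for t using that g(2)[of t] by (simp add: \<Phi>_def)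
  have cont: "continuous_on UNIV \<Phi>"
    unfolding \<Phi>_def
    by (rule continuous_on_compose2[OF uniformly_continuous_imp_continuous[OF g(1)]])
      (auto simp: cl intro!: continuous_intros)
  have deriv: "(\<Phi>0 has_vector_derivative \<Psi> t) (at t)" if t: "0 < t" "t < real L" for t
    unfolding has_vector_derivative_def has_derivative_at_alt
  proof (intro conjI allI impI)
    show "bounded_linear (\<lambda>x. x *\<^sub>R \<Psi> t)" by (rule bounded_linear_scaleR_left)
    fix e :: real assume e: "e > 0"
    obtain d where d: "d > 0" "\<And>x. x \<noteq> 0 \<Longrightarrow> \<bar>x\<bar> < d \<Longrightarrow> H * \<bar>x\<bar> powr \<beta> < e"
      using holder_modulus_small[OF \<beta> e] by blast
    \<comment> \<open>Half of each admissible radius: the grid points of the increment estimate may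
      lie \<open>\<eta>\<close> to the left of an argument that is itself within
      \<open>\<eta>\<close> of \<open>t\<close>.\<close>
    define \<eta> where "\<eta> = min (min d (1 / 2 ^ l0)) (min t (real L - t)) / 2"
    have \<eta>: "\<eta> > 0" "2 * \<eta> \<le> d" "2 * \<eta> \<le> 1 / 2 ^ l0" "\<eta> < t" "\<eta> < real L - t"
      using d t by (auto simp: \<eta>_def min_def)
    have w: "norm (\<Psi> x - \<Psi> t) \<le> e" if "0 \<le> x" "x < real L" "\<bar>x - t\<bar> < 2 * \<eta>" for x
    proof (cases "x = t")
      case False
      have "norm (\<Psi> x - \<Psi> t) \<le> H * \<bar>x - t\<bar> powr \<beta>" using that t \<eta> by (intro hoelder) auto
      also have "\<dots> < e" using False that \<eta> by (intro d(2)) auto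
      finally show ?thesis by simp
    qed (use e in simp)
    have incr: "norm (\<Phi>0 y - \<Phi>0 x - (y - x) *\<^sub>R \<Psi> t) \<le> (y - x) * e"
      if "0 \<le> x" "x \<le> y" "y < real L" "\<bar>x - t\<bar> < \<eta>" "\<bar>y - t\<bar> < \<eta>" for x y
      by (rule dyadic_limit_increment[where \<Psi> = \<Psi> and \<Phi> = \<Phi>0 and \<eta> = \<eta>, OF \<Phi>0 _ q01])
        (use that \<Psi> \<eta> in \<open>auto simp: D_def intro!: w\<close>)
    show "\<exists>d>0. \<forall>y. norm (y - t) < d \<longrightarrow>
        norm (\<Phi>0 y - \<Phi>0 t - (y - t) *\<^sub>R \<Psi> t) \<le> e * norm (y - t)"
    proof (intro exI[of _ \<eta>] conjI allI impI)
      fix y assume y: "norm (y - t) < \<eta>"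
      show "norm (\<Phi>0 y - \<Phi>0 t - (y - t) *\<^sub>R \<Psi> t) \<le> e * norm (y - t)"
      proof (cases "t \<le> y")
        case True
        then show ?thesis using incr[of t y] y \<eta> t by (auto simp: mult.commute)
      next
        case False
        have "norm (\<Phi>0 t - \<Phi>0 y - (t - y) *\<^sub>R \<Psi> t) \<le> (t - y) * e"
          using False y \<eta> t by (intro incr) auto
        moreover have "norm (\<Phi>0 t - \<Phi>0 y - (t - y) *\<^sub>R \<Psi> t) = norm (\<Phi>0 y - \<Phi>0 t - (y - t) *\<^sub>R \<Psi> t)"
          by (subst norm_minus_cancel[symmetric]) (simp add: algebra_simps)
        ultimately show ?thesis using False by (simp add: mult.commute)
      qed
    qed (use \<eta> in auto)
  qed
  show ?thesis
  proof (rule that[of \<Phi> K \<Psi> H])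
    fix l i assume l: "l \<ge> l0" and i: "0 < i" "i < 2 ^ l * L"
    have "real i < real (2 ^ l * L)" using i(2) by (simp only: of_nat_less_iff)
    then have "real i / 2 ^ l < real L" by (auto simp: field_simps)
    then show "norm (\<Phi> (real i / 2 ^ l) - Q l i) \<le> K * (1 / 2) ^ l"
      using \<Phi>0[OF l, of "real i / 2 ^ l"] eq by simp
  next
    fix t assume t: "0 < t" "t < real L"
    show "(\<Phi> has_vector_derivative \<Psi> t) (at t)"
      by (rule has_vector_derivative_transform_within_open[OF deriv[OF t], of "{0<..<real L}"])
        (use t eq in auto)
  qed (use cont hoelder in auto)
qed

section \<open>Second differences of linear schemes\<close>

abbreviation second_diff :: "(nat \<Rightarrow> 'a::ab_group_add) \<Rightarrow> nat \<Rightarrow> 'a" where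
  "second_diff x i \<equiv> (x (i + 2) - x (i + 1)) - (x (i + 1) - x i)"

lemma norm_second_diff_le:
  fixes x :: "nat \<Rightarrow> 'a::real_normed_vector"
  assumes "norm (x i) \<le> b" "norm (x (i + 1)) \<le> b" "norm (x (i + 2)) \<le> b"
  shows "norm (second_diff x i) \<le> 4 * b"
  using norm_triangle_ineq4[of "x (i + 2) - x (i + 1)" "x (i + 1) - x i"]
    norm_triangle_ineq4[of "x (i + 2)" "x (i + 1)"] norm_triangle_ineq4[of "x (i + 1)" "x i"] assms
  by simp

text \<open>Discrete Taylor formula at index 0: first differences deviate from
  \<open>x 1 - x 0\<close> by at most \<open>i * c\<close>, and summation contributes another factor
  \<open>i\<close>.\<close>

lemma second_diff_bound:
  fixes x :: "nat \<Rightarrow> 'a::real_normed_vector"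
  assumes x: "\<And>i. i + 2 < N \<Longrightarrow> norm (second_diff x i) \<le> c" and "c \<ge> 0" and "i < N"
  shows "norm (x i - x 0 - real i *\<^sub>R (x 1 - x 0)) \<le> (real i)\<^sup>2 * c"
proof -
  define u where "u = x 1 - x 0"
  have 1: "norm (x (Suc i) - x i - u) \<le> real i * c" if "Suc i < N" for i
    using that
  proof (induction i)
    case (Suc i)
    have "x (Suc (Suc i)) - x (Suc i) - u = second_diff x i + (x (Suc i) - x i - u)" by simp
    then have "norm (x (Suc (Suc i)) - x (Suc i) - u) \<le> norm (second_diff x i) + norm (x (Suc i) - x i - u)"
      by (metis norm_triangle_ineq)
    also have "\<dots> \<le> c + real i * c" using x[of i] Suc by (intro add_mono) auto
    finally show ?case by (simp add: algebra_simps)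
  qed (simp add: u_def)
  have "norm (x i - x 0 - real i *\<^sub>R u) \<le> (real i)\<^sup>2 * c" using assms(3)
  proof (induction i)
    case (Suc i)
    have "x (Suc i) - x 0 - real (Suc i) *\<^sub>R u = (x i - x 0 - real i *\<^sub>R u) + (x (Suc i) - x i - u)"
      by (simp add: algebra_simps)
    then have "norm (x (Suc i) - x 0 - real (Suc i) *\<^sub>R u) \<le>
        norm (x i - x 0 - real i *\<^sub>R u) + norm (x (Suc i) - x i - u)"
      by (metis norm_triangle_ineq)
    also have "\<dots> \<le> (real i)\<^sup>2 * c + real i * c" using Suc 1[of i] by (intro add_mono) auto
    also have "\<dots> = (real i * real i + real i) * c" by (simp add: power2_eq_square algebra_simps)
    also have "\<dots> \<le> (real (Suc i))\<^sup>2 * c"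
      using assms(2) by (intro mult_right_mono) (auto simp: power2_eq_square algebra_simps)
    finally show ?case .
  qed simp
  then show ?thesis by (simp add: u_def)
qed

section \<open>Limit curves at dyadic parameters and their Taylor estimates\<close>

lemma param_length_eq: "length P = L + 2 * m \<Longrightarrow> param_length m P = real L"
  by (simp add: param_length_def)

text \<open>A dyadic parameter stays on the grid from level \<open>r\<close> on, with index
  \<open>2 ^ l * k\<close> at level \<open>r + l\<close>.\<close>

lemma limit_curve_dyadic:
  assumes lc: "limit_curve m G P \<Phi>" and P: "length P = L + 2 * m" and k: "0 < k" "k < 2 ^ r * L"
  shows "(\<lambda>l. (G ^^ (r + l)) P ! (2 ^ l * k)) \<longlonglongrightarrow> \<Phi> (real k / 2 ^ r)"
proof -
  define t where "t = real k / 2 ^ r"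
  have "real k < real (2 ^ r * L)" using k(2) by (simp only: of_nat_less_iff)
  then have t: "0 < t" "t < real L" using k(1) by (auto simp: t_def field_simps)
  \<comment> \<open>The largest margin whose inner interval still contains \<open>t\<close>.\<close>
  define z where "z = min t (real L - t)"
  have z: "z > 0" using t by (auto simp: z_def)
  let ?I = "\<lambda>l. {i::nat. i \<ge> 1 \<and> real i \<in> (\<lambda>t. 2 ^ l * t) ` inner_interval (real L) z}"
  let ?s = "\<lambda>l. SUP i\<in>?I l. ennreal (norm (\<Phi> (real i / 2 ^ l) - (G ^^ l) P ! i))"
  have "?s \<longlonglongrightarrow> 0"
    using lc z unfolding limit_curve_def param_length_eq[OF P] by simp
  then have lim: "(\<lambda>l. ?s (l + r)) \<longlonglongrightarrow> 0" by (rule LIMSEQ_ignore_initial_segment)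
  have "(\<lambda>l. ennreal (norm (\<Phi> t - (G ^^ (r + l)) P ! (2 ^ l * k)))) \<longlonglongrightarrow> 0"
  proof (rule tendsto_sandwich[OF _ _ tendsto_const lim])
    have "ennreal (norm (\<Phi> t - (G ^^ (r + l)) P ! (2 ^ l * k))) \<le> ?s (l + r)" for l
    proof -
      have "real (2 ^ l * k) = 2 ^ (l + r) * t" by (simp add: t_def power_add)
      moreover have "t \<in> inner_interval (real L) z" using t by (auto simp: inner_interval_def z_def)
      moreover have "2 ^ l * k \<ge> 1" using k by (simp add: Suc_le_eq)
      ultimately have "2 ^ l * k \<in> ?I (l + r)" by blast
      then have "ennreal (norm (\<Phi> (real (2 ^ l * k) / 2 ^ (l + r)) - (G ^^ (l + r)) P ! (2 ^ l * k)))
          \<le> ?s (l + r)" by (rule SUP_upper)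
      moreover have "real (2 ^ l * k) / 2 ^ (l + r) = t" by (simp add: t_def power_add)
      ultimately show ?thesis by (simp add: add.commute)
    qed
    then show "\<forall>\<^sub>F l in sequentially.
        ennreal (norm (\<Phi> t - (G ^^ (r + l)) P ! (2 ^ l * k))) \<le> ?s (l + r)" by simp
  qed simp
  then have "(\<lambda>l. norm (\<Phi> t - (G ^^ (r + l)) P ! (2 ^ l * k))) \<longlonglongrightarrow> 0"
    by (simp add: ennreal_tendsto_0_iff)
  then have "(\<lambda>l. \<Phi> t - (\<Phi> t - (G ^^ (r + l)) P ! (2 ^ l * k))) \<longlonglongrightarrow> \<Phi> t - 0"
    by (intro tendsto_diff tendsto_const) (rule tendsto_norm_zero_cancel)
  then show ?thesis by (simp add: t_def)
qed

text \<open>The Hoelder condition is stated by a modulus with centered differences and values in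
  \<open>ennreal\<close>. Here it becomes an ordinary Taylor remainder of first order, for one fixed
  margin \<open>z\<close>.\<close>

lemma holder_curve_taylor:
  fixes \<Phi> :: "real \<Rightarrow> 'a::real_normed_vector"
  assumes \<Phi>: "Ck_holder_curve L 1 \<beta> \<Phi>" and z: "z > 0" and \<beta>: "\<beta> > 0"
  obtains H h where "H \<ge> 0" "h > 0"
    "\<And>s t. s \<in> {z..L - z} \<Longrightarrow> t \<in> {z..L - z} \<Longrightarrow> \<bar>t - s\<bar> \<le> h \<Longrightarrow>
      norm (\<Phi> t - \<Phi> s - (t - s) *\<^sub>R vector_derivative \<Phi> (at s)) \<le> H * \<bar>t - s\<bar> powr (1 + \<beta>)"
proof -
  define \<Psi> where "\<Psi> = (\<lambda>t. vector_derivative \<Phi> (at t))"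
  have cd: "curve_deriv 1 \<Phi> = \<Psi>" by (simp add: curve_deriv_def \<Psi>_def)
  have diff: "(\<Phi> has_vector_derivative \<Psi> t) (at t)" if "0 < t" "t < L" for t
    using \<Phi> that unfolding Ck_holder_curve_def Ck_curve_def \<Psi>_def
    by (simp add: curve_deriv_def vector_derivative_works)
  obtain h where h: "h > 0"
    "(SUP h\<in>{0<..h}. ennreal (h powr (- \<beta>)) * modulus L z \<Psi> h) < \<infinity>"
    using \<Phi> z unfolding Ck_holder_curve_def cd by blast
  define S where "S = (SUP h\<in>{0<..h}. ennreal (h powr (- \<beta>)) * modulus L z \<Psi> h)"
  define H where "H = enn2real S"
  have hol: "norm (\<Psi> t - \<Psi> s) \<le> H * (t - s) powr \<beta>"
    if "z \<le> s" "s < t" "t \<le> L - z" "t - s \<le> h" for s t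
  proof -
    \<comment> \<open>The centered modulus is evaluated at the midpoint of \<open>s\<close> and
      \<open>t\<close>, with step \<open>t - s\<close>.\<close>
    let ?h = "t - s" and ?c = "(s + t) / 2"
    have "?c \<in> inner_interval L (z + ?h / 2)" using that by (auto simp: inner_interval_def field_simps)
    then have "ennreal (norm (\<Psi> (?c + ?h / 2) - \<Psi> (?c - ?h / 2))) \<le> modulus L z \<Psi> ?h"
      unfolding modulus_def curve_norm_def by (rule SUP_upper)
    moreover have "?c + ?h / 2 = t" "?c - ?h / 2 = s" by (simp_all add: field_simps)
    ultimately have "ennreal (norm (\<Psi> t - \<Psi> s)) \<le> modulus L z \<Psi> ?h" by simp
    then have "ennreal (?h powr (- \<beta>)) * ennreal (norm (\<Psi> t - \<Psi> s)) \<le>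
        ennreal (?h powr (- \<beta>)) * modulus L z \<Psi> ?h" by (intro mult_left_mono) auto
    also have "\<dots> \<le> S" unfolding S_def using that by (intro SUP_upper) auto
    also have "S = ennreal H" using h(2) by (simp add: H_def S_def)
    finally have "ennreal (?h powr (- \<beta>) * norm (\<Psi> t - \<Psi> s)) \<le> ennreal H"
      by (simp add: ennreal_mult)
    then have "?h powr (- \<beta>) * norm (\<Psi> t - \<Psi> s) \<le> H"
      by (simp add: H_def)
    then show ?thesis using that by (simp add: powr_minus field_simps)
  qed
  have hol': "norm (\<Psi> t - \<Psi> s) \<le> H * \<bar>t - s\<bar> powr \<beta>"
    if "s \<in> {z..L - z}" "t \<in> {z..L - z}" "\<bar>t - s\<bar> \<le> h" for s t
    using hol[of s t] hol[of t s] that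
    by (cases s t rule: linorder_cases) (auto simp: norm_minus_commute)
  show ?thesis
  proof (rule that[of H h])
    fix s t assume st: "s \<in> {z..L - z}" "t \<in> {z..L - z}" "\<bar>t - s\<bar> \<le> h"
    have "norm (\<Phi> t - \<Phi> s - (t - s) *\<^sub>R \<Psi> s) \<le> norm (t - s) * (H * \<bar>t - s\<bar> powr \<beta>)"
    proof (rule vector_differentiable_bound_linearization[where S = "closed_segment s t"])
      fix x assume x: "x \<in> closed_segment s t"
      then have x': "x \<in> {z..L - z}" "\<bar>x - s\<bar> \<le> \<bar>t - s\<bar>"
        using st by (auto simp: closed_segment_eq_real_ivl split: if_splits)
      show "(\<Phi> has_vector_derivative \<Psi> x) (at x within closed_segment s t)"
        using diff[of x] x'(1) z by (auto intro: has_vector_derivative_at_within)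
      have "norm (\<Psi> x - \<Psi> s) \<le> H * \<bar>x - s\<bar> powr \<beta>" using x' st by (intro hol') auto
      also have "\<dots> \<le> H * \<bar>t - s\<bar> powr \<beta>"
        using x'(2) \<beta> by (intro mult_left_mono powr_mono2) (auto simp: H_def)
      finally show "norm (\<Psi> x - \<Psi> s) \<le> H * \<bar>t - s\<bar> powr \<beta>" .
    qed auto
    also have "\<dots> = H * \<bar>t - s\<bar> powr (1 + \<beta>)"
      by (cases "t = s") (auto simp: powr_add)
    finally show "norm (\<Phi> t - \<Phi> s - (t - s) *\<^sub>R vector_derivative \<Phi> (at s)) \<le> H * \<bar>t - s\<bar> powr (1 + \<beta>)"
      by (simp add: \<Psi>_def)
  qed (use h in \<open>auto simp: H_def\<close>)
qed

text \<open>Together with \<open>weights\<close>, the assumption \<open>moment\<close> expresses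
  reproduction of affine data up to the shift \<open>\<sigma>\<close>. For the schemes associated
  with a GLUE-scheme it is supplied by \<open>lin_sub_moment\<close>, with the same shift for
  both.\<close>

locale smooth_linear_scheme =
  fixes m :: nat and a :: "nat \<Rightarrow> nat \<Rightarrow> real" and S :: "'d::{finite,linorder} chain \<Rightarrow> 'd chain"
    and \<sigma> \<alpha> :: real
  assumes weights: "\<And>\<mu>. \<mu> \<in> {0, 1} \<Longrightarrow> (\<Sum>j\<le>m. a \<mu> j) = 1"
    and moment: "\<And>\<mu>. \<mu> \<in> {0, 1} \<Longrightarrow> (\<Sum>j\<le>m. a \<mu> j * real j) = (real \<mu> + \<sigma>) / 2"
    and scheme: "\<And>P. length P \<ge> 2 * m + 1 \<Longrightarrow> length (S P) = 2 * length P + 1 - (2 * m + 1) \<and>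
        (\<forall>\<mu>\<in>{0, 1}. \<forall>i < length P - m. S P ! (2 * i + \<mu>) = (\<Sum>j\<le>m. a \<mu> j *\<^sub>R P ! (i + j)))"
    and \<alpha>: "\<alpha> > 0"
    and smooth: "almost_Ck_holder_linear 1 \<alpha> m S"
begin

abbreviation "T r \<equiv> lin_sub m a ^^ r"

lemma T_affine: "T r (\<lambda>i. \<beta> + \<gamma> * real i) k = \<beta> + \<gamma> * (real k / 2 ^ r + \<sigma> * (1 - 1 / 2 ^ r))"
  using fun_cong[OF lin_sub_iter_affine[OF weights moment, of r \<beta> \<gamma>], of k] .

lemma T_const: "T r (\<lambda>_. c) k = c"
  using T_affine[of r c 0 k] by simp

lemma scheme_component:
  assumes "length P = L + 2 * m" "L \<ge> 1" "k < 2 ^ r * L + 2 * m" "\<And>i. i < L + 2 * m \<Longrightarrow> P ! i $ c = x i"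
  shows "(S ^^ r) P ! k $ c = T r x k"
proof -
  have "(S ^^ r) P ! k $ c = T r (\<lambda>i. P ! i $ c) k"
    using linear_scheme_iter[OF scheme assms(1,2), of r c] assms(3) by simp
  also have "\<dots> = T r x k" using assms by (intro lin_sub_iter_cong) auto
  finally show ?thesis .
qed

text \<open>Scalar data are carried in the first coordinate of a chain. The margin is fixed at
  \<open>1/2\<close> because \<open>H\<close> and \<open>h\<close> may depend on it.\<close>

lemma limit_function:
  assumes \<beta>: "0 < \<beta>" "\<beta> < \<alpha>" and L: "L \<ge> 1"
  obtains \<phi> \<psi> :: "real \<Rightarrow> real" and H h where "H \<ge> 0" "h > 0"
    "\<And>k r. 0 < k \<Longrightarrow> k < 2 ^ r * L \<Longrightarrow> (\<lambda>l. T (r + l) x (2 ^ l * k)) \<longlonglongrightarrow> \<phi> (real k / 2 ^ r)"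
    "\<And>s t. s \<in> {1/2..real L - 1/2} \<Longrightarrow> t \<in> {1/2..real L - 1/2} \<Longrightarrow> \<bar>t - s\<bar> \<le> h \<Longrightarrow>
      \<bar>\<phi> t - \<phi> s - (t - s) * \<psi> s\<bar> \<le> H * \<bar>t - s\<bar> powr (1 + \<beta>)"
proof -
  define P :: "'d chain" where "P = map (\<lambda>i. x i *\<^sub>R e_vec) [0..<L + 2 * m]"
  have P: "length P = L + 2 * m" by (simp add: P_def)
  have "Ck_holder_at 1 \<beta> m S P"
    using smooth \<beta> P L unfolding almost_Ck_holder_linear_def almost_Ck_holder_at_def by auto
  then obtain \<Phi> where \<Phi>: "limit_curve m S P \<Phi>" "Ck_holder_curve (real L) 1 \<beta> \<Phi>"
    unfolding Ck_holder_at_def param_length_eq[OF P] by blast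
  obtain H h where H: "H \<ge> 0" "h > 0"
    "\<And>s t. s \<in> {1/2..real L - 1/2} \<Longrightarrow> t \<in> {1/2..real L - 1/2} \<Longrightarrow> \<bar>t - s\<bar> \<le> h \<Longrightarrow>
      norm (\<Phi> t - \<Phi> s - (t - s) *\<^sub>R vector_derivative \<Phi> (at s)) \<le> H * \<bar>t - s\<bar> powr (1 + \<beta>)"
    using holder_curve_taylor[OF \<Phi>(2), of "1/2"] \<beta>(1) by (metis half_gt_zero_iff zero_less_one)
  let ?f = "first_coord :: 'd"
  have comp: "(S ^^ r) P ! k $ ?f = T r x k" if "k < 2 ^ r * L + 2 * m" for r k
    using that L by (intro scheme_component[OF P]) (auto simp: P_def e_vec_def)
  show ?thesis
  proof (rule that[OF H(1,2), of "\<lambda>t. \<Phi> t $ ?f" "\<lambda>t. vector_derivative \<Phi> (at t) $ ?f"])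
    fix k r :: nat assume k: "0 < k" "k < 2 ^ r * L"
    have "(\<lambda>l. (S ^^ (r + l)) P ! (2 ^ l * k) $ ?f) \<longlonglongrightarrow> \<Phi> (real k / 2 ^ r) $ ?f"
      by (intro tendsto_vec_nth limit_curve_dyadic[OF \<Phi>(1) P k])
    moreover have "2 ^ l * k < 2 ^ (r + l) * L + 2 * m" for l
      using k(2) by (simp add: power_add trans_less_add1 mult.assoc mult.left_commute)
    ultimately show "(\<lambda>l. T (r + l) x (2 ^ l * k)) \<longlonglongrightarrow> \<Phi> (real k / 2 ^ r) $ ?f"
      by (simp add: comp)
  next
    fix s t assume st: "s \<in> {1/2..real L - 1/2}" "t \<in> {1/2..real L - 1/2}" "\<bar>t - s\<bar> \<le> h"
    show "\<bar>\<Phi> t $ ?f - \<Phi> s $ ?f - (t - s) * vector_derivative \<Phi> (at s) $ ?f\<bar> \<le> H * \<bar>t - s\<bar> powr (1 + \<beta>)"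
      using order_trans[OF component_le_norm_cart[of _ ?f] H(3)[OF st]] by simp
  qed
qed

text \<open>Vanishing at dyadic parameters extends to the whole interval by continuity, so
  non-degeneracy makes the data constant. Constants are reproduced, hence the constant is itself the
  limit, which is 0.\<close>

lemma limit_zero_imp_zero:
  assumes lim: "\<And>r k. 0 < k \<Longrightarrow> k < 2 ^ r \<Longrightarrow> (\<lambda>l. T (r + l) x (2 ^ l * k)) \<longlonglongrightarrow> 0"
    and i: "i < 2 * m + 1"
  shows "x i = 0"
proof -
  define P :: "'d chain" where "P = map (\<lambda>i. x i *\<^sub>R e_vec) [0..<1 + 2 * m]"
  have P: "length P = 1 + 2 * m" by (simp add: P_def)
  have nthP: "P ! i = x i *\<^sub>R e_vec" if "i < 1 + 2 * m" for i
    using that by (simp add: P_def del: upt_Suc)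
  have "Ck_holder_at 1 (\<alpha> / 2) m S P"
    using smooth \<alpha> P unfolding almost_Ck_holder_linear_def almost_Ck_holder_at_def by auto
  then obtain \<Phi> where \<Phi>: "limit_curve m S P \<Phi>" unfolding Ck_holder_at_def by blast
  have bnd: "2 ^ l * k < 2 ^ (r + l) * 1 + 2 * m" if "k < 2 ^ r" for l k r
    using that by (simp add: power_add trans_less_add1)
  have dyadic: "\<Phi> (real k / 2 ^ r) = 0" if k: "0 < k" "k < 2 ^ r" for k r
  proof (rule vec_eq_iff[THEN iffD2], rule allI)
    fix c :: 'd
    have *: "(\<lambda>l. (S ^^ (r + l)) P ! (2 ^ l * k) $ c) \<longlonglongrightarrow> \<Phi> (real k / 2 ^ r) $ c"
      using k by (intro tendsto_vec_nth limit_curve_dyadic[OF \<Phi> P]) auto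
    have "(\<lambda>l. (S ^^ (r + l)) P ! (2 ^ l * k) $ c) \<longlonglongrightarrow> 0"
    proof (cases "c = first_coord")
      case True
      have "(S ^^ (r + l)) P ! (2 ^ l * k) $ c = T (r + l) x (2 ^ l * k)" for l
        using bnd[OF k(2)] by (intro scheme_component[OF P]) (simp_all add: nthP e_vec_def True)
      then show ?thesis using lim[OF k] by simp
    next
      case False
      have "(S ^^ (r + l)) P ! (2 ^ l * k) $ c = T (r + l) (\<lambda>_. 0) (2 ^ l * k)" for l
        using bnd[OF k(2)] False
        by (intro scheme_component[OF P]) (simp_all add: nthP e_vec_def axis_def)
      then show ?thesis by (simp add: T_const)
    qed
    with * show "\<Phi> (real k / 2 ^ r) $ c = 0 $ c" using LIMSEQ_unique by fastforce
  qed
  have "\<Phi> t = 0" if t: "0 < t" "t < 1" for t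
  proof -
    have lt: "(\<lambda>l. real (dyadic_index l t) / 2 ^ l) \<longlonglongrightarrow> t"
      using t by (intro dyadic_index_tendsto) auto
    have "isCont \<Phi> t" using \<Phi> by (auto simp: limit_curve_def continuous_on_eq_continuous_at)
    then have 1: "(\<lambda>l. \<Phi> (real (dyadic_index l t) / 2 ^ l)) \<longlonglongrightarrow> \<Phi> t"
      using lt by (rule isCont_tendsto_compose)
    have "\<forall>\<^sub>F l in sequentially. 0 < real (dyadic_index l t) / 2 ^ l"
      using order_tendstoD(1)[OF lt t(1)] .
    then have "\<forall>\<^sub>F l in sequentially. \<Phi> (real (dyadic_index l t) / 2 ^ l) = 0"
    proof eventually_elim
      case (elim l)
      have "dyadic_index l t < 2 ^ l * 1" using t by (intro dyadic_index_less) auto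
      then show ?case using elim by (intro dyadic) (auto simp: zero_less_divide_iff)
    qed
    then have "(\<lambda>l. \<Phi> (real (dyadic_index l t) / 2 ^ l)) \<longlonglongrightarrow> 0" by (rule tendsto_eventually)
    with 1 show ?thesis using LIMSEQ_unique by blast
  qed
  then have "\<exists>c. \<forall>t\<in>{0<..<param_length m P}. \<Phi> t = c"
    using param_length_eq[OF P] by auto
  moreover have "non_degenerate m S" using smooth by (simp add: almost_Ck_holder_linear_def)
  moreover have "length P \<ge> 2 * m + 1" using P by simp
  ultimately have "\<exists>c. \<forall>p\<in>set P. p = c" using \<Phi> unfolding non_degenerate_def by blast
  then obtain c where c: "\<And>i. i < 1 + 2 * m \<Longrightarrow> P ! i = c" using P by (metis nth_mem)
  have const: "x j = x 0" if "j < 1 + 2 * m" for j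
  proof -
    have "P ! j $ first_coord = P ! 0 $ first_coord" using c that by simp
    then show ?thesis using that by (simp add: nthP e_vec_def)
  qed
  have "T (1 + l) x (2 ^ l * 1) = x 0" for l
  proof -
    have "T (1 + l) x (2 ^ l * 1) = T (1 + l) (\<lambda>_. x 0) (2 ^ l * 1)"
      by (rule lin_sub_iter_cong[where L = 1]) (erule const, use bnd[of 1 1 l] in simp)
    also have "\<dots> = x 0" by (rule T_const)
    finally show ?thesis .
  qed
  then have "(\<lambda>l. T (1 + l) x (2 ^ l * 1)) \<longlonglongrightarrow> x 0" by (simp only: tendsto_const)
  moreover have "(\<lambda>l. T (1 + l) x (2 ^ l * 1)) \<longlonglongrightarrow> 0" by (rule lim) auto
  ultimately have "x 0 = 0" using LIMSEQ_unique by blast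
  then show ?thesis using const[of i] i by simp
qed

text \<open>The limits of unit data, viewed as functions of the pair \<open>(r, k)\<close> that
  codes a dyadic parameter, are linearly independent by \<open>limit_zero_imp_zero\<close>. Their
  dual functionals give a constant that depends on the scheme only.\<close>

lemma bounded_by_limit:
  obtains C where "C \<ge> 0"
    "\<And>x b i. b \<ge> 0 \<Longrightarrow> (\<And>r k. 0 < k \<Longrightarrow> k < 2 ^ r \<Longrightarrow> \<exists>y. (\<lambda>l. T (r + l) x (2 ^ l * k)) \<longlonglongrightarrow> y \<and> \<bar>y\<bar> \<le> b)
      \<Longrightarrow> i < 2 * m + 1 \<Longrightarrow> \<bar>x i\<bar> \<le> C * b"
proof -
  define \<delta> where "\<delta> j i = (if i = j then 1 else 0 :: real)" for i j :: nat
  define f where "f j rk = lim (\<lambda>l. T (fst rk + l) (\<delta> j) (2 ^ l * snd rk))" for j and rk :: "nat \<times> nat"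
  let ?D = "{(r, k). 0 < k \<and> k < (2::nat) ^ r}"
  have f: "(\<lambda>l. T (r + l) x (2 ^ l * k)) \<longlonglongrightarrow> (\<Sum>j<2 * m + 1. x j * f j (r, k))"
    if k: "0 < k" "k < 2 ^ r" for x r k
  proof -
    have "(\<lambda>l. T (r + l) (\<delta> j) (2 ^ l * k)) \<longlonglongrightarrow> f j (r, k)" for j
    proof -
      have "0 < \<alpha> / 2" "\<alpha> / 2 < \<alpha>" "(1::nat) \<le> 1" using \<alpha> by auto
      then obtain \<phi> where
        "\<And>k r. 0 < k \<Longrightarrow> k < 2 ^ r * 1 \<Longrightarrow> (\<lambda>l. T (r + l) (\<delta> j) (2 ^ l * k)) \<longlonglongrightarrow> \<phi> (real k / 2 ^ r)"
        by (rule limit_function[of _ _ "\<delta> j"]) (rule that)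
      then have "(\<lambda>l. T (r + l) (\<delta> j) (2 ^ l * k)) \<longlonglongrightarrow> \<phi> (real k / 2 ^ r)" using k by simp
      then show ?thesis by (simp add: f_def limI)
    qed
    then have "(\<lambda>l. \<Sum>j<2 * m + 1. x j * T (r + l) (\<delta> j) (2 ^ l * k)) \<longlonglongrightarrow> (\<Sum>j<2 * m + 1. x j * f j (r, k))"
      by (intro tendsto_intros)
    moreover have "(\<Sum>j<2 * m + 1. x j * T (r + l) (\<delta> j) (2 ^ l * k)) = T (r + l) x (2 ^ l * k)" for l
    proof -
      have "(\<Sum>j<2 * m + 1. x j * T (r + l) (\<delta> j) (2 ^ l * k)) =
          T (r + l) (\<lambda>i. \<Sum>j<2 * m + 1. x j * \<delta> j i) (2 ^ l * k)"
        by (simp only: lin_sub_iter_sum finite_lessThan)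
      also have "\<dots> = T (r + l) x (2 ^ l * k)"
      proof (rule lin_sub_iter_cong[where L = 1])
        fix i assume "i < 1 + 2 * m"
        then show "(\<Sum>j<2 * m + 1. x j * \<delta> j i) = x i"
          by (simp add: \<delta>_def if_distrib[of "\<lambda>y. x _ * y"] cong: if_cong)
      next
        show "2 ^ l * k < 2 ^ (r + l) * 1 + 2 * m"
          using k by (simp add: power_add trans_less_add1)
      qed
      finally show ?thesis .
    qed
    ultimately show ?thesis by simp
  qed
  have "\<forall>x. (\<forall>t\<in>?D. (\<Sum>i<2 * m + 1. x i * f i t) = 0) \<longrightarrow> (\<forall>i<2 * m + 1. x i = 0)"
  proof (intro allI impI)
    fix x i assume x: "\<forall>t\<in>?D. (\<Sum>i<2 * m + 1. x i * f i t) = 0" and i: "i < 2 * m + 1"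
    show "x i = 0"
    proof (rule limit_zero_imp_zero[OF _ i])
      fix r k :: nat assume k: "0 < k" "k < 2 ^ r"
      then show "(\<lambda>l. T (r + l) x (2 ^ l * k)) \<longlonglongrightarrow> 0" using f[OF k, of x] x by auto
    qed
  qed
  then obtain C where C: "C \<ge> 0"
    "\<And>x b i. b \<ge> 0 \<Longrightarrow> (\<And>t. t \<in> ?D \<Longrightarrow> \<bar>\<Sum>j<2 * m + 1. x j * f j t\<bar> \<le> b) \<Longrightarrow> i < 2 * m + 1 \<Longrightarrow> \<bar>x i\<bar> \<le> C * b"
    by (rule coefficients_bounded_by_values) blast
  show ?thesis
  proof (rule that[OF C(1)])
    fix x b i assume b: "b \<ge> 0" and i: "i < 2 * m + 1"
      and x: "\<And>r k. 0 < k \<Longrightarrow> k < 2 ^ r \<Longrightarrow> \<exists>y. (\<lambda>l. T (r + l) x (2 ^ l * k)) \<longlonglongrightarrow> y \<and> \<bar>y\<bar> \<le> b"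
    show "\<bar>x i\<bar> \<le> C * b"
    proof (rule C(2)[OF b _ i])
      fix t assume "t \<in> ?D"
      then obtain r k where t: "t = (r, k)" "0 < k" "k < 2 ^ r" by auto
      then show "\<bar>\<Sum>j<2 * m + 1. x j * f j t\<bar> \<le> b"
        using x[OF t(2,3)] f[OF t(2,3), of x] LIMSEQ_unique by blast
    qed
  qed
qed

end

text \<open>Only second differences of the data enter, so affine parts are free, and one constant
  serves all levels. In this form the smoothness of the linear schemes enters the nonlinear
  argument.\<close>

definition second_diff_rate :: "nat \<Rightarrow> (nat \<Rightarrow> nat \<Rightarrow> real) \<Rightarrow> real \<Rightarrow> real \<Rightarrow> bool" where
  "second_diff_rate m a \<theta> C \<longleftrightarrow> C \<ge> 0 \<and> (\<forall>x c r k. c \<ge> 0 \<longrightarrow>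
      (\<forall>i. i + 2 < 2 * m + 1 \<longrightarrow> \<bar>second_diff x i\<bar> \<le> c) \<longrightarrow> k + 2 < 2 ^ r + 2 * m \<longrightarrow>
      \<bar>second_diff ((lin_sub m a ^^ r) x) k\<bar> \<le> C * \<theta> ^ r * c)"

lemma power_half_powr: "(1 / 2 ^ r :: real) powr b = (2 powr (- b)) ^ r"
proof -
  have "(1 / 2 ^ r :: real) = 2 powr (- real r)"
    by (simp add: powr_minus powr_realpow divide_inverse)
  then show ?thesis by (simp add: powr_powr powr_power mult.commute)
qed

context smooth_linear_scheme
begin

text \<open>Bounded data keep the combination of the Taylor remainders of the unit limits under
  control, and \<open>r \<ge> r0\<close> makes a piece of the curve shorter than the range of the
  Taylor estimates. Both restrictions are lifted in \<open>second_diff_decay\<close>.\<close>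

lemma second_diff_decay_bounded_data:
  assumes \<beta>: "0 < \<beta>" "\<beta> < \<alpha>" and m: "m \<ge> 1"
  obtains C r0 where "C \<ge> 0"
    "\<And>x c r k. c \<ge> 0 \<Longrightarrow> (\<And>i. i < 2 * m + 1 \<Longrightarrow> \<bar>x i\<bar> \<le> c) \<Longrightarrow> r \<ge> r0 \<Longrightarrow> k + 2 < 2 ^ r + 2 * m \<Longrightarrow>
      \<bar>second_diff (T r x) k\<bar> \<le> C * (2 powr (- (1 + \<beta>))) ^ r * c"
proof -
  define \<theta> :: real where "\<theta> = 2 powr (- (1 + \<beta>))"
  obtain C where C: "C \<ge> 0"
    "\<And>x b i. b \<ge> 0 \<Longrightarrow> (\<And>r k. 0 < k \<Longrightarrow> k < 2 ^ r \<Longrightarrow> \<exists>y. (\<lambda>l. T (r + l) x (2 ^ l * k)) \<longlonglongrightarrow> y \<and> \<bar>y\<bar> \<le> b)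
      \<Longrightarrow> i < 2 * m + 1 \<Longrightarrow> \<bar>x i\<bar> \<le> C * b"
    using bounded_by_limit by blast
  \<comment> \<open>Unit data placed one index after \<open>j\<close>: with index 0 free and one
    more zero at the end there are \<open>2 * m + 3\<close> points, hence the parameter interval of
    length 3.\<close>
  define \<delta> where "\<delta> j i = (if i = Suc j then 1 else 0 :: real)" for i j :: nat
  define Q where "Q j \<phi> \<psi> H h \<longleftrightarrow> H \<ge> 0 \<and> h > 0 \<and>
    (\<forall>k r. 0 < k \<longrightarrow> k < 2 ^ r * 3 \<longrightarrow> (\<lambda>l. T (r + l) (\<delta> j) (2 ^ l * k)) \<longlonglongrightarrow> \<phi> (real k / 2 ^ r)) \<and>
    (\<forall>s\<in>{1/2..5/2}. \<forall>t\<in>{1/2..5/2}. \<bar>t - s\<bar> \<le> h \<longrightarrow>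
      \<bar>\<phi> t - \<phi> s - (t - s) * \<psi> s\<bar> \<le> H * \<bar>t - s\<bar> powr (1 + \<beta>))"
    for j \<phi> \<psi> and H h :: real
  have "\<exists>\<phi> \<psi> H h. Q j \<phi> \<psi> H h" for j
  proof -
    have "(3::nat) \<ge> 1" by simp
    show ?thesis
    proof (rule limit_function[OF \<beta> \<open>3 \<ge> 1\<close>, of "\<delta> j"])
      fix \<phi> \<psi> :: "real \<Rightarrow> real" and H h :: real
      assume "H \<ge> 0" "h > 0"
        "\<And>k r. 0 < k \<Longrightarrow> k < 2 ^ r * 3 \<Longrightarrow> (\<lambda>l. T (r + l) (\<delta> j) (2 ^ l * k)) \<longlonglongrightarrow> \<phi> (real k / 2 ^ r)"
        "\<And>s t. s \<in> {1/2..real 3 - 1/2} \<Longrightarrow> t \<in> {1/2..real 3 - 1/2} \<Longrightarrow> \<bar>t - s\<bar> \<le> h \<Longrightarrow>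
          \<bar>\<phi> t - \<phi> s - (t - s) * \<psi> s\<bar> \<le> H * \<bar>t - s\<bar> powr (1 + \<beta>)"
      then have "Q j \<phi> \<psi> H h" unfolding Q_def by simp
      then show ?thesis by blast
    qed
  qed
  then obtain \<phi> \<psi> H h where Q: "\<And>j. Q j (\<phi> j) (\<psi> j) (H j) (h j)" by metis
  have H: "H j \<ge> 0" and h: "h j > 0"
    and lim: "0 < k \<Longrightarrow> k < 2 ^ r * 3 \<Longrightarrow> (\<lambda>l. T (r + l) (\<delta> j) (2 ^ l * k)) \<longlonglongrightarrow> \<phi> j (real k / 2 ^ r)"
    and taylor: "s \<in> {1/2..5/2} \<Longrightarrow> t \<in> {1/2..5/2} \<Longrightarrow> \<bar>t - s\<bar> \<le> h j \<Longrightarrow>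
      \<bar>\<phi> j t - \<phi> j s - (t - s) * \<psi> j s\<bar> \<le> H j * \<bar>t - s\<bar> powr (1 + \<beta>)" for j k r s t
    using Q[of j] unfolding Q_def by blast+
  define h0 where "h0 = Min (h ` {..<2 * m + 1})"
  have h0: "h0 > 0" "\<And>j. j < 2 * m + 1 \<Longrightarrow> h0 \<le> h j"
    unfolding h0_def using h by (auto simp: lessThan_empty_iff)
  \<comment> \<open>From this level on, the parameter length \<open>1 / 2 ^ r\<close> of a window is
    within the range of the Taylor estimates of all unit limits.\<close>
  obtain r0 where r0: "(1 / 2 :: real) ^ r0 < h0" using real_arch_pow_inv[OF h0(1), of "1/2"] by auto
  define HH where "HH = (\<Sum>j<2 * m + 1. H j)"
  have HH: "HH \<ge> 0" unfolding HH_def using H by (intro sum_nonneg) auto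
  have small: "\<bar>second_diff (T r x) \<kappa>\<bar> \<le> (4 * (C * HH)) * \<theta> ^ r * c"
    if c: "c \<ge> 0" and x: "\<And>i. i < 2 * m + 1 \<Longrightarrow> \<bar>x i\<bar> \<le> c" and r: "r \<ge> r0"
      and \<kappa>: "\<kappa> + 2 < 2 ^ r + 2 * m" for x c r \<kappa>
  proof -
    \<comment> \<open>\<open>k\<close> is a window containing the second difference at
      \<open>\<kappa>\<close>, and \<open>i0\<close> its place there. Indices past the last window
      start are assigned to the last window.\<close>
    define k where "k = min \<kappa> (2 ^ r - 1)"
    define i0 where "i0 = \<kappa> - k"
    have "(0::nat) < 2 ^ r" by simp
    then have k: "k < 2 ^ r" unfolding k_def by linarith
    have i0: "\<kappa> = k + i0" "i0 + 2 < 2 * m + 1"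
      using \<kappa> m \<open>0 < 2 ^ r\<close> unfolding i0_def k_def by linarith+
    \<comment> \<open>Padding \<open>x\<close> by one zero on each side moves its parameter interval to \<open>(1, 2)\<close>, which has
      positive distance to the boundary of \<open>(0, 3)\<close>, so that the Hoelder estimate is uniform.\<close>
    define X where "X i = (\<Sum>j<2 * m + 1. x j * \<delta> j i)" for i
    have X: "X (1 + i) = x i" if "i < 1 + 2 * m" for i
      using that by (simp add: X_def \<delta>_def if_distrib[of "\<lambda>y. x _ * y"] cong: if_cong)
    have TX: "T r X (2 ^ r + k') = T r x k'" if "k' < 2 ^ r + 2 * m" for k'
    proof -
      have "T r X (2 ^ r * 1 + k') = T r (\<lambda>i. X (1 + i)) k'" by (simp only: lin_sub_iter_shift)
      also have "\<dots> = T r x k'"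
        by (rule lin_sub_iter_cong[where L = 1]) (use X that in auto)
      finally show ?thesis by simp
    qed
    \<comment> \<open>The parameter of the left end of window \<open>k\<close>; the summand 1 is the
      index shift in \<open>\<delta>\<close>.\<close>
    define t0 where "t0 = 1 + real k / 2 ^ r"
    \<comment> \<open>Slope and constant of the line to be subtracted from the window: the Taylor
      polynomial of the limit at \<open>t0\<close>, in steps of \<open>1 / 2 ^ r\<close>. The term
      \<open>\<gamma> * \<sigma>\<close> cancels the shift that affine data acquire in the
      limit.\<close>
    define \<gamma> where "\<gamma> = (\<Sum>j<2 * m + 1. x j * \<psi> j t0) / 2 ^ r"
    define \<beta>0 where "\<beta>0 = (\<Sum>j<2 * m + 1. x j * \<phi> j t0) - \<gamma> * \<sigma>"
    define Y where "Y i = T r x (k + i) - (\<beta>0 + \<gamma> * real i)" for i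
    define b where "b = HH * \<theta> ^ r * c"
    have b: "b \<ge> 0" using HH c by (simp add: b_def \<theta>_def)
    have Y: "\<bar>Y i\<bar> \<le> C * b" if "i < 2 * m + 1" for i
    proof (rule C(2)[OF b _ that])
      fix r' k' :: nat assume k': "0 < k'" "k' < 2 ^ r'"
      \<comment> \<open>The index, at level \<open>r + r'\<close> of the data \<open>X\<close>, of
        the point that has index \<open>k'\<close> at level \<open>r'\<close> of the window.\<close>
      define K where "K = 2 ^ r' * (2 ^ r + k) + k'"
      have "K < 2 ^ r' * (2 ^ r + k + 1)" using k' by (simp add: K_def)
      also have "\<dots> \<le> 2 ^ r' * (2 ^ r * 3)" using k by (intro mult_left_mono) auto
      finally have K: "0 < K" "K < 2 ^ (r + r') * 3" using k' by (auto simp: K_def power_add mult_ac)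
      define t where "t = real K / 2 ^ (r + r')"
      define s where "s = real k' / 2 ^ r'"
      have "real k' \<le> real (2 ^ r')" using k' by (intro of_nat_mono) simp
      then have s: "0 \<le> s" "s \<le> 1" by (auto simp: s_def)
      have t: "t = t0 + s / 2 ^ r"
        by (simp add: t_def K_def t0_def s_def power_add field_simps)
      have Xlim: "(\<lambda>l. T (r + r' + l) X (2 ^ l * K)) \<longlonglongrightarrow> (\<Sum>j<2 * m + 1. x j * \<phi> j t)"
      proof -
        have "(\<lambda>l. \<Sum>j<2 * m + 1. x j * T (r + r' + l) (\<delta> j) (2 ^ l * K)) \<longlonglongrightarrow> (\<Sum>j<2 * m + 1. x j * \<phi> j t)"
          unfolding t_def by (intro tendsto_intros lim K)
        moreover have "(\<Sum>j<2 * m + 1. x j * T (r + r' + l) (\<delta> j) (2 ^ l * K)) = T (r + r' + l) X (2 ^ l * K)" for l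
          unfolding X_def by (simp only: lin_sub_iter_sum finite_lessThan)
        ultimately show ?thesis by simp
      qed
      have TY: "T (r' + l) Y (2 ^ l * k') = T (r + r' + l) X (2 ^ l * K) -
          (\<beta>0 + \<gamma> * (s / 1 + \<sigma> * (1 - (1 / 2) ^ (r' + l))))" for l
      proof -
        have bnd: "2 ^ l * k' < 2 ^ (r' + l) * 1 + 2 * m"
          using k' by (simp add: power_add trans_less_add1)
        have "T (r' + l) Y (2 ^ l * k') =
            T (r' + l) (\<lambda>i. 1 * T r X ((2 ^ r + k) + i) + (-1) * (\<beta>0 + \<gamma> * real i)) (2 ^ l * k')"
        proof (rule lin_sub_iter_cong[OF _ bnd])
          fix i assume "i < 1 + 2 * m"
          then show "Y i = 1 * T r X ((2 ^ r + k) + i) + (-1) * (\<beta>0 + \<gamma> * real i)"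
            using TX[of "k + i"] k by (simp add: Y_def add.assoc)
        qed
        also have "\<dots> = T (r' + l) (\<lambda>i. T r X ((2 ^ r + k) + i)) (2 ^ l * k') -
            T (r' + l) (\<lambda>i. \<beta>0 + \<gamma> * real i) (2 ^ l * k')"
          by (subst lin_sub_iter_linear) simp
        also have "T (r' + l) (\<lambda>i. T r X ((2 ^ r + k) + i)) (2 ^ l * k') =
            (T (r' + l) \<circ> T r) X (2 ^ (r' + l) * (2 ^ r + k) + 2 ^ l * k')"
          by (simp only: lin_sub_iter_shift o_apply)
        also have "T (r' + l) \<circ> T r = T (r + r' + l)"
          by (simp add: add.commute add.left_commute flip: funpow_add)
        also have "2 ^ (r' + l) * (2 ^ r + k) + 2 ^ l * k' = 2 ^ l * K"
          by (simp add: K_def power_add algebra_simps)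
        also have "T (r' + l) (\<lambda>i. \<beta>0 + \<gamma> * real i) (2 ^ l * k') =
            \<beta>0 + \<gamma> * (s / 1 + \<sigma> * (1 - (1 / 2) ^ (r' + l)))"
          unfolding T_affine by (simp add: s_def power_add power_divide)
        finally show ?thesis .
      qed
      let ?y = "(\<Sum>j<2 * m + 1. x j * \<phi> j t) - (\<beta>0 + \<gamma> * (s / 1 + \<sigma> * (1 - 0)))"
      have "(\<lambda>l. (1 / 2 :: real) ^ (r' + l)) \<longlonglongrightarrow> 0"
        using LIMSEQ_ignore_initial_segment[OF LIMSEQ_power_zero[of "1 / 2 :: real"], of r']
        by (simp add: add.commute)
      then have "(\<lambda>l. T (r' + l) Y (2 ^ l * k')) \<longlonglongrightarrow> ?y"
        unfolding TY by (intro tendsto_intros Xlim)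
      moreover have "\<bar>?y\<bar> \<le> b"
      proof -
        have ts: "t - t0 = s / 2 ^ r" using t by simp
        \<comment> \<open>With this choice of \<open>\<beta>0\<close> and \<open>\<gamma>\<close>
          the limit of \<open>Y\<close> is exactly a Taylor remainder at \<open>t0\<close>.\<close>
        have "?y = (\<Sum>j<2 * m + 1. x j * \<phi> j t) - (\<Sum>j<2 * m + 1. x j * \<phi> j t0)
            - (t - t0) * (\<Sum>j<2 * m + 1. x j * \<psi> j t0)"
          unfolding ts by (simp add: \<beta>0_def \<gamma>_def algebra_simps add_divide_distrib
              del: sum.lessThan_Suc)
        also have "\<dots> = (\<Sum>j<2 * m + 1. x j * (\<phi> j t - \<phi> j t0 - (t - t0) * \<psi> j t0))"
          by (simp only: right_diff_distrib sum_subtractf sum_distrib_left mult.left_commute)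
        also have "\<bar>\<dots>\<bar> \<le> (\<Sum>j<2 * m + 1. c * (H j * \<theta> ^ r))"
        proof (intro order.trans[OF sum_abs] sum_mono)
          fix j assume j: "j \<in> {..<2 * m + 1}"
          have "s / 2 ^ r \<le> 1 / 2 ^ r" using s by (intro divide_right_mono) auto
          then have le: "\<bar>t - t0\<bar> \<le> 1 / 2 ^ r" using ts s by simp
          have "(2::real) ^ r0 \<le> 2 ^ r" using r by (intro power_increasing) auto
          then have "1 / 2 ^ r \<le> (1 / 2 :: real) ^ r0" by (simp add: power_divide frac_le)
          then have le': "\<bar>t - t0\<bar> \<le> h j" using le r0 h0(2)[of j] j by simp
          have "real (k + 1) \<le> real (2 ^ r)" using k by (intro of_nat_mono) simp
          then have k1: "real k + 1 \<le> 2 ^ r" by simp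
          have "real k / 2 ^ r \<le> 1" using k by simp
          then have t0: "1 \<le> t0" "t0 \<le> 2" by (auto simp: t0_def)
          have "real k + s \<le> 2 ^ r" using k1 s by simp
          then have "t \<le> 2" by (simp add: t t0_def field_simps)
          moreover have "1 \<le> t" using t0 s by (simp add: t add_increasing2)
          ultimately have "\<bar>\<phi> j t - \<phi> j t0 - (t - t0) * \<psi> j t0\<bar> \<le> H j * \<bar>t - t0\<bar> powr (1 + \<beta>)"
            using t0 le' by (intro taylor) auto
          also have "\<dots> \<le> H j * (1 / 2 ^ r) powr (1 + \<beta>)"
            using le \<beta> H by (intro mult_left_mono powr_mono2) auto
          also have "\<dots> = H j * \<theta> ^ r" by (simp only: power_half_powr \<theta>_def)
          finally show "\<bar>x j * (\<phi> j t - \<phi> j t0 - (t - t0) * \<psi> j t0)\<bar> \<le> c * (H j * \<theta> ^ r)"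
            unfolding abs_mult using x[of j] j c by (intro mult_mono) auto
        qed
        also have "\<dots> = b" by (simp only: b_def HH_def sum_distrib_left[symmetric] sum_distrib_right[symmetric] mult_ac)
        finally show ?thesis .
      qed
      ultimately show "\<exists>y. (\<lambda>l. T (r' + l) Y (2 ^ l * k')) \<longlonglongrightarrow> y \<and> \<bar>y\<bar> \<le> b" by blast
    qed
    have "second_diff (T r x) \<kappa> = second_diff Y i0"
      unfolding i0(1) by (simp add: Y_def algebra_simps)
    then have "norm (second_diff (T r x) \<kappa>) \<le> 4 * (C * b)"
      using Y[of i0] Y[of "i0 + 1"] Y[of "i0 + 2"] i0(2)
      by (simp only:) (rule norm_second_diff_le; simp)
    then show ?thesis by (simp add: b_def mult_ac)
  qed
  show ?thesis
    by (rule that[of "4 * (C * HH)" r0]) (use C(1) HH small in \<open>auto simp: \<theta>_def\<close>)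
qed

text \<open>Subtracting the line through the first two points leaves the second differences of all
  levels unchanged, by affine reproduction, and makes the data bounded by
  \<open>N * c\<close>.\<close>

lemma second_diff_decay:
  assumes \<beta>: "0 < \<beta>" "\<beta> < \<alpha>" and m: "m \<ge> 1"
  shows "\<exists>C. second_diff_rate m a (2 powr (- (1 + \<beta>))) C"
proof -
  define \<theta> :: real where "\<theta> = 2 powr (- (1 + \<beta>))"
  have \<theta>: "0 < \<theta>" "\<theta> \<le> 1" using \<beta> powr_mono[of "- (1 + \<beta>)" 0 2] by (auto simp: \<theta>_def)
  obtain C r0 where C: "C \<ge> 0"
    "\<And>x c r k. c \<ge> 0 \<Longrightarrow> (\<And>i. i < 2 * m + 1 \<Longrightarrow> \<bar>x i\<bar> \<le> c) \<Longrightarrow> r \<ge> r0 \<Longrightarrow> k + 2 < 2 ^ r + 2 * m \<Longrightarrow>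
      \<bar>second_diff (T r x) k\<bar> \<le> C * \<theta> ^ r * c"
    by (rule second_diff_decay_bounded_data[OF assms, folded \<theta>_def]) (erule that, blast)
  define K where "K = 1 + (\<Sum>j\<le>m. \<bar>a 0 j\<bar>) + (\<Sum>j\<le>m. \<bar>a 1 j\<bar>)"
  have nonneg: "0 \<le> (\<Sum>j\<le>m. \<bar>a 0 j\<bar>)" "0 \<le> (\<Sum>j\<le>m. \<bar>a 1 j\<bar>)" by (simp_all add: sum_nonneg)
  have K: "(\<Sum>j\<le>m. \<bar>a \<mu> j\<bar>) \<le> K" if "\<mu> \<in> {0, 1}" for \<mu>
    using that nonneg by (auto simp: K_def)
  have K1: "K \<ge> 1" using nonneg by (simp add: K_def)
  \<comment> \<open>The second summand covers the levels below \<open>r0\<close>, where only the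
    growth bound \<open>K ^ r\<close> is at hand; dividing by \<open>\<theta> ^ r0\<close>
    compensates the factor \<open>\<theta> ^ r\<close> of the claim.\<close>
  define C0 where "C0 = C + 4 * K ^ r0 / \<theta> ^ r0"
  have C0: "C \<le> C0" "4 * K ^ r0 / \<theta> ^ r0 \<le> C0" "C0 \<ge> 0" using C(1) K1 \<theta> by (auto simp: C0_def)
  have bounded: "\<bar>second_diff (T r x) k\<bar> \<le> C0 * \<theta> ^ r * c"
    if c: "c \<ge> 0" and x: "\<And>i. i < 2 * m + 1 \<Longrightarrow> \<bar>x i\<bar> \<le> c" and k: "k + 2 < 2 ^ r + 2 * m" for x c r k
  proof (cases "r \<ge> r0")
    case True
    have "\<bar>second_diff (T r x) k\<bar> \<le> C * \<theta> ^ r * c" using C(2) c x True k by blast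
    also have "\<dots> \<le> C0 * \<theta> ^ r * c" using C0 \<theta> c by (intro mult_right_mono) auto
    finally show ?thesis .
  next
    case False
    have T: "norm (T r x i) \<le> K ^ r * c" if "i < 2 ^ r + 2 * m" for i
      using lin_sub_iter_bound[of a m K 1 x c i r, OF K] x c that by simp
    have "norm (second_diff (T r x) k) \<le> 4 * (K ^ r * c)"
      by (rule norm_second_diff_le; rule T) (use k in simp_all)
    also have "K ^ r \<le> K ^ r0" using False K1 by (intro power_increasing) auto
    also have "\<theta> ^ r0 \<le> \<theta> ^ r" using False \<theta> by (intro power_decreasing) auto
    then have "K ^ r0 \<le> K ^ r0 / \<theta> ^ r0 * \<theta> ^ r"
      using \<theta> K1 by (simp add: field_simps)
    finally have "norm (second_diff (T r x) k) \<le> 4 * (K ^ r0 / \<theta> ^ r0 * \<theta> ^ r * c)"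
      using c by (simp add: mult_right_mono)
    also have "\<dots> = (4 * K ^ r0 / \<theta> ^ r0) * \<theta> ^ r * c" by simp
    also have "\<dots> \<le> C0 * \<theta> ^ r * c" using C0 \<theta> c by (intro mult_right_mono) auto
    finally show ?thesis by simp
  qed
  define N where "N = (real (2 * m + 1))\<^sup>2"
  show ?thesis
    unfolding second_diff_rate_def
  proof (intro exI[of _ "C0 * N"] conjI allI impI)
    fix x :: "nat \<Rightarrow> real" and c :: real and r k :: nat
    assume c: "c \<ge> 0" and x: "\<forall>i. i + 2 < 2 * m + 1 \<longrightarrow> \<bar>second_diff x i\<bar> \<le> c" and k: "k + 2 < 2 ^ r + 2 * m"
    define u where "u = x 1 - x 0"
    define y where "y i = 1 * x i + (-1) * (x 0 + u * real i)" for i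
    have y: "\<bar>y i\<bar> \<le> N * c" if "i < 2 * m + 1" for i
    proof -
      have "norm (x i - x 0 - real i *\<^sub>R (x 1 - x 0)) \<le> (real i)\<^sup>2 * c"
        by (rule second_diff_bound[where N = "2 * m + 1"]) (use x c that in auto)
      also have "\<dots> \<le> N * c" unfolding N_def using that c by (intro mult_right_mono power_mono) auto
      finally show ?thesis by (simp add: y_def u_def mult.commute algebra_simps)
    qed
    have "second_diff (T r y) k = second_diff (T r x) k"
      unfolding y_def lin_sub_iter_linear T_affine
      by (simp add: field_simps)
    moreover have "\<bar>second_diff (T r y) k\<bar> \<le> C0 * \<theta> ^ r * (N * c)"
      by (rule bounded) (use c y k in \<open>auto simp: N_def\<close>)
    ultimately show "\<bar>second_diff (T r x) k\<bar> \<le> C0 * N * (2 powr (- (1 + \<beta>))) ^ r * c"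
      by (simp add: \<theta>_def mult_ac)
  qed (use C0 in \<open>simp add: N_def\<close>)
qed

end

section \<open>Relative distortion\<close>

lemma length_fdiff [simp]: "length (fdiff p) = length p - 1"
  by (simp add: fdiff_def)

lemma nth_fdiff: "i + 1 < length p \<Longrightarrow> fdiff p ! i = p ! (i + 1) - p ! i"
  by (simp add: fdiff_def less_diff_conv)

lemma nth_fdiff2: "i + 2 < length p \<Longrightarrow> fdiff (fdiff p) ! i = second_diff ((!) p) i"
  by (simp add: nth_fdiff)

text \<open>Lines are parametrized from the middle index \<open>m\<close>. Constants and slopes are
  then orthogonal, so the normal equations of the projection decouple.\<close>

definition centered_line :: "nat \<Rightarrow> 'a::real_vector \<Rightarrow> 'a \<Rightarrow> 'a list" where
  "centered_line m A B = map (\<lambda>i. A + (real i - real m) *\<^sub>R B) [0..<2 * m + 1]"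

lemma length_centered_line [simp]: "length (centered_line m A B) = 2 * m + 1"
  by (simp add: centered_line_def)

lemma nth_centered_line: "i < 2 * m + 1 \<Longrightarrow> centered_line m A B ! i = A + (real i - real m) *\<^sub>R B"
  by (simp add: centered_line_def del: upt_Suc)

lemma fdiff_centered_line: "fdiff (centered_line m A B) = replicate (2 * m) B"
  by (intro nth_equalityI) (simp_all add: nth_fdiff nth_centered_line algebra_simps)

lemma fdiff_replicate: "fdiff (replicate k B) = replicate (k - 1) 0"
  by (intro nth_equalityI) (simp_all add: nth_fdiff)

lemma linear_chains_iff:
  assumes "m \<ge> 1"
  shows "q \<in> linear_chains (2 * m + 1) \<longleftrightarrow> (\<exists>A B. q = centered_line m A (B::'a::real_normed_vector))"
proof
  assume q: "q \<in> linear_chains (2 * m + 1)"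
  then have len: "length q = 2 * m + 1" and 0: "fdiff (fdiff q) = replicate (2 * m - 1) 0"
    by (simp_all add: linear_chains_def)
  define u where "u = q ! 1 - q ! 0"
  have q: "q ! i = q ! 0 + real i *\<^sub>R u" if "i < 2 * m + 1" for i
  proof -
    have "norm (q ! i - q ! 0 - real i *\<^sub>R (q ! 1 - q ! 0)) \<le> (real i)\<^sup>2 * 0"
    proof (rule second_diff_bound[where N = "2 * m + 1"])
      fix i assume "i + 2 < 2 * m + 1"
      then show "norm (second_diff ((!) q) i) \<le> 0"
        using nth_fdiff2[of i q] len by (simp add: 0)
    qed (use that in auto)
    then show ?thesis by (simp add: u_def algebra_simps)
  qed
  have "q = centered_line m (q ! 0 + real m *\<^sub>R u) u"
  proof (rule nth_equalityI)
    fix i assume "i < length q"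
    then have i: "i < 2 * m + 1" using len by simp
    have "q ! 0 + real i *\<^sub>R u = centered_line m (q ! 0 + real m *\<^sub>R u) u ! i"
      by (simp only: nth_centered_line[OF i]) (simp add: algebra_simps)
    then show "q ! i = centered_line m (q ! 0 + real m *\<^sub>R u) u ! i" using q[OF i] by metis
  qed (simp add: len)
  then show "\<exists>A B. q = centered_line m A B" by blast
next
  assume "\<exists>A B. q = centered_line m A B"
  then show "q \<in> linear_chains (2 * m + 1)"
    by (auto simp: linear_chains_def fdiff_centered_line fdiff_replicate)
qed

definition centered_square_sum :: "nat \<Rightarrow> real" where
  "centered_square_sum m = (\<Sum>i<2 * m + 1. (real i - real m)\<^sup>2)"

lemma centered_sum: "(\<Sum>i<2 * m + 1. real i - real m) = 0"
proof -
  have "(\<Sum>i<2 * m + 1. real i) = real m * (2 * real m + 1)"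
    by (induction m) (simp_all add: algebra_simps)
  then show ?thesis by (simp add: sum_subtractf algebra_simps del: sum.lessThan_Suc)
qed

lemma centered_square_sum_pos: "m \<ge> 1 \<Longrightarrow> centered_square_sum m > 0"
  unfolding centered_square_sum_def by (intro sum_pos2[of _ 0]) auto

lemma centered_moment: "(\<Sum>i<2 * m + 1. (real i - real m) * real i) = centered_square_sum m"
proof -
  have "(\<Sum>i<2 * m + 1. (real i - real m) * real i) =
    centered_square_sum m + real m * (\<Sum>i<2 * m + 1. real i - real m)"
    unfolding centered_square_sum_def sum_distrib_left sum.distrib[symmetric]
    by (intro sum.cong) (auto simp: power2_eq_square algebra_simps)
  then show ?thesis by (simp only: centered_sum)
qed

text \<open>The mixed terms are multiples of the sum of \<open>i - m\<close>, which vanishes.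
  Setting both brackets to 0 gives the normal equations.\<close>

lemma chain_inner_centered_line:
  assumes p: "length p = 2 * m + 1"
  shows "chain_inner (chain_diff p (centered_line m A' B')) (centered_line m A B) =
    ((\<Sum>i<2 * m + 1. p ! i) - real (2 * m + 1) *\<^sub>R A') \<bullet> A +
    ((\<Sum>i<2 * m + 1. (real i - real m) *\<^sub>R p ! i) - centered_square_sum m *\<^sub>R B') \<bullet> B"
proof -
  let ?s = "\<lambda>i. real i - real m"
  have split: "(\<Sum>i<N. f i - c + g i - h i - k i) =
      (\<Sum>i<N. f i) - real N * c + (\<Sum>i<N. g i) - (\<Sum>i<N. h i) - (\<Sum>i<N. k i)"
    for f g h k :: "nat \<Rightarrow> real" and c N
    by (simp add: sum.distrib sum_subtractf)
  have "chain_inner (chain_diff p (centered_line m A' B')) (centered_line m A B) =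
      (\<Sum>i<2 * m + 1. (p ! i - (A' + ?s i *\<^sub>R B')) \<bullet> (A + ?s i *\<^sub>R B))"
    unfolding chain_inner_def chain_diff_def
    by (intro sum.cong) (simp_all add: p nth_centered_line)
  also have "\<dots> = (\<Sum>i<2 * m + 1. p ! i \<bullet> A - A' \<bullet> A + (?s i *\<^sub>R p ! i) \<bullet> B - (?s i)\<^sup>2 * (B' \<bullet> B)
      - ?s i * (B' \<bullet> A + A' \<bullet> B))"
    by (intro sum.cong) (simp_all add: inner_add_left inner_add_right inner_diff_left
        power2_eq_square algebra_simps)
  also have "\<dots> = (\<Sum>i<2 * m + 1. p ! i) \<bullet> A - real (2 * m + 1) * (A' \<bullet> A) +
      (\<Sum>i<2 * m + 1. ?s i *\<^sub>R p ! i) \<bullet> B - centered_square_sum m * (B' \<bullet> B)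
      - (\<Sum>i<2 * m + 1. ?s i) * (B' \<bullet> A + A' \<bullet> B)"
    unfolding split inner_sum_left sum_distrib_right centered_square_sum_def ..
  finally show ?thesis unfolding centered_sum by (simp add: inner_diff_left)
qed

lemma lin_proj_eq:
  fixes p :: "'a::real_inner list"
  assumes m: "m \<ge> 1" and p: "length p = 2 * m + 1"
  shows "lin_proj (2 * m + 1) p = centered_line m
    ((1 / real (2 * m + 1)) *\<^sub>R (\<Sum>i<2 * m + 1. p ! i))
    ((1 / centered_square_sum m) *\<^sub>R (\<Sum>i<2 * m + 1. (real i - real m) *\<^sub>R p ! i))" (is "_ = ?q")
proof -
  let ?c = "centered_square_sum m"
  let ?S0 = "\<Sum>i<2 * m + 1. p ! i" and ?S1 = "\<Sum>i<2 * m + 1. (real i - real m) *\<^sub>R p ! i"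
  have c: "?c > 0" using centered_square_sum_pos[OF m] .
  show ?thesis unfolding lin_proj_def
  proof (rule the_equality)
    have n: "real (2 * m + 1) *\<^sub>R ((1 / real (2 * m + 1)) *\<^sub>R x) = x" for x :: 'a by simp
    have c': "?c *\<^sub>R ((1 / ?c) *\<^sub>R x) = x" for x :: 'a using c by simp
    show "?q \<in> linear_chains (2 * m + 1) \<and>
        (\<forall>r\<in>linear_chains (2 * m + 1). chain_inner (chain_diff p ?q) r = 0)"
    proof (intro conjI ballI)
      show "?q \<in> linear_chains (2 * m + 1)" using linear_chains_iff[OF m] by blast
      fix r :: "'a list" assume "r \<in> linear_chains (2 * m + 1)"
      then obtain A B where r: "r = centered_line m A B" using linear_chains_iff[OF m] by blast
      show "chain_inner (chain_diff p ?q) r = 0"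
        unfolding r chain_inner_centered_line[OF p] n c' by simp
    qed
  next
    fix q assume q: "q \<in> linear_chains (2 * m + 1) \<and>
        (\<forall>r\<in>linear_chains (2 * m + 1). chain_inner (chain_diff p q) r = 0)"
    then obtain A B where AB: "q = centered_line m A B" using linear_chains_iff[OF m] by blast
    have *: "(?S0 - real (2 * m + 1) *\<^sub>R A) \<bullet> x + (?S1 - ?c *\<^sub>R B) \<bullet> y = 0" for x y
    proof -
      have "centered_line m x y \<in> linear_chains (2 * m + 1)" using linear_chains_iff[OF m] by blast
      then have "chain_inner (chain_diff p q) (centered_line m x y) = 0" using q by blast
      then show ?thesis unfolding AB chain_inner_centered_line[OF p] .
    qed
    \<comment> \<open>Uniqueness: each residual of the normal equations is tested against
      itself.\<close>
    have "?S0 - real (2 * m + 1) *\<^sub>R A = 0" using *[of "?S0 - real (2 * m + 1) *\<^sub>R A" 0]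
      by (simp only: inner_zero_right add_0_right inner_eq_zero_iff)
    moreover have "?S1 - ?c *\<^sub>R B = 0" using *[of 0 "?S1 - ?c *\<^sub>R B"]
      by (simp only: inner_zero_right add_0_left inner_eq_zero_iff)
    ultimately have "A = (1 / real (2 * m + 1)) *\<^sub>R ?S0" "B = (1 / ?c) *\<^sub>R ?S1"
      using c by (simp_all del: sum.lessThan_Suc of_nat_add of_nat_Suc of_nat_mult)
    then show "q = ?q" using AB by simp
  qed
qed

text \<open>Distortion is normalized by the slope \<open>v\<close> of the projection, whereas the
  adapted frame uses the first edge \<open>u\<close>. The two differ by at most \<open>K\<close>
  times the largest second difference, so they are comparable for small distortion; this costs the
  factor 2.\<close>

lemma small_distortion:
  fixes m :: nat
  assumes m: "m \<ge> 1"
  obtains \<epsilon>0 where "\<epsilon>0 > 0"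
    "\<And>(p :: 'a::real_inner list) \<epsilon>. length p = 2 * m + 1 \<Longrightarrow> \<epsilon> > 0 \<Longrightarrow> \<epsilon> \<le> \<epsilon>0 \<Longrightarrow>
      distortion0 (2 * m + 1) p \<le> ereal \<epsilon> \<Longrightarrow>
      p ! 1 \<noteq> p ! 0 \<and> (\<forall>i. i + 2 < 2 * m + 1 \<longrightarrow>
        norm (second_diff ((!) p) i) \<le> 2 * \<epsilon> * norm (p ! 1 - p ! 0))"
proof -
  let ?c = "centered_square_sum m"
  have c: "?c > 0" using centered_square_sum_pos[OF m] .
  \<comment> \<open>The weights of the least-squares slope, combined with the quadratic factor of
    \<open>second_diff_bound\<close>.\<close>
  define K where "K = (1 / ?c) * (\<Sum>j<2 * m + 1. \<bar>real j - real m\<bar> * (real j)\<^sup>2)"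
  have K: "K \<ge> 0" unfolding K_def using c by (intro mult_nonneg_nonneg sum_nonneg) auto
  show ?thesis
  \<comment> \<open>Small enough for \<open>\<epsilon> * K \<le> 1 / 2\<close>, so that the term
    with \<open>d\<close> on the right can be absorbed on the left.\<close>
  proof (rule that[of "1 / (2 * (K + 1))"])
    fix p :: "'a list" and \<epsilon> :: real
    assume p: "length p = 2 * m + 1" and \<epsilon>: "\<epsilon> > 0" "\<epsilon> \<le> 1 / (2 * (K + 1))"
      and dist: "distortion0 (2 * m + 1) p \<le> ereal \<epsilon>"
    define v where "v = (1 / ?c) *\<^sub>R (\<Sum>i<2 * m + 1. (real i - real m) *\<^sub>R p ! i)"
    define u where "u = p ! 1 - p ! 0"
    define d where "d = chain_seminorm 2 p"
    have fd: "fdiff (lin_proj (2 * m + 1) p) = replicate (2 * m) v"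
      unfolding lin_proj_eq[OF m p] fdiff_centered_line v_def ..
    have "v \<noteq> 0"
    proof
      assume "v = 0"
      then have "distortion0 (2 * m + 1) p = \<infinity>" unfolding distortion0_def fd by simp
      then show False using dist by simp
    qed
    have pow1: "(fdiff ^^ 1) q = fdiff q" for q :: "'a list" by simp
    have sn: "chain_seminorm 1 (lin_proj (2 * m + 1) p) = norm v"
      unfolding chain_seminorm_def pow1 fd using m by simp
    have "fdiff (lin_proj (2 * m + 1) p) \<noteq> replicate (2 * m + 1 - 1) 0"
      unfolding fd using m \<open>v \<noteq> 0\<close> by simp
    then have "distortion0 (2 * m + 1) p = ereal (d / norm v)"
      unfolding distortion0_def d_def sn by (rule if_P)
    then have "d / norm v \<le> \<epsilon>" using dist by simp
    then have dv: "d \<le> \<epsilon> * norm v" using \<open>v \<noteq> 0\<close> by (simp add: field_simps)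
    have pow2: "(fdiff ^^ 2) q = fdiff (fdiff q)" for q :: "'a list" by (simp add: numeral_2_eq_2)
    have sd: "norm (second_diff ((!) p) i) \<le> d" if "i + 2 < 2 * m + 1" for i
    proof -
      have "fdiff (fdiff p) ! i \<in> set (fdiff (fdiff p))" using that p by (intro nth_mem) simp
      then have "norm (fdiff (fdiff p) ! i) \<le> Max (norm ` set (fdiff (fdiff p)))"
        by (intro Max_ge) auto
      then show ?thesis using nth_fdiff2[of i p] that p
        unfolding d_def chain_seminorm_def pow2 by simp
    qed
    have d0: "d \<ge> 0" using order_trans[OF norm_ge_zero sd[of 0]] m by simp
    have split: "(\<Sum>j<N. s j *\<^sub>R (x j - y - t j *\<^sub>R z)) =
        (\<Sum>j<N. s j *\<^sub>R x j) - (\<Sum>j<N. s j) *\<^sub>R y - (\<Sum>j<N. s j * t j) *\<^sub>R z"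
      for s t and x :: "nat \<Rightarrow> 'a" and y z N
      by (simp add: scaleR_diff_right sum_subtractf scaleR_sum_left)
    \<comment> \<open>The slope functional annihilates constants and returns \<open>u\<close> on a
      line of slope \<open>u\<close>, by \<open>centered_sum\<close> and
      \<open>centered_moment\<close>.\<close>
    have "v - u = (1 / ?c) *\<^sub>R (\<Sum>j<2 * m + 1. (real j - real m) *\<^sub>R (p ! j - p ! 0 - real j *\<^sub>R u))"
    proof -
      have "(\<Sum>j<2 * m + 1. (real j - real m) *\<^sub>R (p ! j - p ! 0 - real j *\<^sub>R u)) =
          (\<Sum>j<2 * m + 1. (real j - real m) *\<^sub>R p ! j) -
          (\<Sum>j<2 * m + 1. real j - real m) *\<^sub>R p ! 0 -
          (\<Sum>j<2 * m + 1. (real j - real m) * real j) *\<^sub>R u"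
        by (rule split)
      then show ?thesis
        unfolding centered_sum centered_moment
        using c by (simp add: v_def scaleR_diff_right del: sum.lessThan_Suc)
    qed
    then have "norm (v - u) = (1 / ?c) * norm (\<Sum>j<2 * m + 1. (real j - real m) *\<^sub>R (p ! j - p ! 0 - real j *\<^sub>R u))"
      using c by (simp del: sum.lessThan_Suc)
    also have "\<dots> \<le> (1 / ?c) * (\<Sum>j<2 * m + 1. \<bar>real j - real m\<bar> * ((real j)\<^sup>2 * d))"
    proof (intro mult_left_mono sum_norm_le)
      fix j assume "j \<in> {..<2 * m + 1}"
      then have "norm (p ! j - p ! 0 - real j *\<^sub>R (p ! 1 - p ! 0)) \<le> (real j)\<^sup>2 * d"
        using sd d0 by (intro second_diff_bound[where N = "2 * m + 1"]) auto
      then show "norm ((real j - real m) *\<^sub>R (p ! j - p ! 0 - real j *\<^sub>R u)) \<le>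
          \<bar>real j - real m\<bar> * ((real j)\<^sup>2 * d)"
        unfolding u_def by (simp add: mult_left_mono)
    qed (use c in auto)
    also have "\<dots> = K * d" by (simp only: K_def sum_distrib_right mult.assoc)
    finally have vu: "norm (v - u) \<le> K * d" .
    have "\<epsilon> * (K + 1) \<le> 1 / (2 * (K + 1)) * (K + 1)" using \<epsilon> K by (intro mult_right_mono) auto
    then have \<epsilon>K: "\<epsilon> * K \<le> 1 / 2" using K \<epsilon> by (simp add: field_simps)
    have "norm v \<le> norm u + K * d" using vu norm_triangle_sub[of v u] by simp
    then have "d \<le> \<epsilon> * (norm u + K * d)" using dv \<epsilon> by (meson mult_left_mono less_imp_le order_trans)
    also have "\<dots> = \<epsilon> * norm u + (\<epsilon> * K) * d" by (simp add: algebra_simps)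
    also have "\<dots> \<le> \<epsilon> * norm u + 1 / 2 * d" using \<epsilon>K d0 by (intro add_left_mono mult_right_mono) auto
    finally have du: "d \<le> 2 * \<epsilon> * norm u" by simp
    have "u \<noteq> 0"
    proof
      assume "u = 0"
      then show False using du d0 vu \<open>v \<noteq> 0\<close> by simp
    qed
    then show "p ! 1 \<noteq> p ! 0 \<and> (\<forall>i. i + 2 < 2 * m + 1 \<longrightarrow>
        norm (second_diff ((!) p) i) \<le> 2 * \<epsilon> * norm (p ! 1 - p ! 0))"
      using order_trans[OF sd du] unfolding u_def by auto
  qed (use K in auto)
qed

lemma distortion0_le_distortion:
  assumes "k + n \<le> length P"
  shows "distortion0 n (subchain n k P) \<le> distortion n P"
proof -
  have "subchains n P = (\<lambda>i. subchain n i P) ` {i. i + n \<le> length P}" by (auto simp: subchains_def)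
  moreover have "finite {i. i + n \<le> length P}"
    by (rule finite_subset[of _ "{..length P}"]) auto
  ultimately have "finite (subchains n P)" by simp
  then show ?thesis unfolding distortion_def using assms
    by (intro Max_ge) (auto simp: subchains_def)
qed

section \<open>Linearization of a GLUE-scheme\<close>

type_synonym 'd point = "real ^ 'd"

text \<open>The derivative of one refinement step at a line in direction \<open>e_vec\<close>,
  acting on infinite sequences: weights \<open>a\<close> along the line, weights \<open>b\<close>
  across it.\<close>

definition split_sub :: "nat \<Rightarrow> (nat \<Rightarrow> nat \<Rightarrow> real) \<Rightarrow> (nat \<Rightarrow> nat \<Rightarrow> real) \<Rightarrow>
    (nat \<Rightarrow> real ^ 'd::{finite,linorder}) \<Rightarrow> nat \<Rightarrow> 'd point" where
  "split_sub m a b x k = (\<chi> c. lin_sub m (if c = first_coord then a else b) (\<lambda>i. x i $ c) k)"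

lemma split_sub_iter_component:
  "(split_sub m a b ^^ r) x k $ c = (lin_sub m (if c = first_coord then a else b) ^^ r) (\<lambda>i. x i $ c) k"
proof (induction r arbitrary: k)
  case (Suc r)
  then have "(\<lambda>i. (split_sub m a b ^^ r) x i $ c) =
      (lin_sub m (if c = first_coord then a else b) ^^ r) (\<lambda>i. x i $ c)" by (rule ext)
  then show ?case by (simp add: split_sub_def[of m a b "(split_sub m a b ^^ r) x"])
qed simp

lemma split_sub_linear:
  "split_sub m a b (\<lambda>i. s *\<^sub>R x i + t *\<^sub>R y i) k = s *\<^sub>R split_sub m a b x k + t *\<^sub>R split_sub m a b y k"
  by (simp add: vec_eq_iff split_sub_def lin_sub_linear)

lemma split_sub_scale: "split_sub m a b (\<lambda>i. s *\<^sub>R x i) k = s *\<^sub>R split_sub m a b x k"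
  using split_sub_linear[of m a b s x 0 x k] by simp

lemma split_sub_diff: "split_sub m a b (\<lambda>i. x i - y i) k = split_sub m a b x k - split_sub m a b y k"
  using split_sub_linear[of m a b 1 x "-1" y k] by simp

lemma split_sub_shift: "split_sub m a b (\<lambda>i. x (c + i)) k = split_sub m a b x (2 * c + k)"
proof -
  have "lin_sub m w (\<lambda>i. x (c + i) $ cc) k = lin_sub m w (\<lambda>i. x i $ cc) (2 * c + k)" for w cc
    using lin_sub_shift[of m w "\<lambda>i. x i $ cc" c k] .
  then show ?thesis by (simp add: vec_eq_iff split_sub_def)
qed

definition split_bound :: "nat \<Rightarrow> (nat \<Rightarrow> nat \<Rightarrow> real) \<Rightarrow> (nat \<Rightarrow> nat \<Rightarrow> real) \<Rightarrow> real" where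
  "split_bound m a b = (\<Sum>j\<le>m. \<bar>a 0 j\<bar>) + (\<Sum>j\<le>m. \<bar>a 1 j\<bar>) + (\<Sum>j\<le>m. \<bar>b 0 j\<bar>) + (\<Sum>j\<le>m. \<bar>b 1 j\<bar>)"

lemma split_bound_nonneg: "split_bound m a b \<ge> 0"
  unfolding split_bound_def by (intro add_nonneg_nonneg sum_nonneg) auto

text \<open>The dimension enters because the Euclidean norm is bounded by the sum of the absolute
  coordinates.\<close>

lemma norm_split_sub_le:
  fixes x :: "nat \<Rightarrow> real ^ 'd::{finite,linorder}"
  assumes x: "\<And>j. j \<le> m \<Longrightarrow> norm (x (k div 2 + j)) \<le> c" and c: "c \<ge> 0"
  shows "norm (split_sub m a b x k) \<le> real CARD('d) * split_bound m a b * c"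
proof -
  have nn: "0 \<le> (\<Sum>j\<le>m. \<bar>w j\<bar>)" for w :: "nat \<Rightarrow> real" by (simp add: sum_nonneg)
  have "\<bar>split_sub m a b x k $ cc\<bar> \<le> split_bound m a b * c" for cc
    unfolding split_sub_def vec_lambda_beta
  proof (rule lin_sub_bound[OF _ _ c])
    show "(\<Sum>j\<le>m. \<bar>(if cc = first_coord then a else b) \<mu> j\<bar>) \<le> split_bound m a b" if "\<mu> \<in> {0, 1}" for \<mu>
      using that nn[of "a 0"] nn[of "a 1"] nn[of "b 0"] nn[of "b 1"]
      by (cases "cc = first_coord") (auto simp: split_bound_def)
    show "\<bar>x (k div 2 + j) $ cc\<bar> \<le> c" if "j \<le> m" for j
      using order_trans[OF component_le_norm_cart x[OF that]] .
  qed
  then have "(\<Sum>cc\<in>UNIV. \<bar>split_sub m a b x k $ cc\<bar>) \<le> (\<Sum>cc\<in>(UNIV :: 'd set). split_bound m a b * c)"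
    by (intro sum_mono)
  then show ?thesis
    using order_trans[OF norm_le_l1_cart[of "split_sub m a b x k"]] by (simp add: mult.assoc)
qed

lemma norm_split_sub_iter_le:
  fixes x :: "nat \<Rightarrow> real ^ 'd::{finite,linorder}"
  assumes x: "\<And>i. i < 2 * m + 1 \<Longrightarrow> norm (x i) \<le> c" and c: "c \<ge> 0" and k: "k < 2 ^ r + 2 * m"
  shows "norm ((split_sub m a b ^^ r) x k) \<le> (real CARD('d) * split_bound m a b) ^ r * c"
  using k
proof (induction r arbitrary: k)
  case (Suc r)
  let ?K = "real CARD('d) * split_bound m a b"
  have "norm (split_sub m a b ((split_sub m a b ^^ r) x) k) \<le> ?K * (?K ^ r * c)"
    using c Suc.prems split_bound_nonneg[of m a b] by (intro norm_split_sub_le Suc.IH) auto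
  then show ?case by (simp add: mult.assoc)
qed (use x in simp)

lemma uniform_delta:
  fixes P :: "nat \<Rightarrow> real \<Rightarrow> bool"
  assumes "\<And>k. k \<le> N \<Longrightarrow> \<exists>\<delta>>0. P k \<delta>" and mono: "\<And>k \<delta> \<delta>'. P k \<delta> \<Longrightarrow> \<delta>' \<le> \<delta> \<Longrightarrow> P k \<delta>'"
  shows "\<exists>\<delta>>0. \<forall>k\<le>N. P k \<delta>"
  using assms(1)
proof (induction N)
  case 0
  then show ?case by auto
next
  case (Suc N)
  then obtain \<delta>1 \<delta>2 where "\<delta>1 > 0" "\<forall>k\<le>N. P k \<delta>1" "\<delta>2 > 0" "P (Suc N) \<delta>2" by (metis le_Suc_eq)
  then have "min \<delta>1 \<delta>2 > 0 \<and> (\<forall>k\<le>Suc N. P k (min \<delta>1 \<delta>2))"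
    using mono[of _ \<delta>1 "min \<delta>1 \<delta>2"] mono[of _ \<delta>2 "min \<delta>1 \<delta>2"] by (auto simp: le_Suc_eq)
  then show ?case by blast
qed

section \<open>Similarities and perturbed lines\<close>

lemma similarity_frame:
  fixes u :: "real ^ 'd::{finite,linorder}"
  assumes "u \<noteq> 0"
  obtains R where "linear R" "R e_vec = u" "\<And>z. norm (R z) = norm u * norm z" "surj R"
    "\<And>s. similarity (\<lambda>z. R z + s)"
proof -
  have "norm (e_vec :: 'd point) = norm ((1 / norm u) *\<^sub>R u)"
    using assms by (simp add: e_vec_def)
  then obtain f :: "'d point \<Rightarrow> 'd point" where f: "orthogonal_transformation f" "f e_vec = (1 / norm u) *\<^sub>R u"
    using orthogonal_transformation_exists by metis
  have lin: "linear f" using f(1) by (simp add: orthogonal_transformation_def)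
  \<comment> \<open>Transposed because similarities act on row vectors.\<close>
  define Q where "Q = transpose (matrix f)"
  have Q: "p v* Q = f p" for p
    using lin by (simp add: Q_def vector_transpose_matrix matrix_works)
  have "orthogonal_matrix Q"
    using f(1) by (simp add: Q_def orthogonal_matrix_transpose orthogonal_transformation_matrix)
  then have sim: "similarity (\<lambda>z. norm u *\<^sub>R f z + s)" for s
    unfolding similarity_def using assms by (intro exI[of _ "norm u"] exI[of _ Q] exI[of _ s]) (simp add: Q)
  show ?thesis
  proof (rule that[of "\<lambda>z. norm u *\<^sub>R f z"])
    show "linear (\<lambda>z. norm u *\<^sub>R f z)" using lin by (rule linear_compose_scale_right)
    show "surj (\<lambda>z. norm u *\<^sub>R f z)"
    proof (rule surjI[of _ "\<lambda>y. inv f ((1 / norm u) *\<^sub>R y)"])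
      show "norm u *\<^sub>R f (inv f ((1 / norm u) *\<^sub>R y)) = y" for y
        using assms by (simp add: surj_f_inv_f[OF orthogonal_transformation_surj[OF f(1)]])
    qed
  qed (use f assms sim in \<open>auto simp: orthogonal_transformation_norm\<close>)
qed

lemma similarity_homothety: "s > 0 \<Longrightarrow> similarity (\<lambda>z. s *\<^sub>R z + y)"
  unfolding similarity_def
  by (intro exI[of _ s] exI[of _ "mat 1"] exI[of _ y]) (simp add: orthogonal_matrix_id)

definition perturbed_line :: "nat \<Rightarrow> (nat \<Rightarrow> real ^ 'd::{finite,linorder}) \<Rightarrow> 'd chain" where
  "perturbed_line m x = map (\<lambda>i. real (i + 1) *\<^sub>R e_vec + x i) [0..<2 * m + 1]"

lemma length_perturbed_line [simp]: "length (perturbed_line m x) = 2 * m + 1"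
  by (simp add: perturbed_line_def)

lemma nth_perturbed_line: "i < 2 * m + 1 \<Longrightarrow> perturbed_line m x ! i = real (i + 1) *\<^sub>R e_vec + x i"
  by (simp add: perturbed_line_def del: upt_Suc)

lemma perturbed_line_0: "perturbed_line m (\<lambda>_. 0) = E_chain (2 * m + 1)"
  by (simp add: perturbed_line_def E_chain_def)

text \<open>The assumption \<open>deriv\<close> speaks of all \<open>2 * m + 2\<close> points of the
  image, which comprises both self-maps, with a common \<open>\<delta>\<close>.\<close>

locale differentiable_glue_scheme =
  fixes m :: nat and G :: "'d::{finite,linorder} chain \<Rightarrow> 'd chain" and \<tau> :: real
    and a b :: "nat \<Rightarrow> nat \<Rightarrow> real"
  assumes loc: "local_scheme m G"
    and sim: "\<And>S P. similarity S \<Longrightarrow> length P \<ge> 2 * m + 1 \<Longrightarrow> G (map S P) = map S (G P)"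
    and line: "\<And>k. k \<le> 2 * m + 1 \<Longrightarrow>
      G (perturbed_line m (\<lambda>_. 0)) ! k = ((real k + 1 + real m + \<tau>) / 2) *\<^sub>R e_vec"
    and deriv: "\<And>\<epsilon>. \<epsilon> > 0 \<Longrightarrow> \<exists>\<delta>>0. \<forall>k\<le>2 * m + 1. \<forall>x c. 0 \<le> c \<longrightarrow> c < \<delta> \<longrightarrow>
      (\<forall>i<2 * m + 1. norm (x i) \<le> c) \<longrightarrow>
      norm (G (perturbed_line m x) ! k - G (perturbed_line m (\<lambda>_. 0)) ! k - split_sub m a b x k) \<le> \<epsilon> * c"
begin

lemma length_G: "length P = 2 * m + 1 \<Longrightarrow> length (G P) = 2 * m + 2"
  using local_scheme_length_iter[OF loc, of P 1 1] by simp

lemma length_G_iter: "length P = 2 * m + 1 \<Longrightarrow> length ((G ^^ r) P) = 2 ^ r + 2 * m"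
  using local_scheme_length_iter[OF loc, of P 1 r] by simp

lemma sim_iter:
  assumes "similarity S" "length P = 2 * m + 1"
  shows "(G ^^ r) (map S P) = map S ((G ^^ r) P)"
proof (induction r)
  case (Suc r)
  have "length ((G ^^ r) P) \<ge> 2 * m + 1" using length_G_iter[OF assms(2), of r] by (simp add: Suc_le_eq)
  then show ?case using sim[OF assms(1)] Suc by simp
qed simp

text \<open>The line perturbed by small multiples of \<open>(i + 1) v\<close> is similar to the line
  itself, so its image is known without the derivative. Equating both answers determines the
  derivative on such perturbations.\<close>

lemma split_sub_line:
  fixes v :: "'d point"
  assumes k: "k \<le> 2 * m + 1"
  shows "split_sub m a b (\<lambda>i. real (i + 1) *\<^sub>R v) k = ((real k + 1 + real m + \<tau>) / 2) *\<^sub>R v"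
proof -
  define w where "w = ((real k + 1 + real m + \<tau>) / 2) *\<^sub>R v"
  define c where "c = real (2 * m + 1) * norm v"
  have c: "c \<ge> 0" by (simp add: c_def)
  have "norm (w - split_sub m a b (\<lambda>i. real (i + 1) *\<^sub>R v) k) \<le> \<epsilon> * c" if \<epsilon>: "\<epsilon> > 0" for \<epsilon>
  proof -
    obtain \<delta> where \<delta>: "\<delta> > 0" "\<And>x c. 0 \<le> c \<Longrightarrow> c < \<delta> \<Longrightarrow> (\<And>i. i < 2 * m + 1 \<Longrightarrow> norm (x i) \<le> c) \<Longrightarrow>
      norm (G (perturbed_line m x) ! k - G (perturbed_line m (\<lambda>_. 0)) ! k - split_sub m a b x k) \<le> \<epsilon> * c"
      using deriv[OF \<epsilon>] k by blast
    \<comment> \<open>Small enough for the perturbation to lie within \<open>\<delta>\<close> and,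
      by the minimum with 1, for \<open>e_vec + \<theta> v\<close> to be nonzero.\<close>
    define \<theta> where "\<theta> = (min \<delta> 1 / 2) / (c + 1)"
    have \<theta>: "\<theta> > 0" using \<delta> c by (simp add: \<theta>_def)
    have "c + 1 \<noteq> 0" using c by simp
    from nonzero_mult_div_cancel_right[OF this]
    have divide_cancel: "z / (c + 1) * (c + 1) = z" for z by simp
    have "\<theta> * c \<le> \<theta> * (c + 1)" using \<theta> by (intro mult_left_mono) auto
    also have "\<dots> = min \<delta> 1 / 2"
      unfolding \<theta>_def by (rule divide_cancel)
    finally have \<theta>c: "\<theta> * c < \<delta>" "\<theta> * c < 1" using \<delta>(1) by auto
    define u where "u = e_vec + \<theta> *\<^sub>R v"
    have "norm v \<le> c" unfolding c_def by (simp add: mult_le_cancel_right1)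
    have "norm (\<theta> *\<^sub>R v) = \<theta> * norm v" using \<theta> by simp
    also have "\<dots> \<le> \<theta> * c" using \<open>norm v \<le> c\<close> \<theta> by (intro mult_left_mono) auto
    also note \<theta>c(2)
    finally have "norm (\<theta> *\<^sub>R v) < 1" .
    moreover have "norm (e_vec :: 'd point) = 1" by (simp add: e_vec_def)
    moreover have "norm (e_vec :: 'd point) \<le> norm (\<theta> *\<^sub>R v) + norm u"
      unfolding u_def using norm_triangle_ineq4[of "e_vec + \<theta> *\<^sub>R v" "\<theta> *\<^sub>R v"] by (simp add: add.commute)
    ultimately have u: "u \<noteq> 0" by auto
    obtain R where R: "linear R" "R e_vec = u" "\<And>s. similarity (\<lambda>z. R z + s)"
      by (rule similarity_frame[OF u]) (erule that, assumption, blast)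
    have S: "similarity R" using R(3)[of 0] by simp
    have "perturbed_line m (\<lambda>i. \<theta> *\<^sub>R (real (i + 1) *\<^sub>R v)) = map R (perturbed_line m (\<lambda>_. 0))"
    proof (rule nth_equalityI)
      fix i assume "i < length (perturbed_line m (\<lambda>i. \<theta> *\<^sub>R (real (i + 1) *\<^sub>R v)))"
      then have i: "i < 2 * m + 1" by simp
      have "real (i + 1) *\<^sub>R e_vec + \<theta> *\<^sub>R (real (i + 1) *\<^sub>R v) = real (i + 1) *\<^sub>R u"
        by (simp only: u_def scaleR_add_right scaleR_left_commute)
      also have "\<dots> = R (real (i + 1) *\<^sub>R e_vec + 0)"
        using R(1,2) by (simp only: linear_cmul add_0_right)
      finally show "perturbed_line m (\<lambda>i. \<theta> *\<^sub>R (real (i + 1) *\<^sub>R v)) ! i = map R (perturbed_line m (\<lambda>_. 0)) ! i"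
        using i by (simp only: nth_perturbed_line nth_map length_perturbed_line)
    qed simp
    then have "G (perturbed_line m (\<lambda>i. \<theta> *\<^sub>R (real (i + 1) *\<^sub>R v))) ! k = R (G (perturbed_line m (\<lambda>_. 0)) ! k)"
      using sim[OF S] k length_G[of "perturbed_line m (\<lambda>_. 0)"] by simp
    also have "\<dots> = ((real k + 1 + real m + \<tau>) / 2) *\<^sub>R u"
      using line[OF k] R(1,2) by (simp add: linear_cmul)
    finally have "G (perturbed_line m (\<lambda>i. \<theta> *\<^sub>R (real (i + 1) *\<^sub>R v))) ! k -
        G (perturbed_line m (\<lambda>_. 0)) ! k = \<theta> *\<^sub>R w"
      using line[OF k] by (simp add: u_def w_def algebra_simps)
    moreover have "norm (G (perturbed_line m (\<lambda>i. \<theta> *\<^sub>R (real (i + 1) *\<^sub>R v))) ! k -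
        G (perturbed_line m (\<lambda>_. 0)) ! k - split_sub m a b (\<lambda>i. \<theta> *\<^sub>R (real (i + 1) *\<^sub>R v)) k) \<le> \<epsilon> * (\<theta> * c)"
    proof (rule \<delta>(2)[OF _ \<theta>c(1)])
      show "norm (\<theta> *\<^sub>R (real (i + 1) *\<^sub>R v)) \<le> \<theta> * c" if "i < 2 * m + 1" for i
        using that \<theta> unfolding norm_scaleR c_def by (intro mult_left_mono mult_mono) auto
    qed (use \<theta> c in auto)
    ultimately have "norm (\<theta> *\<^sub>R w - \<theta> *\<^sub>R split_sub m a b (\<lambda>i. real (i + 1) *\<^sub>R v) k) \<le> \<epsilon> * (\<theta> * c)"
      by (simp only: split_sub_scale)
    also have "\<theta> *\<^sub>R w - \<theta> *\<^sub>R split_sub m a b (\<lambda>i. real (i + 1) *\<^sub>R v) k =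
        \<theta> *\<^sub>R (w - split_sub m a b (\<lambda>i. real (i + 1) *\<^sub>R v) k)" by (simp only: scaleR_diff_right)
    finally have "\<theta> * norm (w - split_sub m a b (\<lambda>i. real (i + 1) *\<^sub>R v) k) \<le> \<theta> * (\<epsilon> * c)"
      using \<theta> by (simp add: mult.left_commute)
    then show ?thesis using \<theta> by simp
  qed
  note * = this
  \<comment> \<open>Neither \<open>w\<close> nor the derivative depends on
    \<open>\<epsilon>\<close>, so they agree.\<close>
  have "norm (w - split_sub m a b (\<lambda>i. real (i + 1) *\<^sub>R v) k) \<le> 0 + e" if "e > 0" for e
  proof -
    have "norm (w - split_sub m a b (\<lambda>i. real (i + 1) *\<^sub>R v) k) \<le> (e / (c + 1)) * c"
      by (rule *) (use that c in simp)
    also have "\<dots> \<le> e" using that c by (simp add: field_simps)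
    finally show ?thesis by simp
  qed
  then have "norm (w - split_sub m a b (\<lambda>i. real (i + 1) *\<^sub>R v) k) \<le> 0" by (rule field_le_epsilon)
  then show ?thesis by (simp add: w_def)
qed

text \<open>This is \<open>split_sub_line\<close> in the direction of coordinate \<open>c\<close>.
  The points of the line carry the factors 1, 2, ..., which is the origin of the \<open>- 1\<close>
  in the shift.\<close>

lemma lin_sub_moment:
  fixes c :: 'd
  assumes "\<mu> \<in> {0, 1}" "(\<Sum>j\<le>m. (if c = first_coord then a else b) \<mu> j) = 1"
  shows "(\<Sum>j\<le>m. (if c = first_coord then a else b) \<mu> j * real j) = (real \<mu> + (real m + \<tau> - 1)) / 2"
proof -
  let ?w = "if c = first_coord then a else b"
  have "\<mu> \<le> 2 * m + 1" using assms by auto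
  from split_sub_line[OF this, of "axis c 1"]
  have "split_sub m a b (\<lambda>i. real (i + 1) *\<^sub>R axis c 1) \<mu> $ c = (real \<mu> + 1 + real m + \<tau>) / 2" by simp
  then have "(\<Sum>j\<le>m. ?w \<mu> j * real j) + (\<Sum>j\<le>m. ?w \<mu> j) = (real \<mu> + 1 + real m + \<tau>) / 2"
    using assms(1) by (auto simp: split_sub_def lin_sub_def sum.distrib algebra_simps)
  then show ?thesis using assms(2) by (simp add: field_simps)
qed

text \<open>Windows of an evenly spaced line are images of the initial line under homotheties, so
  equivariance and \<open>line\<close> settle every level. The offset passes from \<open>s\<close>
  to \<open>2 * s + m + \<tau> - 1\<close>.\<close>

lemma iter_line:
  obtains s where "\<And>k. k < 2 ^ r + 2 * m \<Longrightarrow>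
    (G ^^ r) (perturbed_line m (\<lambda>_. 0)) ! k = ((real k + s) / 2 ^ r) *\<^sub>R e_vec"
proof -
  have "\<exists>s. \<forall>k < 2 ^ r + 2 * m.
    (G ^^ r) (perturbed_line m (\<lambda>_. 0)) ! k = ((real k + s) / 2 ^ r) *\<^sub>R (e_vec :: 'd point)"
  proof (induction r)
    case 0
    show ?case by (rule exI[of _ 1]) (simp add: nth_perturbed_line)
  next
    case (Suc r)
    let ?E = "perturbed_line m (\<lambda>_. 0) :: 'd chain"
    obtain s where s: "\<And>k. k < 2 ^ r + 2 * m \<Longrightarrow> (G ^^ r) ?E ! k = ((real k + s) / 2 ^ r) *\<^sub>R e_vec"
      using Suc by blast
    have "(G ^^ Suc r) ?E ! k = ((real k + (2 * s + real m + \<tau> - 1)) / 2 ^ Suc r) *\<^sub>R e_vec"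
      if k: "k < 2 ^ Suc r + 2 * m" for k
    proof -
      obtain k0 j where kj: "k = 2 * k0 + j" "k0 < 2 ^ r" "j \<le> 2 * m + 1"
        using dyadic_split[OF k] .
      \<comment> \<open>The homothety that takes the initial line to window \<open>k0\<close> of
        level \<open>r\<close>; the \<open>- 1\<close> is there because the initial line starts at
        \<open>e_vec\<close> and not at the origin.\<close>
      define S where "S z = (1 / 2 ^ r) *\<^sub>R z + ((real k0 + s - 1) / 2 ^ r) *\<^sub>R e_vec" for z :: "'d point"
      have S: "similarity S" unfolding S_def by (rule similarity_homothety) simp
      have k0: "k0 + (2 * m + 1) \<le> length ((G ^^ r) ?E)" using kj length_G_iter[of ?E r] by simp
      have sub: "subchain (2 * m + 1) k0 ((G ^^ r) ?E) = map S ?E"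
      proof (rule nth_equalityI)
        show "length (subchain (2 * m + 1) k0 ((G ^^ r) ?E)) = length (map S ?E)"
          using length_subchain[OF k0] by simp
        fix i assume "i < length (subchain (2 * m + 1) k0 ((G ^^ r) ?E))"
        then have i: "i < 2 * m + 1" using length_subchain[OF k0] by simp
        then have "subchain (2 * m + 1) k0 ((G ^^ r) ?E) ! i = ((real (k0 + i) + s) / 2 ^ r) *\<^sub>R e_vec"
          using kj by (simp only: nth_subchain[OF k0 i]) (rule s, simp)
        also have "\<dots> = S (real (i + 1) *\<^sub>R e_vec)"
          by (simp add: S_def add_divide_distrib diff_divide_distrib algebra_simps)
        finally show "subchain (2 * m + 1) k0 ((G ^^ r) ?E) ! i = map S ?E ! i"
          using i by (simp add: nth_perturbed_line)
      qed
      have "(G ^^ Suc r) ?E ! k = G ((G ^^ r) ?E) ! (2 * k0 + j)" by (simp add: kj(1))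
      also have "\<dots> = G (map S ?E) ! j" unfolding local_scheme_shift[OF loc k0 kj(3)] sub ..
      also have "\<dots> = S (G ?E ! j)" using sim[OF S, of ?E] length_G[of ?E] kj(3) by simp
      also have "\<dots> = ((real k + (2 * s + real m + \<tau> - 1)) / 2 ^ Suc r) *\<^sub>R e_vec"
        unfolding line[OF kj(3)] S_def scaleR_scaleR scaleR_left_distrib[symmetric]
        by (simp add: kj(1) field_simps)
      finally show ?thesis .
    qed
    then show ?case by blast
  qed
  then show ?thesis using that by blast
qed

text \<open>A chain rule by hand. A window of level \<open>r\<close> is a homothetic image of a
  perturbed line, with the perturbation magnified by \<open>2 ^ r\<close>, and the derivative of one
  step applies there. The error of level \<open>r\<close> is passed on through the linear
  step.\<close>

lemma iter_derivative:
  assumes "\<epsilon> > 0"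
  shows "\<exists>\<delta>>0. \<forall>x c k. 0 \<le> c \<longrightarrow> c < \<delta> \<longrightarrow> (\<forall>i<2 * m + 1. norm (x i) \<le> c) \<longrightarrow> k < 2 ^ r + 2 * m \<longrightarrow>
      norm ((G ^^ r) (perturbed_line m x) ! k - (G ^^ r) (perturbed_line m (\<lambda>_. 0)) ! k -
        (split_sub m a b ^^ r) x k) \<le> \<epsilon> * c"
  using assms
proof (induction r arbitrary: \<epsilon>)
  case 0
  then show ?case by (intro exI[of _ 1]) (simp add: nth_perturbed_line)
next
  case (Suc r)
  let ?E = "perturbed_line m (\<lambda>_. 0) :: 'd chain"
  let ?M = "split_sub m a b :: (nat \<Rightarrow> 'd point) \<Rightarrow> _"
  define K where "K = real CARD('d) * split_bound m a b"
  have K: "K \<ge> 0" using split_bound_nonneg[of m a b] by (simp add: K_def)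
  \<comment> \<open>Half of \<open>\<epsilon>\<close> is reserved for the error of level
    \<open>r\<close>, which the linear step amplifies by at most \<open>K\<close>.\<close>
  define \<epsilon>' where "\<epsilon>' = \<epsilon> / (2 * (K + 1))"
  have \<epsilon>': "\<epsilon>' > 0" "K * \<epsilon>' \<le> \<epsilon> / 2" using Suc.prems K by (auto simp: \<epsilon>'_def field_simps)
  \<comment> \<open>\<open>B * c\<close> bounds the deviation from the line at level
    \<open>r\<close>. The other half of \<open>\<epsilon>\<close> is for the new linearization
    error, at most \<open>\<epsilon>1 * B * c\<close>.\<close>
  define B where "B = \<epsilon>' + K ^ r + 1"
  have B: "B > 0" using \<epsilon>' K by (simp add: B_def add_pos_nonneg)
  define \<epsilon>1 where "\<epsilon>1 = \<epsilon> / (2 * B)"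
  have \<epsilon>1: "\<epsilon>1 > 0" "\<epsilon>1 * B = \<epsilon> / 2" using Suc.prems B by (auto simp: \<epsilon>1_def)
  obtain \<delta>' where \<delta>': "\<delta>' > 0" and IH: "\<And>x c k. 0 \<le> c \<Longrightarrow> c < \<delta>' \<Longrightarrow> (\<And>i. i < 2 * m + 1 \<Longrightarrow> norm (x i) \<le> c) \<Longrightarrow>
      k < 2 ^ r + 2 * m \<Longrightarrow> norm ((G ^^ r) (perturbed_line m x) ! k - (G ^^ r) ?E ! k - (?M ^^ r) x k) \<le> \<epsilon>' * c"
    using Suc.IH[OF \<epsilon>'(1)] by blast
  obtain \<delta>1 where \<delta>1: "\<delta>1 > 0" and D: "\<And>k x c. k \<le> 2 * m + 1 \<Longrightarrow> 0 \<le> c \<Longrightarrow> c < \<delta>1 \<Longrightarrow>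
      (\<And>i. i < 2 * m + 1 \<Longrightarrow> norm (x i) \<le> c) \<Longrightarrow>
      norm (G (perturbed_line m x) ! k - G ?E ! k - ?M x k) \<le> \<epsilon>1 * c"
    using deriv[OF \<epsilon>1(1)] by blast
  obtain s where s: "\<And>k. k < 2 ^ r + 2 * m \<Longrightarrow> (G ^^ r) ?E ! k = ((real k + s) / 2 ^ r) *\<^sub>R e_vec"
    using iter_line[of r] by blast
  show ?case
  \<comment> \<open>The factor \<open>2 ^ r\<close> comes from magnification to unit scale: the
    magnified deviation has to stay below \<open>\<delta>1\<close>.\<close>
  proof (intro exI[of _ "min \<delta>' (\<delta>1 / (2 ^ r * B))"] conjI allI impI)
    show "min \<delta>' (\<delta>1 / (2 ^ r * B)) > 0" using \<delta>' \<delta>1 B by simp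
    fix x :: "nat \<Rightarrow> 'd point" and c :: real and k :: nat
    assume c: "0 \<le> c" "c < min \<delta>' (\<delta>1 / (2 ^ r * B))" and x: "\<forall>i<2 * m + 1. norm (x i) \<le> c"
      and k: "k < 2 ^ Suc r + 2 * m"
    let ?P = "perturbed_line m x"
    obtain k0 j where kj: "k = 2 * k0 + j" "k0 < 2 ^ r" "j \<le> 2 * m + 1"
      using dyadic_split[OF k] .
    define S where "S z = (1 / 2 ^ r) *\<^sub>R z + ((real k0 + s - 1) / 2 ^ r) *\<^sub>R e_vec" for z :: "'d point"
    have S: "similarity S" unfolding S_def by (rule similarity_homothety) simp
    define y where "y i = (G ^^ r) ?P ! (k0 + i) - (G ^^ r) ?E ! (k0 + i)" for i
    have y: "norm (y i - (?M ^^ r) x (k0 + i)) \<le> \<epsilon>' * c" if "i < 2 * m + 1" for i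
      unfolding y_def using c x kj that by (intro IH) auto
    have yB: "norm (y i) \<le> B * c" if "i < 2 * m + 1" for i
    proof -
      have "norm ((?M ^^ r) x (k0 + i)) \<le> K ^ r * c"
        unfolding K_def using x c kj that by (intro norm_split_sub_iter_le) auto
      then have "norm (y i) \<le> \<epsilon>' * c + K ^ r * c"
        using y[OF that] norm_triangle_sub[of "y i" "(?M ^^ r) x (k0 + i)"] by simp
      also have "\<dots> \<le> B * c" using c by (simp add: B_def algebra_simps)
      finally show ?thesis .
    qed
    \<comment> \<open>Window \<open>k0\<close> of level \<open>r\<close>, magnified to a perturbed
      line at unit scale.\<close>
    define N where "N x' = perturbed_line m
        (\<lambda>i. 2 ^ r *\<^sub>R ((G ^^ r) (perturbed_line m x') ! (k0 + i) - (G ^^ r) ?E ! (k0 + i)))" for x'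
    have sub: "subchain (2 * m + 1) k0 ((G ^^ r) (perturbed_line m x')) = map S (N x')"
      for x' :: "nat \<Rightarrow> 'd point"
    proof (rule nth_equalityI)
      let ?Q = "(G ^^ r) (perturbed_line m x')"
      have k0: "k0 + (2 * m + 1) \<le> length ?Q" using kj length_G_iter[of "perturbed_line m x'" r] by simp
      show "length (subchain (2 * m + 1) k0 ?Q) = length (map S (N x'))"
        using length_subchain[OF k0] by (simp add: N_def)
      fix i assume "i < length (subchain (2 * m + 1) k0 ?Q)"
      then have i: "i < 2 * m + 1" using length_subchain[OF k0] by simp
      have E: "(G ^^ r) ?E ! (k0 + i) = ((real (k0 + i) + s) / 2 ^ r) *\<^sub>R e_vec"
        using kj i by (intro s) simp
      have "S (real (i + 1) *\<^sub>R e_vec + 2 ^ r *\<^sub>R (?Q ! (k0 + i) - (G ^^ r) ?E ! (k0 + i))) =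
          (1 / 2 ^ r) *\<^sub>R (real (i + 1) *\<^sub>R e_vec) + ((real k0 + s - 1) / 2 ^ r) *\<^sub>R e_vec +
          (?Q ! (k0 + i) - (G ^^ r) ?E ! (k0 + i))"
        unfolding S_def by (simp add: scaleR_add_right)
      also have "(1 / 2 ^ r) *\<^sub>R (real (i + 1) *\<^sub>R e_vec) + ((real k0 + s - 1) / 2 ^ r) *\<^sub>R e_vec =
          (G ^^ r) ?E ! (k0 + i)"
        unfolding E scaleR_scaleR scaleR_left_distrib[symmetric] by (simp add: add_divide_distrib diff_divide_distrib)
      finally show "subchain (2 * m + 1) k0 ?Q ! i = map S (N x') ! i"
        using nth_subchain[OF k0 i] i by (simp add: N_def nth_perturbed_line)
    qed
    have iter: "(G ^^ Suc r) (perturbed_line m x') ! k = S (G (N x') ! j)" for x'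
    proof -
      have k0: "k0 + (2 * m + 1) \<le> length ((G ^^ r) (perturbed_line m x'))"
        using kj length_G_iter[of "perturbed_line m x'" r] by simp
      have "(G ^^ Suc r) (perturbed_line m x') ! k = G ((G ^^ r) (perturbed_line m x')) ! (2 * k0 + j)"
        by (simp add: kj(1))
      also have "\<dots> = G (map S (N x')) ! j" unfolding local_scheme_shift[OF loc k0 kj(3)] sub ..
      also have "\<dots> = S (G (N x') ! j)" using sim[OF S, of "N x'"] length_G[of "N x'"] kj(3) by (simp add: N_def)
      finally show ?thesis .
    qed
    define err where "err = G (perturbed_line m (\<lambda>i. 2 ^ r *\<^sub>R y i)) ! j - G ?E ! j - ?M (\<lambda>i. 2 ^ r *\<^sub>R y i) j"
    have "norm err \<le> \<epsilon>1 * (2 ^ r * (B * c))"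
      unfolding err_def
    proof (rule D[OF kj(3)])
      show "2 ^ r * (B * c) < \<delta>1" using c B by (simp add: field_simps)
      show "norm (2 ^ r *\<^sub>R y i) \<le> 2 ^ r * (B * c)" if "i < 2 * m + 1" for i
        using yB[OF that] by simp
    qed (use B c in auto)
    then have err: "norm ((1 / 2 ^ r) *\<^sub>R err) \<le> \<epsilon> / 2 * c"
      by (simp add: field_simps \<epsilon>1(2)[symmetric])
    have "(G ^^ Suc r) ?P ! k - (G ^^ Suc r) ?E ! k =
        (1 / 2 ^ r) *\<^sub>R (G (perturbed_line m (\<lambda>i. 2 ^ r *\<^sub>R y i)) ! j - G ?E ! j)"
      unfolding iter N_def y_def by (simp add: S_def scaleR_diff_right)
    also have "\<dots> = (1 / 2 ^ r) *\<^sub>R err + ?M y j"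
      by (simp add: err_def split_sub_scale scaleR_diff_right scaleR_add_right)
    finally have "(G ^^ Suc r) ?P ! k - (G ^^ Suc r) ?E ! k - (?M ^^ Suc r) x k =
        (1 / 2 ^ r) *\<^sub>R err + (?M y j - ?M (\<lambda>i. (?M ^^ r) x (k0 + i)) j)"
      by (simp add: split_sub_shift[of m a b "(?M ^^ r) x"] kj(1))
    also have "\<dots> = (1 / 2 ^ r) *\<^sub>R err + ?M (\<lambda>i. y i - (?M ^^ r) x (k0 + i)) j"
      by (simp add: split_sub_diff)
    also have "norm \<dots> \<le> \<epsilon> / 2 * c + K * (\<epsilon>' * c)"
    proof (rule norm_triangle_mono[OF err])
      show "norm (?M (\<lambda>i. y i - (?M ^^ r) x (k0 + i)) j) \<le> K * (\<epsilon>' * c)"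
        unfolding K_def using kj(3) c \<epsilon>'(1) by (intro norm_split_sub_le y) auto
    qed
    also have "\<dots> = (\<epsilon> / 2 + K * \<epsilon>') * c" by (simp add: algebra_simps)
    also have "\<dots> \<le> \<epsilon> * c" using \<epsilon>'(2) c by (intro mult_right_mono) auto
    finally show "norm ((G ^^ Suc r) ?P ! k - (G ^^ Suc r) ?E ! k - (?M ^^ Suc r) x k) \<le> \<epsilon> * c" .
  qed
qed

end

section \<open>Difference estimates for chains close to a line\<close>

lemma second_diff_add3:
  fixes x y z :: "nat \<Rightarrow> 'a::ab_group_add"
  assumes "\<And>i. i \<le> k + 2 \<Longrightarrow> w i = x i + y i + z i"
  shows "second_diff w k = second_diff x k + second_diff y k + second_diff z k"
  using assms[of k] assms[of "k + 1"] assms[of "k + 2"] by simp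

context differentiable_glue_scheme
begin

text \<open>An upper bound for the quadratic factor of \<open>second_diff_bound\<close> within a
  window.\<close>

definition sup_factor :: real where
  "sup_factor = (real (2 * m + 1))\<^sup>2"

lemma sup_factor_nonneg: "sup_factor \<ge> 0"
  by (simp add: sup_factor_def)

lemma sup_factor_times_less:
  assumes \<delta>: "\<delta> > 0" and c: "c \<ge> 0" and u: "u > 0" and small: "c \<le> \<delta> / (sup_factor + 1) * u"
  shows "0 \<le> sup_factor * (c / u)" "sup_factor * (c / u) < \<delta>"
proof -
  define t where "t = c / u"
  have t: "t \<ge> 0" using c u by (simp add: t_def)
  have "t \<le> \<delta> / (sup_factor + 1)" using small u by (simp add: t_def field_simps)
  then have "sup_factor * t + t \<le> \<delta>" using sup_factor_nonneg by (simp add: field_simps)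
  then have "sup_factor * t < \<delta>" using t \<delta> by (cases "t = 0") auto
  then show "0 \<le> sup_factor * (c / u)" "sup_factor * (c / u) < \<delta>"
    using t sup_factor_nonneg by (simp_all add: t_def del: times_divide_eq_right)
qed

text \<open>The frame matches the first two points of \<open>p\<close> with those of the unperturbed
  line, so \<open>d\<close> vanishes at the indices 0 and 1 and is governed by second differences
  alone. The translation is \<open>p ! 0 - u\<close> with the first edge \<open>u\<close>, since
  that line starts at \<open>e_vec\<close>.\<close>

lemma chain_in_frame:
  fixes p :: "'d chain"
  assumes p: "length p = 2 * m + 1" and ne: "p ! 1 \<noteq> p ! 0" and c: "c \<ge> 0"
    and sd: "\<And>i. i + 2 < 2 * m + 1 \<Longrightarrow> norm (second_diff ((!) p) i) \<le> c"
  obtains R d where "linear R" "R e_vec = p ! 1 - p ! 0" "\<And>z. norm (R z) = norm (p ! 1 - p ! 0) * norm z"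
    "similarity (\<lambda>z. R z + (p ! 0 - (p ! 1 - p ! 0)))"
    "p = map (\<lambda>z. R z + (p ! 0 - (p ! 1 - p ! 0))) (perturbed_line m d)"
    "\<And>i. i < 2 * m + 1 \<Longrightarrow> norm (d i) \<le> sup_factor * (c / norm (p ! 1 - p ! 0))"
    "\<And>i. i + 2 < 2 * m + 1 \<Longrightarrow> norm (second_diff d i) \<le> c / norm (p ! 1 - p ! 0)"
proof -
  define u where "u = p ! 1 - p ! 0"
  have u: "u \<noteq> 0" using ne by (simp add: u_def)
  obtain R where R: "linear R" "R e_vec = u" "\<And>z. norm (R z) = norm u * norm z" "surj R"
    "\<And>s. similarity (\<lambda>z. R z + s)"
    by (rule similarity_frame[OF u]) (erule that, assumption+)
  define d where "d i = inv R (p ! i - p ! 0 - real i *\<^sub>R u)" for i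
  have Rd: "R (d i) = p ! i - p ! 0 - real i *\<^sub>R u" for i
    unfolding d_def by (rule surj_f_inv_f[OF R(4)])
  show ?thesis
  proof (rule that[of R d, folded u_def])
    show "similarity (\<lambda>z. R z + (p ! 0 - u))" by (rule R(5))
    show "p = map (\<lambda>z. R z + (p ! 0 - u)) (perturbed_line m d)"
    proof (rule nth_equalityI)
      fix i assume "i < length p"
      then have i: "i < 2 * m + 1" using p by simp
      have "R (real (i + 1) *\<^sub>R e_vec + d i) + (p ! 0 - u) = p ! i"
        using R(1,2) Rd[of i] by (simp add: linear_add linear_cmul scaleR_left_distrib)
      then show "p ! i = map (\<lambda>z. R z + (p ! 0 - u)) (perturbed_line m d) ! i"
        using i by (simp add: nth_perturbed_line)
    qed (simp add: p)
    show "norm (d i) \<le> sup_factor * (c / norm u)" if "i < 2 * m + 1" for i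
    proof -
      have "norm (p ! i - p ! 0 - real i *\<^sub>R (p ! 1 - p ! 0)) \<le> (real i)\<^sup>2 * c"
        by (rule second_diff_bound[where N = "2 * m + 1"]) (use sd c that in auto)
      also have "\<dots> \<le> sup_factor * c"
        unfolding sup_factor_def using that c by (intro mult_right_mono power_mono) auto
      also have "norm (p ! i - p ! 0 - real i *\<^sub>R (p ! 1 - p ! 0)) = norm u * norm (d i)"
        using R(3)[of "d i"] Rd[of i] by (simp add: u_def)
      finally have "norm u * norm (d i) \<le> sup_factor * c" .
      then show ?thesis using u by (simp add: field_simps)
    qed
    show "norm (second_diff d i) \<le> c / norm u" if "i + 2 < 2 * m + 1" for i
    proof -
      have "R (second_diff d i) = second_diff (\<lambda>i. R (d i)) i" by (simp only: linear_diff[OF R(1)])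
      also have "\<dots> = second_diff ((!) p) i"
      proof -
        have "real (i + 1) *\<^sub>R u = real i *\<^sub>R u + u" "real (i + 2) *\<^sub>R u = real i *\<^sub>R u + (u + u)"
          by (simp_all add: scaleR_left_distrib scaleR_2[symmetric])
        then show ?thesis unfolding Rd by (simp only:) (simp add: algebra_simps)
      qed
      finally have "norm u * norm (second_diff d i) \<le> c"
        using sd[OF that] by (simp only: R(3)[symmetric])
      then show ?thesis using u by (simp add: field_simps)
    qed
  qed (use R in auto)
qed

text \<open>In the frame, the image is the sum of an exact line without second differences, the
  linear scheme applied to \<open>d\<close>, and an error. The error is a small multiple of the size
  of \<open>d\<close> and hence of the second differences of \<open>d\<close>. The similarity scales
  both sides of the estimate equally.\<close>

lemma second_diff_step:
  assumes lin: "\<And>w x c k. w \<in> {a, b} \<Longrightarrow> c \<ge> 0 \<Longrightarrow>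
      (\<And>i. i + 2 < 2 * m + 1 \<Longrightarrow> \<bar>second_diff x i\<bar> \<le> c) \<Longrightarrow> k + 2 < 2 ^ r + 2 * m \<Longrightarrow>
      \<bar>second_diff ((lin_sub m w ^^ r) x) k\<bar> \<le> C * c"
    and \<eta>: "\<eta> > 0"
  obtains \<epsilon> where "\<epsilon> > 0"
    "\<And>p c k. length p = 2 * m + 1 \<Longrightarrow> p ! 1 \<noteq> p ! 0 \<Longrightarrow> c \<ge> 0 \<Longrightarrow> c \<le> \<epsilon> * norm (p ! 1 - p ! 0) \<Longrightarrow>
      (\<And>i. i + 2 < 2 * m + 1 \<Longrightarrow> norm (second_diff ((!) p) i) \<le> c) \<Longrightarrow> k + 2 < 2 ^ r + 2 * m \<Longrightarrow>
      norm (second_diff (\<lambda>i. (G ^^ r) p ! i) k) \<le> (real CARD('d) * C + \<eta>) * c"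
proof -
  let ?E = "perturbed_line m (\<lambda>_. 0) :: 'd chain" and ?M = "split_sub m a b :: (nat \<Rightarrow> 'd point) \<Rightarrow> _"
  \<comment> \<open>The factor 4 is that of \<open>norm_second_diff_le\<close>;
    \<open>sup_factor\<close> converts the size of \<open>d\<close> into its second
    differences.\<close>
  define \<epsilon>0 where "\<epsilon>0 = \<eta> / (4 * (sup_factor + 1))"
  have \<epsilon>0: "\<epsilon>0 > 0" "4 * \<epsilon>0 * sup_factor \<le> \<eta>"
    using \<eta> sup_factor_nonneg by (auto simp: \<epsilon>0_def field_simps)
  obtain \<delta> where \<delta>: "\<delta> > 0" and D: "\<And>x c k. 0 \<le> c \<Longrightarrow> c < \<delta> \<Longrightarrow> (\<And>i. i < 2 * m + 1 \<Longrightarrow> norm (x i) \<le> c) \<Longrightarrow>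
      k < 2 ^ r + 2 * m \<Longrightarrow> norm ((G ^^ r) (perturbed_line m x) ! k - (G ^^ r) ?E ! k - (?M ^^ r) x k) \<le> \<epsilon>0 * c"
    using iter_derivative[OF \<epsilon>0(1), of r] by blast
  obtain s where s: "\<And>k. k < 2 ^ r + 2 * m \<Longrightarrow> (G ^^ r) ?E ! k = ((real k + s) / 2 ^ r) *\<^sub>R e_vec"
    using iter_line[of r] by blast
  show ?thesis
  proof (rule that[of "\<delta> / (sup_factor + 1)"])
    fix p :: "'d chain" and c k
    assume p: "length p = 2 * m + 1" and ne: "p ! 1 \<noteq> p ! 0" and c: "c \<ge> 0"
      and small: "c \<le> \<delta> / (sup_factor + 1) * norm (p ! 1 - p ! 0)"
      and sd: "\<And>i. i + 2 < 2 * m + 1 \<Longrightarrow> norm (second_diff ((!) p) i) \<le> c"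
      and k: "k + 2 < 2 ^ r + 2 * m"
    define u where "u = p ! 1 - p ! 0"
    have u: "norm u > 0" using ne by (simp add: u_def)
    obtain R d where R: "linear R" "\<And>z. norm (R z) = norm u * norm z"
      and S: "similarity (\<lambda>z. R z + (p ! 0 - u))"
      and pd: "p = map (\<lambda>z. R z + (p ! 0 - u)) (perturbed_line m d)"
      and d: "\<And>i. i < 2 * m + 1 \<Longrightarrow> norm (d i) \<le> sup_factor * (c / norm u)"
      and sdd: "\<And>i. i + 2 < 2 * m + 1 \<Longrightarrow> norm (second_diff d i) \<le> c / norm u"
      by (rule chain_in_frame[OF p ne c sd, folded u_def]) (assumption, rule that, assumption+)
    define t where "t = c / norm u"
    have t: "t \<ge> 0" using c u by (simp add: t_def)
    have st: "0 \<le> sup_factor * t" and tl: "sup_factor * t < \<delta>"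
      using sup_factor_times_less[OF \<delta> c _ small] u by (simp_all add: t_def u_def)
    define q where "q i = (G ^^ r) (perturbed_line m d) ! i" for i
    define err where "err i = q i - (G ^^ r) ?E ! i - (?M ^^ r) d i" for i
    have err: "norm (err i) \<le> \<epsilon>0 * (sup_factor * t)" if "i < 2 ^ r + 2 * m" for i
      unfolding err_def q_def by (rule D[OF st tl]) (use that d in \<open>auto simp: t_def\<close>)
    have "norm (second_diff err k) \<le> 4 * (\<epsilon>0 * (sup_factor * t))"
      by (rule norm_second_diff_le; rule err) (use k in auto)
    also have "\<dots> = (4 * \<epsilon>0 * sup_factor) * t" by simp
    also have "\<dots> \<le> \<eta> * t" using \<epsilon>0(2) t by (rule mult_right_mono)
    finally have e: "norm (second_diff err k) \<le> \<eta> * t" .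
    \<comment> \<open>In each coordinate the linear part is one of the two scalar schemes. Summation
      over the coordinates produces the factor \<open>CARD('d)\<close>.\<close>
    have "\<bar>second_diff ((?M ^^ r) d) k $ cc\<bar> \<le> C * t" for cc
    proof -
      define w where "w = (if cc = first_coord then a else b)"
      have "second_diff ((?M ^^ r) d) k $ cc = second_diff ((lin_sub m w ^^ r) (\<lambda>i. d i $ cc)) k"
        by (simp add: split_sub_iter_component w_def)
      also have "\<bar>\<dots>\<bar> \<le> C * t"
      proof (rule lin[OF _ t _ k])
        show "w \<in> {a, b}" by (simp add: w_def)
        show "\<bar>second_diff (\<lambda>i. d i $ cc) i\<bar> \<le> t" if "i + 2 < 2 * m + 1" for i
          using order_trans[OF component_le_norm_cart[of "second_diff d i" cc] sdd[OF that]]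
          by (simp add: t_def)
      qed
      finally show ?thesis .
    qed
    then have "(\<Sum>cc\<in>UNIV. \<bar>second_diff ((?M ^^ r) d) k $ cc\<bar>) \<le> (\<Sum>cc\<in>(UNIV :: 'd set). C * t)"
      by (intro sum_mono)
    then have M: "norm (second_diff ((?M ^^ r) d) k) \<le> real CARD('d) * C * t"
      using order_trans[OF norm_le_l1_cart[of "second_diff ((?M ^^ r) d) k"]] by (simp add: mult.assoc)
    have "second_diff q k = second_diff (\<lambda>i. ((real i + s) / 2 ^ r) *\<^sub>R e_vec) k +
        second_diff ((?M ^^ r) d) k + second_diff err k"
    proof (rule second_diff_add3)
      fix i assume "i \<le> k + 2"
      then show "q i = ((real i + s) / 2 ^ r) *\<^sub>R e_vec + (?M ^^ r) d i + err i"
        using s[of i] k by (simp add: err_def)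
    qed
    also have "second_diff (\<lambda>i. ((real i + s) / 2 ^ r) *\<^sub>R (e_vec :: 'd point)) k = 0"
      unfolding scaleR_diff_left[symmetric] by (simp add: add_divide_distrib)
    finally have q: "norm (second_diff q k) \<le> (real CARD('d) * C + \<eta>) * t"
      using norm_triangle_le[of "second_diff ((?M ^^ r) d) k" "second_diff err k"] M e
      by (simp add: distrib_right)
    have nth: "(G ^^ r) p ! i = R (q i) + (p ! 0 - u)" if "i < 2 ^ r + 2 * m" for i
    proof -
      have "(G ^^ r) p = (G ^^ r) (map (\<lambda>z. R z + (p ! 0 - u)) (perturbed_line m d))"
        using pd by simp
      also have "\<dots> = map (\<lambda>z. R z + (p ! 0 - u)) ((G ^^ r) (perturbed_line m d))"
        by (rule sim_iter[OF S]) simp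
      finally show ?thesis using that length_G_iter[of "perturbed_line m d" r] by (simp add: q_def)
    qed
    have "second_diff (\<lambda>i. (G ^^ r) p ! i) k = second_diff (\<lambda>i. R (q i)) k"
      using nth[of k] nth[of "k + 1"] nth[of "k + 2"] k by simp
    also have "\<dots> = R (second_diff q k)" by (simp only: linear_diff[OF R(1)])
    finally have "second_diff (\<lambda>i. (G ^^ r) p ! i) k = R (second_diff q k)" .
    then have "norm (second_diff (\<lambda>i. (G ^^ r) p ! i) k) = norm u * norm (second_diff q k)"
      using R(2) by simp
    also have "\<dots> \<le> norm u * ((real CARD('d) * C + \<eta>) * t)" using q u by (intro mult_left_mono) auto
    also have "\<dots> = (real CARD('d) * C + \<eta>) * c" using u by (simp add: t_def)
    finally show "norm (second_diff (\<lambda>i. (G ^^ r) p ! i) k) \<le> (real CARD('d) * C + \<eta>) * c" .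
  qed (use \<delta> sup_factor_nonneg in auto)
qed

text \<open>The derivative with accuracy 1 is enough here: \<open>K\<close> need not be small, as it
  multiplies \<open>c\<close>, which decays where the lemma is applied. Halving of first differences
  up to \<open>K * c\<close> is what makes the scaled differences converge.\<close>

lemma first_diff_step:
  obtains \<epsilon> K where "\<epsilon> > 0" "K \<ge> 0"
    "\<And>p c k. length p = 2 * m + 1 \<Longrightarrow> p ! 1 \<noteq> p ! 0 \<Longrightarrow> c \<ge> 0 \<Longrightarrow> c \<le> \<epsilon> * norm (p ! 1 - p ! 0) \<Longrightarrow>
      (\<And>i. i + 2 < 2 * m + 1 \<Longrightarrow> norm (second_diff ((!) p) i) \<le> c) \<Longrightarrow> k \<le> 2 * m \<Longrightarrow>
      norm ((G p ! (k + 1) - G p ! k) - (1 / 2) *\<^sub>R (p ! 1 - p ! 0)) \<le> K * c \<and>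
      norm (G p ! k - p ! 0) \<le> K * (norm (p ! 1 - p ! 0) + c)"
proof -
  let ?E = "perturbed_line m (\<lambda>_. 0) :: 'd chain" and ?M = "split_sub m a b :: (nat \<Rightarrow> 'd point) \<Rightarrow> _"
  obtain \<delta> where \<delta>: "\<delta> > 0" and D: "\<And>k x c. k \<le> 2 * m + 1 \<Longrightarrow> 0 \<le> c \<Longrightarrow> c < \<delta> \<Longrightarrow>
      (\<And>i. i < 2 * m + 1 \<Longrightarrow> norm (x i) \<le> c) \<Longrightarrow>
      norm (G (perturbed_line m x) ! k - G ?E ! k - ?M x k) \<le> 1 * c"
    using deriv[of 1] by (auto simp del: mult_1)
  define KM where "KM = real CARD('d) * split_bound m a b"
  have KM: "KM \<ge> 0" using split_bound_nonneg[of m a b] by (simp add: KM_def)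
  define K1 where "K1 = (KM + 1) * sup_factor"
  have K1: "K1 \<ge> 0" using KM sup_factor_nonneg by (simp add: K1_def)
  \<comment> \<open>Bounds the factor \<open>(k + 1 + m + \<tau>) / 2 - 1\<close> for
    \<open>k \<le> 2 * m\<close>, the displacement of a refined point of the line from its first
    point.\<close>
  define K0 where "K0 = (3 * real m + 1 + \<bar>\<tau>\<bar>) / 2 + 1"
  have K0: "K0 \<ge> 0" by (simp add: K0_def)
  show ?thesis
  proof (rule that[of "\<delta> / (sup_factor + 1)" "2 * K1 + K0"])
    fix p :: "'d chain" and c k
    assume p: "length p = 2 * m + 1" and ne: "p ! 1 \<noteq> p ! 0" and c: "c \<ge> 0"
      and small: "c \<le> \<delta> / (sup_factor + 1) * norm (p ! 1 - p ! 0)"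
      and sd: "\<And>i. i + 2 < 2 * m + 1 \<Longrightarrow> norm (second_diff ((!) p) i) \<le> c"
      and k: "k \<le> 2 * m"
    define u where "u = p ! 1 - p ! 0"
    have u: "norm u > 0" using ne by (simp add: u_def)
    obtain R d where R: "linear R" "\<And>z. norm (R z) = norm u * norm z" "R e_vec = u"
      and S: "similarity (\<lambda>z. R z + (p ! 0 - u))"
      and pd: "p = map (\<lambda>z. R z + (p ! 0 - u)) (perturbed_line m d)"
      and d: "\<And>i. i < 2 * m + 1 \<Longrightarrow> norm (d i) \<le> sup_factor * (c / norm u)"
      by (rule chain_in_frame[OF p ne c sd, folded u_def]) (assumption, rule that, assumption+)
    define t where "t = c / norm u"
    have t: "t \<ge> 0" using c u by (simp add: t_def)
    have st: "0 \<le> sup_factor * t" and tl: "sup_factor * t < \<delta>"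
      using sup_factor_times_less[OF \<delta> c _ small] u by (simp_all add: t_def u_def)
    define f where "f i = G (perturbed_line m d) ! i - G ?E ! i" for i
    have f: "norm (f i) \<le> K1 * t" if i: "i \<le> 2 * m + 1" for i
    proof -
      have "norm (f i - ?M d i) \<le> 1 * (sup_factor * t)"
        unfolding f_def by (rule D[OF i st tl]) (use d in \<open>auto simp: t_def\<close>)
      moreover have "norm (?M d i) \<le> KM * (sup_factor * t)"
        unfolding KM_def by (rule norm_split_sub_le[OF _ st]) (use i d in \<open>auto simp: t_def\<close>)
      ultimately have "norm (f i) \<le> 1 * (sup_factor * t) + KM * (sup_factor * t)"
        using norm_triangle_sub[of "f i" "?M d i"] by simp
      then show ?thesis by (simp add: K1_def algebra_simps)
    qed
    have q: "G (perturbed_line m d) ! i = ((real i + 1 + real m + \<tau>) / 2) *\<^sub>R e_vec + f i" if "i \<le> 2 * m + 1" for i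
      using line[OF that] by (simp add: f_def)
    have nth: "G p ! i = ((real i + 1 + real m + \<tau>) / 2) *\<^sub>R u + R (f i) + (p ! 0 - u)" if "i \<le> 2 * m + 1" for i
    proof -
      have "G p = G (map (\<lambda>z. R z + (p ! 0 - u)) (perturbed_line m d))" using pd by simp
      also have "\<dots> = map (\<lambda>z. R z + (p ! 0 - u)) (G (perturbed_line m d))"
        by (rule sim[OF S]) simp
      finally have "G p ! i = R (G (perturbed_line m d) ! i) + (p ! 0 - u)"
        using that length_G[of "perturbed_line m d"] by simp
      then show ?thesis using R(1,3) by (simp only: q[OF that] linear_add linear_cmul)
    qed
    have Rf: "norm (R (f i)) \<le> K1 * c" if "i \<le> 2 * m + 1" for i
    proof -
      have "norm (R (f i)) \<le> norm u * (K1 * t)" unfolding R(2) using f[OF that] u by (intro mult_left_mono) auto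
      then show ?thesis using u by (simp add: t_def)
    qed
    have "(G p ! (k + 1) - G p ! k) - (1 / 2) *\<^sub>R u = R (f (k + 1)) - R (f k)"
    proof -
      have "((real (k + 1) + 1 + real m + \<tau>) / 2) *\<^sub>R u = ((real k + 1 + real m + \<tau>) / 2) *\<^sub>R u + (1 / 2) *\<^sub>R u"
        unfolding scaleR_left_distrib[symmetric] by (simp add: add_divide_distrib)
      then show ?thesis using nth[of k] nth[of "k + 1"] k by simp
    qed
    also have "norm \<dots> \<le> K1 * c + K1 * c"
      using norm_triangle_ineq4[of "R (f (k + 1))" "R (f k)"] Rf[of k] Rf[of "k + 1"] k by simp
    also have "\<dots> \<le> (2 * K1 + K0) * c" using K0 c by (simp add: distrib_right)
    finally have 1: "norm ((G p ! (k + 1) - G p ! k) - (1 / 2) *\<^sub>R u) \<le> (2 * K1 + K0) * c" .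
    have "G p ! k - p ! 0 = ((real k + 1 + real m + \<tau>) / 2 - 1) *\<^sub>R u + R (f k)"
      using nth[of k] k by (simp add: scaleR_diff_left)
    also have "norm \<dots> \<le> K0 * norm u + K1 * c"
    proof (rule norm_triangle_mono)
      have "\<bar>(real k + 1 + real m + \<tau>) / 2 - 1\<bar> \<le> K0"
        using of_nat_mono[OF k, where 'a = real] by (auto simp: K0_def abs_le_iff abs_if field_simps)
      then show "norm (((real k + 1 + real m + \<tau>) / 2 - 1) *\<^sub>R u) \<le> K0 * norm u"
        unfolding norm_scaleR by (rule mult_right_mono) simp
      show "norm (R (f k)) \<le> K1 * c" using Rf k by simp
    qed
    also have "\<dots> \<le> (2 * K1 + K0) * norm u + (2 * K1 + K0) * c"
      using K0 K1 c by (intro add_mono mult_right_mono) auto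
    finally have 2: "norm (G p ! k - p ! 0) \<le> (2 * K1 + K0) * (norm u + c)" by (simp add: distrib_left)
    show "norm ((G p ! (k + 1) - G p ! k) - (1 / 2) *\<^sub>R (p ! 1 - p ! 0)) \<le> (2 * K1 + K0) * c \<and>
      norm (G p ! k - p ! 0) \<le> (2 * K1 + K0) * (norm (p ! 1 - p ! 0) + c)"
      using 1 2 by (simp add: u_def)
  qed (use \<delta> sup_factor_nonneg K0 K1 in auto)
qed

end

section \<open>Regularity of the limit curve\<close>

text \<open>The estimates are uniform up to the ends of the parameter interval, so one constant
  serves every margin \<open>z\<close>. The step bound is \<open>1 / 2 ^ l0\<close>, the range of
  the Hoelder estimate.\<close>

lemma Ck_holder_atI:
  fixes P :: "'a::real_normed_vector list" and \<Phi> :: "real \<Rightarrow> 'a"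
  assumes P: "length P = L + 2 * m" and \<beta>: "\<beta> > 0"
    and cont: "continuous_on UNIV \<Phi>"
    and lim: "\<And>l i. l \<ge> l0 \<Longrightarrow> 0 < i \<Longrightarrow> i < 2 ^ l * L \<Longrightarrow>
      norm (\<Phi> (real i / 2 ^ l) - (G ^^ l) P ! i) \<le> K * (1 / 2) ^ l"
    and deriv: "\<And>t. 0 < t \<Longrightarrow> t < real L \<Longrightarrow> (\<Phi> has_vector_derivative \<Psi> t) (at t)"
    and hol: "\<And>s t. 0 < s \<Longrightarrow> s < real L \<Longrightarrow> 0 < t \<Longrightarrow> t < real L \<Longrightarrow> \<bar>t - s\<bar> \<le> 1 / 2 ^ l0 \<Longrightarrow>
      norm (\<Psi> t - \<Psi> s) \<le> H * \<bar>t - s\<bar> powr \<beta>"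
  shows "Ck_holder_at 1 \<beta> m G P"
proof -
  have "limit_curve m G P \<Phi>"
    unfolding limit_curve_def param_length_eq[OF P]
  proof (intro conjI allI impI cont)
    fix z :: real assume z: "z > 0"
    let ?I = "\<lambda>l. {i::nat. i \<ge> 1 \<and> real i \<in> (\<lambda>t. 2 ^ l * t) ` inner_interval (real L) z}"
    let ?s = "\<lambda>l. SUP i\<in>?I l. ennreal (norm (\<Phi> (real i / 2 ^ l) - (G ^^ l) P ! i))"
    show "?s \<longlonglongrightarrow> 0"
    proof (rule tendsto_sandwich[OF _ _ tendsto_const])
      have "(\<lambda>l. \<bar>K\<bar> * (1 / 2) ^ l) \<longlonglongrightarrow> \<bar>K\<bar> * 0"
        by (intro tendsto_intros LIMSEQ_power_zero) auto
      then show "(\<lambda>l. ennreal (\<bar>K\<bar> * (1 / 2) ^ l)) \<longlonglongrightarrow> 0"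
        by (subst ennreal_tendsto_0_iff) auto
      show "\<forall>\<^sub>F l in sequentially. ?s l \<le> ennreal (\<bar>K\<bar> * (1 / 2) ^ l)"
        using eventually_ge_at_top[of l0]
      proof eventually_elim
        case (elim l)
        show ?case
        proof (rule SUP_least)
          fix i assume "i \<in> ?I l"
          then obtain t where i: "i \<ge> 1" "real i = 2 ^ l * t" and "t \<in> inner_interval (real L) z"
            by blast
          then have "t \<le> real L - z" by (simp add: inner_interval_def)
          then have "2 ^ l * t < 2 ^ l * real L" using z by simp
          then have "real i < real (2 ^ l * L)" using i by simp
          then have "i < 2 ^ l * L" by (simp only: of_nat_less_iff)
          then have "norm (\<Phi> (real i / 2 ^ l) - (G ^^ l) P ! i) \<le> K * (1 / 2) ^ l"
            using i elim by (intro lim) auto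
          also have "\<dots> \<le> \<bar>K\<bar> * (1 / 2) ^ l" by (intro mult_right_mono) auto
          finally show "ennreal (norm (\<Phi> (real i / 2 ^ l) - (G ^^ l) P ! i)) \<le> ennreal (\<bar>K\<bar> * (1 / 2) ^ l)"
            by (rule ennreal_leI)
        qed
      qed
    qed simp
  qed
  moreover have "Ck_holder_curve (real L) 1 \<beta> \<Phi>"
  proof -
    have cd: "curve_deriv 1 \<Phi> t = \<Psi> t" if "0 < t" "t < real L" for t
      using deriv[OF that] by (simp add: curve_deriv_def vector_derivative_at)
    have cont': "continuous_on {0<..<real L} \<Psi>"
      unfolding continuous_on_iff
    proof (intro ballI allI impI)
      fix s e :: real assume s: "s \<in> {0<..<real L}" and e: "e > 0"
      obtain d where d: "d > 0" "\<And>x. x \<noteq> 0 \<Longrightarrow> \<bar>x\<bar> < d \<Longrightarrow> H * \<bar>x\<bar> powr \<beta> < e"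
        using holder_modulus_small[OF \<beta> e] by blast
      have "dist (\<Psi> t) (\<Psi> s) < e" if "t \<in> {0<..<real L}" "dist t s < min d (1 / 2 ^ l0)" for t
      proof (cases "t = s")
        case False
        have "norm (\<Psi> t - \<Psi> s) \<le> H * \<bar>t - s\<bar> powr \<beta>"
          using that s by (intro hol) (auto simp: dist_real_def)
        also have "\<dots> < e" using that False by (intro d(2)) (auto simp: dist_real_def)
        finally show ?thesis by (simp add: dist_norm)
      qed (use e in simp)
      then show "\<exists>d>0. \<forall>t\<in>{0<..<real L}. dist t s < d \<longrightarrow> dist (\<Psi> t) (\<Psi> s) < e"
        using d(1) by (intro exI[of _ "min d (1 / 2 ^ l0)"]) auto
    qed
    have "Ck_curve (real L) 1 \<Phi>"
      unfolding Ck_curve_def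
    proof (intro conjI allI impI ballI)
      fix j :: nat and t assume "j < 1" "t \<in> {0<..<real L}"
      then show "curve_deriv j \<Phi> differentiable (at t)"
        using deriv[of t] by (auto simp: curve_deriv_def intro: differentiableI_vector)
    next
      show "continuous_on {0<..<real L} (curve_deriv 1 \<Phi>)"
        using cont' by (rule continuous_on_cong[THEN iffD1, rotated 2]) (auto simp: cd[unfolded One_nat_def])
    qed
    moreover have "(SUP h\<in>{0<..1 / 2 ^ l0}. ennreal (h powr (- \<beta>)) * modulus (real L) z (curve_deriv 1 \<Phi>) h) < \<infinity>"
      if z: "z > 0" for z
    proof -
      have "(SUP h\<in>{0<..1 / 2 ^ l0}. ennreal (h powr (- \<beta>)) * modulus (real L) z (curve_deriv 1 \<Phi>) h) \<le> ennreal \<bar>H\<bar>"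
      proof (rule SUP_least)
        fix h :: real assume h: "h \<in> {0<..1 / 2 ^ l0}"
        have "modulus (real L) z (curve_deriv 1 \<Phi>) h \<le> ennreal (\<bar>H\<bar> * h powr \<beta>)"
          unfolding modulus_def curve_norm_def
        proof (intro SUP_least ennreal_leI)
          fix t assume "t \<in> inner_interval (real L) (z + h / 2)"
          then have t: "z + h / 2 \<le> t" "t \<le> real L - (z + h / 2)" by (auto simp: inner_interval_def)
          have "norm (\<Psi> (t + h / 2) - \<Psi> (t - h / 2)) \<le> H * \<bar>(t + h / 2) - (t - h / 2)\<bar> powr \<beta>"
            using t h z by (intro hol) auto
          also have "\<dots> \<le> \<bar>H\<bar> * h powr \<beta>" using h by (auto intro!: mult_right_mono)
          finally show "norm (curve_deriv 1 \<Phi> (t + h / 2) - curve_deriv 1 \<Phi> (t - h / 2)) \<le> \<bar>H\<bar> * h powr \<beta>"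
            using t h z by (subst (1 2) cd) auto
        qed
        then have "ennreal (h powr (- \<beta>)) * modulus (real L) z (curve_deriv 1 \<Phi>) h \<le>
            ennreal (h powr (- \<beta>)) * ennreal (\<bar>H\<bar> * h powr \<beta>)" by (intro mult_left_mono) auto
        also have "\<dots> = ennreal \<bar>H\<bar>"
          using h by (simp add: powr_minus field_simps flip: ennreal_mult)
        finally show "ennreal (h powr (- \<beta>)) * modulus (real L) z (curve_deriv 1 \<Phi>) h \<le> ennreal \<bar>H\<bar>" .
      qed
      also have "\<dots> < \<infinity>" by simp
      finally show ?thesis .
    qed
    ultimately show ?thesis unfolding Ck_holder_curve_def by (intro conjI exI[of _ "1 / 2 ^ l0"]) auto
  qed
  ultimately show ?thesis unfolding Ck_holder_at_def param_length_eq[OF P] by blast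
qed

text \<open>Each point \<open>r\<close> levels further on is produced by one of the \<open>L\<close>
  windows. Points at the right end, beyond \<open>2 ^ r * L\<close>, belong to the last one.\<close>

lemma subchain_index:
  fixes r m L i :: nat
  assumes "i < 2 ^ r * L + 2 * m" "L \<ge> 1"
  obtains k j where "i = 2 ^ r * k + j" "k < L" "j < 2 ^ r + 2 * m"
proof (cases "i div 2 ^ r < L")
  case True
  have "i = 2 ^ r * (i div 2 ^ r) + i mod 2 ^ r" by simp
  moreover have "i mod 2 ^ r < 2 ^ r + 2 * m" by (simp add: trans_less_add1)
  ultimately show ?thesis using that True by blast
next
  case False
  obtain L' where L: "L = Suc L'" using assms(2) by (cases L) auto
  have "2 ^ r * L \<le> 2 ^ r * (i div 2 ^ r)" using False by (intro mult_left_mono) auto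
  also have "\<dots> \<le> i" by simp
  finally have "i = 2 ^ r * L' + (i - 2 ^ r * L')" "i - 2 ^ r * L' < 2 ^ r + 2 * m"
    using assms(1) by (auto simp: L)
  then show ?thesis using that L by blast
qed

text \<open>Contraction is known over blocks of \<open>r\<close> levels only. The constant absorbs
  the first \<open>r\<close> levels, and every later level is reached from one of them in whole
  blocks.\<close>

lemma geometric_decay_of_steps:
  fixes s :: "nat \<Rightarrow> real"
  assumes step: "\<And>l. l \<ge> l0 \<Longrightarrow> s (l + r) \<le> \<theta> ^ r * s l" and r: "r \<ge> 1" and \<theta>: "\<theta> > 0"
  obtains C where "C \<ge> 0" "\<And>l. l \<ge> l0 \<Longrightarrow> s l \<le> C * \<theta> ^ l"
proof -
  define C where "C = (\<Sum>l\<in>{l0..<l0 + r}. \<bar>s l\<bar> / \<theta> ^ l)"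
  have C: "C \<ge> 0" unfolding C_def using \<theta> by (intro sum_nonneg) auto
  have "s l \<le> C * \<theta> ^ l" if "l \<ge> l0" for l
    using that
  proof (induction l rule: less_induct)
    case (less l)
    show ?case
    proof (cases "l < l0 + r")
      case True
      have "\<bar>s l\<bar> / \<theta> ^ l \<le> C" unfolding C_def using less.prems True \<theta>
        by (intro member_le_sum) auto
      then show ?thesis using \<theta> by (simp add: field_simps)
    next
      case False
      have "s ((l - r) + r) \<le> \<theta> ^ r * s (l - r)" using False by (intro step) auto
      also have "\<dots> \<le> \<theta> ^ r * (C * \<theta> ^ (l - r))"
        using False r \<theta> by (intro mult_left_mono less.IH) auto
      also have "\<dots> = C * (\<theta> ^ r * \<theta> ^ (l - r))" by simp
      also have "\<theta> ^ r * \<theta> ^ (l - r) = \<theta> ^ l" using False by (simp flip: power_add)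
      finally show ?thesis using False by simp
    qed
  qed
  then show ?thesis using that C by blast
qed

context differentiable_glue_scheme
begin

lemma holder_at_straightened:
  fixes P :: "'d chain"
  assumes m: "m \<ge> 1" and P: "length P = L + 2 * m" and L: "L \<ge> 1" and \<beta>: "\<beta> > 0" "\<beta> < \<beta>1"
    and str: "straightened m G P"
    and rate_a: "\<exists>C. second_diff_rate m a (2 powr (- (1 + \<beta>1))) C"
    and rate_b: "\<exists>C. second_diff_rate m b (2 powr (- (1 + \<beta>1))) C"
  shows "Ck_holder_at 1 \<beta> m G P"
proof -
  define \<theta> :: real where "\<theta> = 2 powr (- (1 + \<beta>))"
  define \<theta>1 :: real where "\<theta>1 = 2 powr (- (1 + \<beta>1))"
  have \<theta>: "\<theta> > 0" "\<theta>1 > 0" "\<theta>1 < \<theta>" using \<beta> by (auto simp: \<theta>_def \<theta>1_def)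
  obtain Ca where Ca: "second_diff_rate m a \<theta>1 Ca" using rate_a unfolding \<theta>1_def ..
  obtain Cb where Cb: "second_diff_rate m b \<theta>1 Cb" using rate_b unfolding \<theta>1_def ..
  have nonneg: "Ca \<ge> 0" "Cb \<ge> 0" using Ca Cb by (auto simp: second_diff_rate_def)
  \<comment> \<open>The constant lost in a block of linear steps: both schemes, and the passage from
    coordinates to the norm.\<close>
  define D where "D = real CARD('d) * (Ca + Cb)"
  have D: "D \<ge> 0" using nonneg by (simp add: D_def)
  have "(\<lambda>r. D * (\<theta>1 / \<theta>) ^ r) \<longlonglongrightarrow> D * 0"
    using \<theta> by (intro tendsto_intros LIMSEQ_power_zero) auto
  then have "\<forall>\<^sub>F r in sequentially. D * (\<theta>1 / \<theta>) ^ r < 1 / 2"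
    by (rule order_tendstoD(2)) simp
  then have "\<forall>\<^sub>F r in sequentially. D * (\<theta>1 / \<theta>) ^ r < 1 / 2 \<and> r \<ge> 1"
    using eventually_ge_at_top[of 1] by (rule eventually_conj)
  \<comment> \<open>The gap between \<open>\<theta>1\<close> and \<open>\<theta>\<close> beats
    \<open>D\<close>, so the linear part takes at most half of \<open>\<theta> ^ r\<close>; the
    other half is the \<open>\<eta>\<close> of \<open>second_diff_step\<close>.\<close>
  then obtain r where r: "D * (\<theta>1 / \<theta>) ^ r < 1 / 2" "r \<ge> 1"
    using eventually_happens sequentially_bot by blast
  have r1: "D * \<theta>1 ^ r + \<theta> ^ r / 2 \<le> \<theta> ^ r"
    using r(1) \<theta> by (simp add: power_divide field_simps)
  obtain \<epsilon>1 where \<epsilon>1: "\<epsilon>1 > 0" and step: "\<And>p c k. length p = 2 * m + 1 \<Longrightarrow> p ! 1 \<noteq> p ! 0 \<Longrightarrow> c \<ge> 0 \<Longrightarrow>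
      c \<le> \<epsilon>1 * norm (p ! 1 - p ! 0) \<Longrightarrow>
      (\<And>i. i + 2 < 2 * m + 1 \<Longrightarrow> norm (second_diff ((!) p) i) \<le> c) \<Longrightarrow> k + 2 < 2 ^ r + 2 * m \<Longrightarrow>
      norm (second_diff (\<lambda>i. (G ^^ r) p ! i) k) \<le> (real CARD('d) * ((Ca + Cb) * \<theta>1 ^ r) + \<theta> ^ r / 2) * c"
  proof (rule second_diff_step[of r "(Ca + Cb) * \<theta>1 ^ r" "\<theta> ^ r / 2"])
    fix w and x :: "nat \<Rightarrow> real" and c :: real and k
    assume *: "w \<in> {a, b}" "c \<ge> 0" "\<And>i. i + 2 < 2 * m + 1 \<Longrightarrow> \<bar>second_diff x i\<bar> \<le> c" "k + 2 < 2 ^ r + 2 * m"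
    have "Ca * \<theta>1 ^ r * c \<le> (Ca + Cb) * \<theta>1 ^ r * c" "Cb * \<theta>1 ^ r * c \<le> (Ca + Cb) * \<theta>1 ^ r * c"
      using nonneg \<theta> *(2) by (auto intro!: mult_right_mono)
    moreover have "\<bar>second_diff ((lin_sub m w ^^ r) x) k\<bar> \<le> Ca * \<theta>1 ^ r * c \<or>
        \<bar>second_diff ((lin_sub m w ^^ r) x) k\<bar> \<le> Cb * \<theta>1 ^ r * c"
      using * Ca Cb unfolding second_diff_rate_def by blast
    ultimately show "\<bar>second_diff ((lin_sub m w ^^ r) x) k\<bar> \<le> (Ca + Cb) * \<theta>1 ^ r * c"
      by linarith
  qed (use \<theta> that in auto)
  obtain \<epsilon>2 K where \<epsilon>2: "\<epsilon>2 > 0" "K \<ge> 0" and first: "\<And>p c k. length p = 2 * m + 1 \<Longrightarrow> p ! 1 \<noteq> p ! 0 \<Longrightarrow> c \<ge> 0 \<Longrightarrow>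
      c \<le> \<epsilon>2 * norm (p ! 1 - p ! 0) \<Longrightarrow>
      (\<And>i. i + 2 < 2 * m + 1 \<Longrightarrow> norm (second_diff ((!) p) i) \<le> c) \<Longrightarrow> k \<le> 2 * m \<Longrightarrow>
      norm ((G p ! (k + 1) - G p ! k) - (1 / 2) *\<^sub>R (p ! 1 - p ! 0)) \<le> K * c \<and>
      norm (G p ! k - p ! 0) \<le> K * (norm (p ! 1 - p ! 0) + c)"
    by (rule first_diff_step) (rule that, assumption, assumption, blast)
  obtain \<epsilon>0 where \<epsilon>0: "\<epsilon>0 > 0" and dist: "\<And>(p :: 'd chain) \<epsilon>. length p = 2 * m + 1 \<Longrightarrow> \<epsilon> > 0 \<Longrightarrow> \<epsilon> \<le> \<epsilon>0 \<Longrightarrow>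
      distortion0 (2 * m + 1) p \<le> ereal \<epsilon> \<Longrightarrow>
      p ! 1 \<noteq> p ! 0 \<and> (\<forall>i. i + 2 < 2 * m + 1 \<longrightarrow>
        norm (second_diff ((!) p) i) \<le> 2 * \<epsilon> * norm (p ! 1 - p ! 0))"
    using small_distortion[OF m, where 'a = "'d point"] by blast
  \<comment> \<open>The halves compensate the factor 2 of \<open>small_distortion\<close>.\<close>
  define \<epsilon> where "\<epsilon> = min \<epsilon>0 (min (\<epsilon>1 / 2) (\<epsilon>2 / 2))"
  have \<epsilon>: "\<epsilon> > 0" "\<epsilon> \<le> \<epsilon>0" "2 * \<epsilon> \<le> \<epsilon>1" "2 * \<epsilon> \<le> \<epsilon>2" using \<epsilon>0 \<epsilon>1 \<epsilon>2 by (auto simp: \<epsilon>_def)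
  have "\<forall>\<^sub>F l in sequentially. distortion (2 * m + 1) ((G ^^ l) P) < ereal \<epsilon>"
    using str \<epsilon>(1) unfolding straightened_def by (intro order_tendstoD(2)[of _ 0]) auto
  then obtain l0 where l0: "\<And>l. l \<ge> l0 \<Longrightarrow> distortion (2 * m + 1) ((G ^^ l) P) < ereal \<epsilon>"
    by (auto simp: eventually_sequentially)
  define Q where "Q l i = (G ^^ l) P ! i" for l i
  define p where "p l k = subchain (2 * m + 1) k ((G ^^ l) P)" for l k
  have len: "length ((G ^^ l) P) = 2 ^ l * L + 2 * m" for l
    using local_scheme_length_iter[OF loc P L] .
  have fits: "k + (2 * m + 1) \<le> length ((G ^^ l) P)" if "k < 2 ^ l * L" for k l
    using that by (simp add: len)
  have lenp: "length (p l k) = 2 * m + 1" if "k < 2 ^ l * L" for k l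
    unfolding p_def using length_subchain[OF fits[OF that]] .
  have nthp: "p l k ! i = Q l (k + i)" if "k < 2 ^ l * L" "i < 2 * m + 1" for k l i
    unfolding p_def Q_def using nth_subchain[OF fits[OF that(1)] that(2)] .
  have Giter: "(G ^^ s) (p l k) ! j = Q (l + s) (2 ^ s * k + j)" if "k < 2 ^ l * L" "j < 2 ^ s + 2 * m" for k l s j
  proof -
    have "(G ^^ s) ((G ^^ l) P) ! (2 ^ s * k + j) = (G ^^ s) (p l k) ! j"
      unfolding p_def by (rule local_scheme_iter_shift[OF loc fits[OF that(1)] that(2)])
    then show ?thesis by (simp add: Q_def funpow_add add.commute[of l s])
  qed
  have good: "p l k ! 1 \<noteq> p l k ! 0 \<and> (\<forall>i. i + 2 < 2 * m + 1 \<longrightarrow>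
        norm (second_diff ((!) (p l k)) i) \<le> 2 * \<epsilon> * norm (p l k ! 1 - p l k ! 0))"
    if "l \<ge> l0" "k < 2 ^ l * L" for l k
  proof (rule dist[OF lenp[OF that(2)] \<epsilon>(1,2)])
    show "distortion0 (2 * m + 1) (p l k) \<le> ereal \<epsilon>"
      using distortion0_le_distortion[OF fits[OF that(2)]] l0[OF that(1)] unfolding p_def by simp
  qed
  define sd where "sd l = Max ((\<lambda>i. norm (second_diff (Q l) i)) ` {i. i + 2 < 2 ^ l * L + 2 * m})" for l
  have finI: "finite {i. i + 2 < 2 ^ l * L + 2 * m}" for l
    by (rule finite_subset[of _ "{..<2 ^ l * L + 2 * m}"]) auto
  have sd: "norm (second_diff (Q l) i) \<le> sd l" if "i + 2 < 2 ^ l * L + 2 * m" for l i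
    unfolding sd_def using that finI by (intro Max_ge) auto
  have pos: "(0::nat) < 2 ^ l * L" for l using L by simp
  have "0 + 2 < 2 ^ l * L + 2 * m" for l using pos[of l] m by linarith
  from order_trans[OF norm_ge_zero sd[OF this]] have sd0: "sd l \<ge> 0" for l .
  \<comment> \<open>A bound for the second differences of a window with two purposes: it is at most
    \<open>sd l\<close>, which gives the recursion, and at most a small multiple of the first edge,
    as the step lemmas demand.\<close>
  define c where "c l k = min (sd l) (2 * \<epsilon> * norm (p l k ! 1 - p l k ! 0))" for l k
  have c0: "c l k \<ge> 0" for l k using sd0 \<epsilon>(1) by (simp add: c_def)
  have csd: "c l k \<le> sd l" for l k by (simp add: c_def)
  have c\<epsilon>: "c l k \<le> e * norm (p l k ! 1 - p l k ! 0)" if "2 * \<epsilon> \<le> e" for l k e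
    using mult_right_mono[OF that norm_ge_zero[of "p l k ! 1 - p l k ! 0"]] by (simp add: c_def)
  have csecond: "norm (second_diff ((!) (p l k)) i) \<le> c l k"
    if "l \<ge> l0" "k < 2 ^ l * L" "i + 2 < 2 * m + 1" for l k i
  proof -
    have "norm (second_diff ((!) (p l k)) i) = norm (second_diff (Q l) (k + i))"
      using that by (simp add: nthp)
    also have "\<dots> \<le> sd l" using that by (intro sd) auto
    finally show ?thesis using good[OF that(1,2)] that(3) by (simp add: c_def)
  qed
  have sdstep: "sd (l + r) \<le> \<theta> ^ r * sd l" if l: "l \<ge> l0" for l
  proof -
    have "norm (second_diff (Q (l + r)) i) \<le> \<theta> ^ r * sd l" if i: "i + 2 < 2 ^ (l + r) * L + 2 * m" for i
    proof -
      \<comment> \<open>A second difference occupies three consecutive points, which must all come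
        from one window. This amounts to splitting the index with \<open>m - 1\<close> in place of
        \<open>m\<close>.\<close>
      have "i < 2 ^ r * (2 ^ l * L) + (2 * m - 2)" using i m by (simp add: power_add mult_ac)
      then have "i < 2 ^ r * (2 ^ l * L) + 2 * (m - 1)" by (simp add: diff_mult_distrib2)
      then obtain k j where kj: "i = 2 ^ r * k + j" "k < 2 ^ l * L" "j < 2 ^ r + 2 * (m - 1)"
        using subchain_index pos[of l] by (metis One_nat_def Suc_leI)
      have j: "j + 2 < 2 ^ r + 2 * m" using kj(3) m by simp
      have "second_diff (Q (l + r)) i = second_diff (\<lambda>i. (G ^^ r) (p l k) ! i) j"
        using Giter[OF kj(2), of j r] Giter[OF kj(2), of "j + 1" r] Giter[OF kj(2), of "j + 2" r] j
        by (simp add: kj(1))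
      also have "norm \<dots> \<le> (real CARD('d) * ((Ca + Cb) * \<theta>1 ^ r) + \<theta> ^ r / 2) * c l k"
        using good[OF l kj(2)] csecond[OF l kj(2)] lenp[OF kj(2)] c0 c\<epsilon>[OF \<epsilon>(3)] j by (intro step) auto
      also have "\<dots> = (D * \<theta>1 ^ r + \<theta> ^ r / 2) * c l k" by (simp add: D_def)
      also have "\<dots> \<le> \<theta> ^ r * c l k" by (intro mult_right_mono r1 c0)
      also have "\<dots> \<le> \<theta> ^ r * sd l" using \<theta> csd by (intro mult_left_mono) auto
      finally show ?thesis .
    qed
    moreover have "{i. i + 2 < 2 ^ (l + r) * L + 2 * m} \<noteq> {}"
      using \<open>\<And>l. 0 + 2 < 2 ^ l * L + 2 * m\<close>[of "l + r"] by blast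
    ultimately show ?thesis unfolding sd_def[of "l + r"] using finI by (intro Max.boundedI) auto
  qed
  obtain C where C: "C \<ge> 0" "\<And>l. l \<ge> l0 \<Longrightarrow> sd l \<le> C * \<theta> ^ l"
    using geometric_decay_of_steps[of l0 sd r \<theta>, OF sdstep r(2) \<theta>(1)] by blast
  define q :: real where "q = 2 powr (- \<beta>)"
  have q: "\<theta> = q / 2" by (simp add: \<theta>_def q_def powr_diff powr_minus powr_add field_simps)
  define C' where "C' = C + K * C + K"
  have C': "C' \<ge> 0" "C \<le> C'" "K * C \<le> C'" "K \<le> C'" using C(1) \<epsilon>2(2) by (auto simp: C'_def)
  have le: "K * c l k \<le> C' * (q / 2) ^ l" "c l k \<le> C * (q / 2) ^ l" if "l \<ge> l0" for l k
  proof -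
    show *: "c l k \<le> C * (q / 2) ^ l" using order_trans[OF csd C(2)[OF that]] by (simp add: q)
    have "K * c l k \<le> K * (C * (q / 2) ^ l)" using * \<epsilon>2 by (intro mult_left_mono) auto
    also have "\<dots> \<le> C' * (q / 2) ^ l" using C'(3) by (simp add: q_def mult_right_mono flip: mult.assoc)
    finally show "K * c l k \<le> C' * (q / 2) ^ l" .
  qed
  obtain \<Phi> \<Psi> K' H where curve: "continuous_on UNIV \<Phi>"
    "\<And>l i. l \<ge> l0 \<Longrightarrow> 0 < i \<Longrightarrow> i < 2 ^ l * L \<Longrightarrow> norm (\<Phi> (real i / 2 ^ l) - Q l i) \<le> K' * (1 / 2) ^ l"
    "\<And>t. 0 < t \<Longrightarrow> t < real L \<Longrightarrow> (\<Phi> has_vector_derivative \<Psi> t) (at t)"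
    "\<And>s t. 0 < s \<Longrightarrow> s < real L \<Longrightarrow> 0 < t \<Longrightarrow> t < real L \<Longrightarrow> \<bar>t - s\<bar> \<le> 1 / 2 ^ l0 \<Longrightarrow>
      norm (\<Psi> t - \<Psi> s) \<le> H * \<bar>t - s\<bar> powr \<beta>"
  \<comment> \<open>The factor \<open>1 + C\<close> accounts for the term \<open>c l i\<close> in
    the displacement bound, which is at most \<open>C * (q / 2) ^ l\<close>.\<close>
  proof (rule dyadic_C1_limit[of \<beta> q "C' * (1 + C)" L l0 Q])
    show "\<beta> > 0" "q = 2 powr (- \<beta>)" "C' * (1 + C) \<ge> 0" "L \<ge> 1" using \<beta> C'(1) C(1) L by (auto simp: q_def)
    have q0: "(q / 2) ^ l \<ge> 0" for l by (simp add: q_def)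
    have C1: "C' * (q / 2) ^ l \<le> C' * (1 + C) * (q / 2) ^ l" for l
      using C'(1) C(1) q0 by (intro mult_right_mono) (auto simp: distrib_left)
    fix l i assume l: "l \<ge> l0" and i: "i < 2 ^ l * L"
    have "norm (second_diff (Q l) i) \<le> sd l" using i m by (intro sd) linarith
    also have "\<dots> \<le> C * (q / 2) ^ l" using C(2)[OF l] by (simp add: q)
    also have "\<dots> \<le> C' * (q / 2) ^ l" using C'(2) q0 by (intro mult_right_mono) auto
    finally show "norm (second_diff (Q l) i) \<le> C' * (1 + C) * (q / 2) ^ l" using C1[of l] by simp
    fix \<mu> :: nat assume \<mu>: "\<mu> \<le> 1"
    have G1: "G (p l i) ! j = Q (Suc l) (2 * i + j)" if "j < 2 + 2 * m" for j
      using Giter[OF i, of j 1] that by simp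
    have F: "norm ((G (p l i) ! (\<mu> + 1) - G (p l i) ! \<mu>) - (1 / 2) *\<^sub>R (p l i ! 1 - p l i ! 0)) \<le> K * c l i \<and>
      norm (G (p l i) ! \<mu> - p l i ! 0) \<le> K * (norm (p l i ! 1 - p l i ! 0) + c l i)"
      using good[OF l i] csecond[OF l i] lenp[OF i] c0 c\<epsilon>[OF \<epsilon>(4)] \<mu> m by (intro first) auto
    have G\<mu>: "G (p l i) ! (\<mu> + 1) = Q (Suc l) (2 * i + \<mu> + 1)" "G (p l i) ! \<mu> = Q (Suc l) (2 * i + \<mu>)"
      using G1[of "\<mu> + 1"] G1[of \<mu>] \<mu> m by (simp_all add: add.assoc)
    have p01: "p l i ! 1 = Q l (i + 1)" "p l i ! 0 = Q l i" using nthp[OF i, of 1] nthp[OF i, of 0] m by auto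
    show "norm ((Q (Suc l) (2 * i + \<mu> + 1) - Q (Suc l) (2 * i + \<mu>)) - (1 / 2) *\<^sub>R (Q l (i + 1) - Q l i))
        \<le> C' * (1 + C) * (q / 2) ^ l"
      using F le(1)[OF l, of i] C1[of l] unfolding G\<mu> p01 by linarith
    have "norm (Q (Suc l) (2 * i + \<mu>) - Q l i) \<le> K * (norm (Q l (i + 1) - Q l i) + c l i)"
      using F unfolding G\<mu> p01 by simp
    also have "\<dots> \<le> C' * ((1 + C) * (norm (Q l (i + 1) - Q l i) + (q / 2) ^ l))"
    proof (intro mult_mono)
      have "norm (Q l (i + 1) - Q l i) + c l i \<le> norm (Q l (i + 1) - Q l i) + C * (q / 2) ^ l"
        using le(2)[OF l, of i] by simp
      also have "\<dots> \<le> (1 + C) * norm (Q l (i + 1) - Q l i) + (1 + C) * (q / 2) ^ l"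
        using C(1) q0[of l] by (intro add_mono) (auto simp: distrib_right)
      finally show "norm (Q l (i + 1) - Q l i) + c l i \<le> (1 + C) * (norm (Q l (i + 1) - Q l i) + (q / 2) ^ l)"
        by (simp only: distrib_left)
    qed (use C' c0 in auto)
    finally show "norm (Q (Suc l) (2 * i + \<mu>) - Q l i) \<le> C' * (1 + C) * (norm (Q l (i + 1) - Q l i) + (q / 2) ^ l)"
      by (simp only: mult.assoc)
  qed (rule that)
  show ?thesis
    by (rule Ck_holder_atI[OF P \<beta>(1) curve(1) curve(2)[unfolded Q_def] curve(3,4)])
qed

end

section \<open>Weights and derivatives of the given schemes\<close>

lemma chain_seminorm_0_le:
  assumes "\<And>i. i < length d \<Longrightarrow> norm (d ! i) \<le> c" "d \<noteq> []"
  shows "chain_seminorm 0 d \<le> c"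
  unfolding chain_seminorm_def using assms by (auto simp: in_set_conv_nth)

lemma glue_scheme_local: "glue_scheme m G \<Longrightarrow> local_scheme m G"
  unfolding glue_scheme_def local_scheme_def Let_def by blast

text \<open>Row \<open>i\<close> of \<open>A \<mu>\<close> is the rule for the point of index
  \<open>\<mu> + i\<close>. Data in the first coordinate turn the equality of chain maps into one of
  scalar functionals.\<close>

lemma linear_scheme_of_weights:
  fixes S :: "'d::{finite,linorder} chain \<Rightarrow> 'd chain"
  assumes "linear_scheme_of m A S"
  obtains a where "\<And>\<mu>. \<mu> \<in> {0, 1} \<Longrightarrow> (\<Sum>j\<le>m. a \<mu> j) = 1"
    "\<And>P. length P \<ge> 2 * m + 1 \<Longrightarrow> length (S P) = 2 * length P + 1 - (2 * m + 1) \<and>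
        (\<forall>\<mu>\<in>{0, 1}. \<forall>i < length P - m. S P ! (2 * i + \<mu>) = (\<Sum>j\<le>m. a \<mu> j *\<^sub>R P ! (i + j)))"
    "\<And>\<mu> i x. \<mu> \<in> {0, 1} \<Longrightarrow> i < 2 * m + 1 \<Longrightarrow>
        (\<Sum>j<2 * m + 1. A \<mu> i j * x j) = lin_sub m a x (\<mu> + i)"
proof -
  have S: "linear_scheme m S" and A: "\<forall>\<mu>\<in>{0, 1}. \<forall>p. length p = 2 * m + 1 \<longrightarrow>
        self_map m S \<mu> p = map (\<lambda>i. \<Sum>j<2 * m + 1. A \<mu> i j *\<^sub>R p ! j) [0..<2 * m + 1]"
    using assms unfolding linear_scheme_of_def by blast+
  obtain a where a: "\<forall>\<mu>\<in>{0, 1}. (\<Sum>j\<le>m. a \<mu> j) = 1"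
    "\<forall>P. length P \<ge> 2 * m + 1 \<longrightarrow> length (S P) = 2 * length P + 1 - (2 * m + 1) \<and>
        (\<forall>\<mu>\<in>{0, 1}. \<forall>i < length P - m. S P ! (2 * i + \<mu>) = (\<Sum>j\<le>m. a \<mu> j *\<^sub>R P ! (i + j)))"
    using S unfolding linear_scheme_def by (elim exE conjE) (rule that)
  have scheme: "length (S P) = 2 * length P + 1 - (2 * m + 1) \<and>
        (\<forall>\<mu>\<in>{0, 1}. \<forall>i < length P - m. S P ! (2 * i + \<mu>) = (\<Sum>j\<le>m. a \<mu> j *\<^sub>R P ! (i + j)))"
    if "length P \<ge> 2 * m + 1" for P using a(2) that by simp
  show ?thesis
  proof (rule that[of a])
    show "(\<Sum>j\<le>m. a \<mu> j) = 1" if "\<mu> \<in> {0, 1}" for \<mu> using bspec[OF a(1) that] .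
    fix \<mu> i :: nat and x :: "nat \<Rightarrow> real"
    assume \<mu>: "\<mu> \<in> {0, 1}" and i: "i < 2 * m + 1"
    define p :: "'d chain" where "p = map (\<lambda>j. x j *\<^sub>R e_vec) [0..<2 * m + 1]"
    have p: "length p = 2 * m + 1" by (simp add: p_def)
    have nthp: "p ! j $ first_coord = x j" if "j < 2 * m + 1" for j
      using that by (simp add: p_def e_vec_def del: upt_Suc)
    have len: "length (S p) = 2 * m + 2" using scheme[of p] p by simp
    have "self_map m S \<mu> p ! i = S p ! (\<mu> + i)"
      unfolding self_map_def using \<mu> i len by (intro nth_subchain) auto
    moreover have "self_map m S \<mu> p ! i = (\<Sum>j<2 * m + 1. A \<mu> i j *\<^sub>R p ! j)"
      using bspec[OF A \<mu>] p i by (simp del: upt_Suc sum.lessThan_Suc)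
    ultimately have "S p ! (\<mu> + i) = (\<Sum>j<2 * m + 1. A \<mu> i j *\<^sub>R p ! j)" by metis
    then have "S p ! (\<mu> + i) $ first_coord = (\<Sum>j<2 * m + 1. A \<mu> i j * (p ! j $ first_coord))"
      by (simp only: sum_component vector_scaleR_component real_scaleR_def)
    also have "\<dots> = (\<Sum>j<2 * m + 1. A \<mu> i j * x j)"
      by (intro sum.cong refl) (simp add: nthp)
    finally have 1: "S p ! (\<mu> + i) $ first_coord = (\<Sum>j<2 * m + 1. A \<mu> i j * x j)" .
    have lt: "\<mu> + i < 2 ^ 1 * 1 + 2 * m" using \<mu> i by auto
    have "length p = 1 + 2 * m" using p by simp
    from linear_scheme_iter[OF scheme this, of 1 first_coord]
    have "(S ^^ 1) p ! (\<mu> + i) $ first_coord = (lin_sub m a ^^ 1) (\<lambda>i. p ! i $ first_coord) (\<mu> + i)"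
      using lt by blast
    also have "\<dots> = (lin_sub m a ^^ 1) x (\<mu> + i)"
      by (rule lin_sub_iter_cong[where L = 1, OF _ lt]) (simp add: nthp)
    finally show "(\<Sum>j<2 * m + 1. A \<mu> i j * x j) = lin_sub m a x (\<mu> + i)" using 1 by simp
  qed (rule scheme)
qed

lemma differentiable_glue_schemeI:
  fixes G :: "'d::{finite,linorder} chain \<Rightarrow> 'd chain"
  assumes glue: "glue_scheme m G" and assoc: "associated_matrices m G A B"
    and a: "\<And>\<mu> i x. \<mu> \<in> {0, 1} \<Longrightarrow> i < 2 * m + 1 \<Longrightarrow> (\<Sum>j<2 * m + 1. A \<mu> i j * x j) = lin_sub m a x (\<mu> + i)"
    and b: "\<And>\<mu> i x. \<mu> \<in> {0, 1} \<Longrightarrow> i < 2 * m + 1 \<Longrightarrow> (\<Sum>j<2 * m + 1. B \<mu> i j * x j) = lin_sub m b x (\<mu> + i)"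
  obtains \<tau> where "differentiable_glue_scheme m G \<tau> a b"
proof -
  let ?E = "perturbed_line m (\<lambda>_. 0) :: 'd chain"
  have loc: "local_scheme m G" using glue_scheme_local[OF glue] .
  obtain \<tau> where \<tau>: "G (E_chain (2 * m + 1)) =
      map (\<lambda>p. (1 / 2) *\<^sub>R (p + (real m + \<tau>) *\<^sub>R e_vec)) (E_chain (2 * m + 1 + 1))"
    using glue unfolding glue_scheme_def Let_def by blast
  have len: "length (G p) = 2 * m + 2" if "length p = 2 * m + 1" for p
    using local_scheme_length_iter[OF loc, of p 1 1] that by simp
  have "differentiable_glue_scheme m G \<tau> a b"
  proof
    show "local_scheme m G" by (rule loc)
    show "G (map S P) = map S (G P)" if "similarity S" "length P \<ge> 2 * m + 1" for S P
      using glue that unfolding glue_scheme_def Let_def by blast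
    show "G ?E ! k = ((real k + 1 + real m + \<tau>) / 2) *\<^sub>R e_vec" if "k \<le> 2 * m + 1" for k
    proof -
      have "E_chain (2 * m + 1 + 1) ! k = real (k + 1) *\<^sub>R (e_vec :: 'd point)"
        "length (E_chain (2 * m + 1 + 1) :: 'd chain) = 2 * m + 1 + 1"
        using that by (simp_all add: E_chain_def del: upt_Suc)
      then have "G ?E ! k = (1 / 2) *\<^sub>R (real (k + 1) *\<^sub>R e_vec + (real m + \<tau>) *\<^sub>R e_vec)"
        using that unfolding perturbed_line_0 \<tau> by (simp only: nth_map less_Suc_eq_le Suc_eq_plus1[symmetric])
      also have "\<dots> = ((real k + 1 + real m + \<tau>) / 2) *\<^sub>R e_vec"
        unfolding scaleR_left_distrib[symmetric] scaleR_scaleR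
        by (rule arg_cong[where f = "\<lambda>s. s *\<^sub>R e_vec"]) simp
      finally show ?thesis .
    qed
    fix \<epsilon> :: real assume \<epsilon>: "\<epsilon> > 0"
    show "\<exists>\<delta>>0. \<forall>k\<le>2 * m + 1. \<forall>x c. 0 \<le> c \<longrightarrow> c < \<delta> \<longrightarrow> (\<forall>i<2 * m + 1. norm (x i) \<le> c) \<longrightarrow>
      norm (G (perturbed_line m x) ! k - G ?E ! k - split_sub m a b x k) \<le> \<epsilon> * c"
    proof (rule uniform_delta)
      fix k :: nat assume k: "k \<le> 2 * m + 1"
      \<comment> \<open>The two self-maps together cover the image: index 0 occurs only for parity
        0, index \<open>2 * m + 1\<close> only for parity 1.\<close>
      obtain \<mu> i :: nat where \<mu>: "\<mu> \<in> {0, 1}" "i < 2 * m + 1" "k = \<mu> + i"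
      proof (cases k)
        case 0
        then show ?thesis using that[of 0 0] by simp
      next
        case (Suc k')
        then show ?thesis using that[of 1 k'] k by simp
      qed
      have "has_chain_derivative (\<lambda>p. self_map m G \<mu> p ! i)
          (\<lambda>d. split_action (2 * m + 1) (A \<mu>) (B \<mu>) d ! i) (E_chain (2 * m + 1))"
        using assoc \<mu> unfolding associated_matrices_def by blast
      then obtain \<delta> where \<delta>: "\<delta> > 0" "\<And>d. length d = 2 * m + 1 \<Longrightarrow> chain_seminorm 0 d < \<delta> \<Longrightarrow>
        norm (self_map m G \<mu> (chain_add ?E d) ! i - self_map m G \<mu> ?E ! i -
          split_action (2 * m + 1) (A \<mu>) (B \<mu>) d ! i) \<le> \<epsilon> * chain_seminorm 0 d"
        using \<epsilon> unfolding has_chain_derivative_def perturbed_line_0[symmetric] length_perturbed_line by blast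
      have self: "self_map m G \<mu> p ! i = G p ! k" if "length p = 2 * m + 1" for p
        unfolding self_map_def \<mu>(3) using \<mu> len[OF that] by (intro nth_subchain) auto
      have "norm (G (perturbed_line m x) ! k - G ?E ! k - split_sub m a b x k) \<le> \<epsilon> * c"
        if c: "0 \<le> c" "c < \<delta>" and x: "\<forall>i<2 * m + 1. norm (x i) \<le> c" for x c
      proof -
        define d where "d = map x [0..<2 * m + 1]"
        have d: "length d = 2 * m + 1" by (simp add: d_def)
        have nthd: "d ! j = x j" if "j < 2 * m + 1" for j using that by (simp add: d_def del: upt_Suc)
        have dc: "chain_seminorm 0 d \<le> c"
          using d x nthd by (intro chain_seminorm_0_le) auto
        have add: "chain_add ?E d = perturbed_line m x"
          by (rule nth_equalityI) (simp_all add: chain_add_def d nthd nth_perturbed_line)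
        have split: "split_action (2 * m + 1) (A \<mu>) (B \<mu>) d ! i = split_sub m a b x k"
        proof (rule vec_eq_iff[THEN iffD2], rule allI)
          fix cc :: 'd
          have "split_action (2 * m + 1) (A \<mu>) (B \<mu>) d ! i $ cc =
              (if cc = first_coord then \<Sum>j<2 * m + 1. A \<mu> i j * (d ! j $ cc) else \<Sum>j<2 * m + 1. B \<mu> i j * (d ! j $ cc))"
            unfolding split_action_def using \<mu>(2) by (simp del: upt_Suc sum.lessThan_Suc)
          also have "(\<Sum>j<2 * m + 1. A \<mu> i j * (d ! j $ cc)) = (\<Sum>j<2 * m + 1. A \<mu> i j * (x j $ cc))"
            by (intro sum.cong refl) (simp add: nthd)
          also have "(\<Sum>j<2 * m + 1. B \<mu> i j * (d ! j $ cc)) = (\<Sum>j<2 * m + 1. B \<mu> i j * (x j $ cc))"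
            by (intro sum.cong refl) (simp add: nthd)
          also have "(if cc = first_coord then \<Sum>j<2 * m + 1. A \<mu> i j * (x j $ cc) else \<Sum>j<2 * m + 1. B \<mu> i j * (x j $ cc)) =
              split_sub m a b x k $ cc"
            unfolding a[OF \<mu>(1,2)] b[OF \<mu>(1,2)] by (simp add: split_sub_def \<mu>(3))
          finally show "split_action (2 * m + 1) (A \<mu>) (B \<mu>) d ! i $ cc = split_sub m a b x k $ cc" .
        qed
        have "norm (G (perturbed_line m x) ! k - G ?E ! k - split_sub m a b x k) \<le> \<epsilon> * chain_seminorm 0 d"
          using \<delta>(2)[OF d] dc c unfolding add split by (simp only: self length_perturbed_line)
        also have "\<dots> \<le> \<epsilon> * c" using dc \<epsilon> by (intro mult_left_mono) auto
        finally show ?thesis .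
      qed
      then show "\<exists>\<delta>>0. \<forall>x c. 0 \<le> c \<longrightarrow> c < \<delta> \<longrightarrow> (\<forall>i<2 * m + 1. norm (x i) \<le> c) \<longrightarrow>
        norm (G (perturbed_line m x) ! k - G ?E ! k - split_sub m a b x k) \<le> \<epsilon> * c"
        using \<delta>(1) by blast
    qed auto
  qed
  then show ?thesis using that by blast
qed

theorem theorem6p1:
  fixes G \<A> \<B> :: "'d::{finite,linorder} chain \<Rightarrow> 'd chain"
    and A B :: "nat \<Rightarrow> nat \<Rightarrow> nat \<Rightarrow> real"
    and P :: "'d chain" and m :: nat and \<alpha> :: real
  assumes "CARD('d) \<ge> 2"
    and "glue_scheme m G"
    and "associated_matrices m G A B"
    and "linear_scheme_of m A \<A>"
    and "linear_scheme_of m B \<B>"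
    and "0 < \<alpha>" and "\<alpha> \<le> 1"
    and "length P \<ge> 2 * m + 1"
    and "straightened m G P"
    and "almost_Ck_holder_linear 1 \<alpha> m \<A>"
    and "almost_Ck_holder_linear 1 \<alpha> m \<B>"
  shows "almost_Ck_holder_at 1 \<alpha> m G P"
proof -
  have m: "m \<ge> 1" using assms(2) by (simp add: glue_scheme_def)
  obtain a where a: "\<And>\<mu>. \<mu> \<in> {0, 1} \<Longrightarrow> (\<Sum>j\<le>m. a \<mu> j) = 1"
    "\<And>P. length P \<ge> 2 * m + 1 \<Longrightarrow> length (\<A> P) = 2 * length P + 1 - (2 * m + 1) \<and>
        (\<forall>\<mu>\<in>{0, 1}. \<forall>i < length P - m. \<A> P ! (2 * i + \<mu>) = (\<Sum>j\<le>m. a \<mu> j *\<^sub>R P ! (i + j)))"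
    "\<And>\<mu> i x. \<mu> \<in> {0, 1} \<Longrightarrow> i < 2 * m + 1 \<Longrightarrow> (\<Sum>j<2 * m + 1. A \<mu> i j * x j) = lin_sub m a x (\<mu> + i)"
    using linear_scheme_of_weights[OF assms(4)] by blast
  obtain b where b: "\<And>\<mu>. \<mu> \<in> {0, 1} \<Longrightarrow> (\<Sum>j\<le>m. b \<mu> j) = 1"
    "\<And>P. length P \<ge> 2 * m + 1 \<Longrightarrow> length (\<B> P) = 2 * length P + 1 - (2 * m + 1) \<and>
        (\<forall>\<mu>\<in>{0, 1}. \<forall>i < length P - m. \<B> P ! (2 * i + \<mu>) = (\<Sum>j\<le>m. b \<mu> j *\<^sub>R P ! (i + j)))"
    "\<And>\<mu> i x. \<mu> \<in> {0, 1} \<Longrightarrow> i < 2 * m + 1 \<Longrightarrow> (\<Sum>j<2 * m + 1. B \<mu> i j * x j) = lin_sub m b x (\<mu> + i)"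
    using linear_scheme_of_weights[OF assms(5)] by blast
  obtain \<tau> where "differentiable_glue_scheme m G \<tau> a b"
    using differentiable_glue_schemeI[OF assms(2,3) a(3) b(3)] by blast
  then interpret G: differentiable_glue_scheme m G \<tau> a b .
  \<comment> \<open>The matrices \<open>B\<close> act on the coordinates other than the first. In
    dimension at least 2 such a coordinate \<open>c\<close> exists, and
    \<open>lin_sub_moment\<close> for \<open>c\<close> yields the first moments of
    \<open>b\<close>.\<close>
  have "\<not> (UNIV :: 'd set) \<subseteq> {first_coord}"
    using assms(1) card_mono[of "{first_coord :: 'd}" UNIV] by auto
  then obtain c :: 'd where c: "c \<noteq> first_coord" by blast
  interpret A: smooth_linear_scheme m a \<A> "real m + \<tau> - 1" \<alpha>
    using a assms G.lin_sub_moment[of _ first_coord] by unfold_locales auto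
  interpret B: smooth_linear_scheme m b \<B> "real m + \<tau> - 1" \<alpha>
    using b assms G.lin_sub_moment[of _ c] c by unfold_locales auto
  show ?thesis
    unfolding almost_Ck_holder_at_def
  proof (intro allI impI)
    fix \<beta> assume \<beta>: "0 < \<beta> \<and> \<beta> < \<alpha>"
    \<comment> \<open>The linear schemes provide rates for exponents below \<open>\<alpha>\<close>,
      and the nonlinear argument gives up a little of the exponent; the midpoint leaves room for
      both.\<close>
    define \<beta>1 where "\<beta>1 = (\<beta> + \<alpha>) / 2"
    have \<beta>1: "0 < \<beta>1" "\<beta>1 < \<alpha>" "\<beta> < \<beta>1" using \<beta> by (auto simp: \<beta>1_def)
    define L where "L = length P - 2 * m"
    have L: "length P = L + 2 * m" "L \<ge> 1" using assms(8) by (auto simp: L_def)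
    show "Ck_holder_at 1 \<beta> m G P"
      using G.holder_at_straightened[OF m L _ \<beta>1(3) assms(9)] \<beta>
        A.second_diff_decay[OF \<beta>1(1,2) m] B.second_diff_decay[OF \<beta>1(1,2) m] by blast
  qed
qed

end
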